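(* Let $X$ be a finite connected CW complex, let $1\le d\le \dim X$, let $E\colon X_{d-1}\to\mathbb{R}$ be a function, let $\beta>0$, and let $x\in H_{d-1}(X;\mathbb{R})$. Then the unique cycle $\rho\in Z_{d-1}(X;\mathbb{R})$ such that $\rho$ represents $x$ and $\partial_E^*\rho=0$ is $\rho=\Psi(x)$, where $\Psi\colon H_{d-1}(X;\mathbb{R})\to Z_{d-1}(X;\mathbb{R})$ is the homomorphism $$\Psi=\frac{1}{\nabla}\sum_L \tau_L\,\psi_L,\qquad \nabla=\sum_L\tau_L,$$ and both sums run over all $(d-1)$-dimensional spanning co-trees $L$ of $X$.
   Context: $X_k$ is the set of $k$-cells of $X$, $X^{(k)}$ the $k$-skeleton, $C_*(X;\mathbb{F})$ the cellular chain complex with coefficients in $\mathbb{F}$, and $Z_k$, $B_k$ its cycles and boundaries; $\beta_k(X)=\dim H_k(X;\mathbb{Q})$. Each $C_k(X;\mathbb{R})$ has the standard inner product $\langle -,-\rangle$ for which $X_k$ is an orthonormal basis. On $C_{d-1}(X;\mathbb{R})$ the modified inner product is determined by $\langle a,b\rangle_E=e^{\beta E(a)}\langle a,b\rangle$ for $a,b\in X_{d-1}$. The map $\partial_E^*\colon C_{d-1}(X;\mathbb{R})\to C_d(X;\mathbb{R})$ is the adjoint of $\partial\colon C_d(X;\mathbb{R})\to C_{d-1}(X;\mathbb{R})$ with respect to the standard inner product on $C_d(X;\mathbb{R})$ and $\langle-,-\rangle_E$ on $C_{d-1}(X;\mathbb{R})$; that is, $\partial^*_E=\partial^*e^{\beta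 E}$, where $\partial^*$ is the adjoint for the standard inner products and $e^{\beta E}$ multiplies each cell $f\in X_{d-1}$ by $e^{\beta E_f}$. A $(d-1)$-dimensional spanning co-tree of $X$ is a subcomplex $L\subset X$ such that (a) the inclusion induces an isomorphism $H_{d-1}(L;\mathbb{Q})\to H_{d-1}(X;\mathbb{Q})$; (b) $\beta_{d-2}(L)=\beta_{d-2}(X)$; (c) $X^{(d-2)}\subset L\subset X^{(d-1)}$. For such $L$, let $\phi_L\colon Z_{d-1}(L;\mathbb{Z})\cong H_{d-1}(L;\mathbb{Z})\to H_{d-1}(X;\mathbb{Z})$ be the map induced by the inclusion (the first map is an isomorphism as $L$ has no $d$-cells); it is an isomorphism after tensoring with $\mathbb{Q}$. Let $\psi_L\colon H_{d-1}(X;\mathbb{Q})\to Z_{d-1}(X;\mathbb{Q})$ be the composite of $(\phi_L\otimes\mathbb{Q})^{-1}\colon H_{d-1}(X;\mathbb{Q})\to Z_{d-1}(L;\mathbb{Q})$ with the inclusion $Z_{d-1}(L;\mathbb{Q})\subset Z_{d-1}(X;\mathbb{Q})$; the same symbol denotes its extension to real coefficients. The group $H_{d-1}(X,L;\mathbb{Z})$ is finite; $a_L$ denotes its order. The weight of $L$ is $\tau_L=a_L^2\prod_{b\in L_{d-1}}e^{-\beta E_b}$, where $L_{d-1}$ is the set of $(d-1)$-cells of $L$. *)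

theory Defs
  imports
    "HOL-Homology.Homology"
    "HOL-Library.Set_Algebras"
    "HOL-Library.Function_Algebras"
    "Jordan_Normal_Form.VS_Connect"
begin

section \<open>Finite CW complexes\<close>

text \<open>Closed disc, bounding sphere and open disc of dimension \<open>n\<close>, inside the library's
  \<open>Euclidean_space n\<close>. For \<open>n = 0\<close> the disc is a point and the sphere is empty.\<close>

definition disc :: "nat \<Rightarrow> (nat \<Rightarrow> real) topology" where
  "disc n = subtopology (Euclidean_space n) {u. (\<Sum>i<n. (u i)\<^sup>2) \<le> 1}"

definition disc_sphere :: "nat \<Rightarrow> (nat \<Rightarrow> real) set" where
  "disc_sphere n = {u \<in> topspace (disc n). (\<Sum>i<n. (u i)\<^sup>2) = 1}"

definition open_disc :: "nat \<Rightarrow> (nat \<Rightarrow> real) set" where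
  "open_disc n = {u \<in> topspace (disc n). (\<Sum>i<n. (u i)\<^sup>2) < 1}"

record ('a, 'c) cw_complex =
  cw_top :: "'a topology"
  cw_cells :: "'c set"
  cw_dim :: "'c \<Rightarrow> nat"
  cw_map :: "'c \<Rightarrow> (nat \<Rightarrow> real) \<Rightarrow> 'a"

text \<open>The point set covered by a set \<open>A\<close> of cells: the union of the corresponding open cells.\<close>

definition cw_points :: "('a, 'c) cw_complex \<Rightarrow> 'c set \<Rightarrow> 'a set" where
  "cw_points X A = (\<Union>c\<in>A. cw_map X c ` open_disc (cw_dim X c))"

definition cw_skel :: "('a, 'c) cw_complex \<Rightarrow> int \<Rightarrow> 'c set" where
  "cw_skel X k = {c \<in> cw_cells X. int (cw_dim X c) \<le> k}"

definition cw_kcells :: "('a, 'c) cw_complex \<Rightarrow> int \<Rightarrow> 'c set" where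
  "cw_kcells X k = {c \<in> cw_cells X. int (cw_dim X c) = k}"

text \<open>With finitely many cells, closure-finiteness is automatic and the weak topology is forced
  by the Hausdorff property; likewise each characteristic map is automatically a homeomorphism
  from the open disc onto its open cell. The bijection says that the space is the disjoint union
  of the open cells and that characteristic maps are injective on open discs.\<close>

locale finite_cw_complex =
  fixes X :: "('a, 'c) cw_complex"
  assumes hausdorff: "Hausdorff_space (cw_top X)"
    and finite_cells: "finite (cw_cells X)"
    and continuous_cw_map:
      "c \<in> cw_cells X \<Longrightarrow> continuous_map (disc (cw_dim X c)) (cw_top X) (cw_map X c)"
    and open_cells_partition:
      "bij_betw (\<lambda>(c, u). cw_map X c u) (SIGMA c:cw_cells X. open_disc (cw_dim X c))
         (topspace (cw_top X))"
    and attaching: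
      "c \<in> cw_cells X \<Longrightarrow> cw_map X c ` disc_sphere (cw_dim X c)
         \<subseteq> cw_points X (cw_skel X (int (cw_dim X c) - 1))"

definition cw_dimension :: "('a, 'c) cw_complex \<Rightarrow> nat" where
  "cw_dimension X = (SUP c\<in>cw_cells X. cw_dim X c)"

text \<open>Subcomplexes are represented by their sets of cells.\<close>

definition cw_subcomplex :: "('a, 'c) cw_complex \<Rightarrow> 'c set \<Rightarrow> bool" where
  "cw_subcomplex X A \<longleftrightarrow> A \<subseteq> cw_cells X \<and>
     (\<forall>c\<in>A. cw_map X c ` topspace (disc (cw_dim X c)) \<subseteq> cw_points X A)"

section \<open>The cellular chain complex\<close>

text \<open>The cellular chain group over the integers, as the singular homology group
  \<open>H\<^sub>k(X\<^sup>(\<^sup>k\<^sup>), X\<^sup>(\<^sup>k\<^sup>-\<^sup>1\<^sup>))\<close>, written multiplicatively in the library. It is free abelian on the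
  classes of the \<open>k\<close>-cells, each being the image under the characteristic map of a
  generator of \<open>H\<^sub>k(D\<^sup>k, S\<^sup>k\<^sup>-\<^sup>1)\<close>, chosen once for each \<open>k\<close>.\<close>

definition cellular_group :: "('a, 'c) cw_complex \<Rightarrow> int \<Rightarrow> 'a chain set monoid" where
  "cellular_group X k = relative_homology_group k
     (subtopology (cw_top X) (cw_points X (cw_skel X k))) (cw_points X (cw_skel X (k - 1)))"

definition disc_generator :: "nat \<Rightarrow> (nat \<Rightarrow> real) chain set" where
  "disc_generator n =
     (let G = relative_homology_group (int n) (disc n) (disc_sphere n)
      in SOME g. g \<in> carrier G \<and> subgroup_generated G {g} = G)"

definition cell_class :: "('a, 'c) cw_complex \<Rightarrow> 'c \<Rightarrow> 'a chain set" where
  "cell_class X c =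
     (let n = cw_dim X c; k = int n
      in hom_induced k (disc n) (disc_sphere n)
           (subtopology (cw_top X) (cw_points X (cw_skel X k))) (cw_points X (cw_skel X (k - 1)))
           (cw_map X c) (disc_generator n))"

text \<open>\<open>hom_relboundary\<close> is the connecting map \<open>H\<^sub>k(X\<^sup>(\<^sup>k\<^sup>), X\<^sup>(\<^sup>k\<^sup>-\<^sup>1\<^sup>)) \<rightarrow> H\<^sub>k\<^sub>-\<^sub>1(X\<^sup>(\<^sup>k\<^sup>-\<^sup>1\<^sup>), X\<^sup>(\<^sup>k\<^sup>-\<^sup>2\<^sup>))\<close>
  of the triple.\<close>

definition cellular_boundary :: "('a, 'c) cw_complex \<Rightarrow> int \<Rightarrow> 'a chain set \<Rightarrow> 'a chain set" where
  "cellular_boundary X k = hom_relboundary k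
     (subtopology (cw_top X) (cw_points X (cw_skel X k)))
     (cw_points X (cw_skel X (k - 1))) (cw_points X (cw_skel X (k - 2)))"

text \<open>The coefficients of the boundary of the cell \<open>b\<close> in the basis of cells of one
  dimension less.\<close>

definition incidence :: "('a, 'c) cw_complex \<Rightarrow> 'c \<Rightarrow> 'c \<Rightarrow> int" where
  "incidence X b =
     (let k = int (cw_dim X b); G = cellular_group X (k - 1)
      in THE m. (\<forall>a. a \<notin> cw_kcells X (k - 1) \<longrightarrow> m a = 0) \<and>
           cellular_boundary X k (cell_class X b)
             = finprod G (\<lambda>a. cell_class X a [^]\<^bsub>G\<^esub> m a) (cw_kcells X (k - 1)))"

text \<open>Chains with coefficients in \<open>'f\<close> are coefficient functions supported on cells. The complex
  of a subcomplex \<open>A\<close> is the span of the cells of \<open>A\<close> in that of \<open>X\<close>; taking \<open>A = cw_cells X\<close>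
  gives \<open>X\<close> itself.\<close>

definition cell_chains :: "('a, 'c) cw_complex \<Rightarrow> 'c set \<Rightarrow> int \<Rightarrow> ('c \<Rightarrow> 'f::comm_ring_1) set" where
  "cell_chains X A k = {z. \<forall>c. c \<notin> A \<inter> cw_kcells X k \<longrightarrow> z c = 0}"

definition bd :: "('a, 'c) cw_complex \<Rightarrow> int \<Rightarrow> ('c \<Rightarrow> 'f::comm_ring_1) \<Rightarrow> 'c \<Rightarrow> 'f" where
  "bd X k z = (\<lambda>a. if a \<in> cw_kcells X (k - 1)
                   then \<Sum>b\<in>cw_kcells X k. of_int (incidence X b a) * z b else 0)"

definition cycles :: "('a, 'c) cw_complex \<Rightarrow> 'c set \<Rightarrow> int \<Rightarrow> ('c \<Rightarrow> 'f::comm_ring_1) set" where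
  "cycles X A k = {z \<in> cell_chains X A k. bd X k z = 0}"

definition boundaries :: "('a, 'c) cw_complex \<Rightarrow> 'c set \<Rightarrow> int \<Rightarrow> ('c \<Rightarrow> 'f::comm_ring_1) set" where
  "boundaries X A k = bd X (k + 1) ` cell_chains X A (k + 1)"

text \<open>Cycles and boundaries of the quotient complex \<open>C\<^sub>*(X) / C\<^sub>*(A)\<close>, pulled back to
  \<open>C\<^sub>*(X)\<close>.\<close>

definition rel_cycles :: "('a, 'c) cw_complex \<Rightarrow> 'c set \<Rightarrow> int \<Rightarrow> ('c \<Rightarrow> 'f::comm_ring_1) set" where
  "rel_cycles X A k = {z \<in> cell_chains X (cw_cells X) k. bd X k z \<in> cell_chains X A (k - 1)}"

definition rel_boundaries :: "('a, 'c) cw_complex \<Rightarrow> 'c set \<Rightarrow> int \<Rightarrow> ('c \<Rightarrow> 'f::comm_ring_1) set" where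
  "rel_boundaries X A k = boundaries X (cw_cells X) k + cell_chains X A k"

section \<open>Homology\<close>

text \<open>Modules over \<open>class_ring\<close>, the ring record of the coefficient type. The fields \<open>mult\<close> and
  \<open>one\<close> of the module record play no role.\<close>

definition fun_module :: "('c \<Rightarrow> 'f::comm_ring_1) set \<Rightarrow> ('f, 'c \<Rightarrow> 'f) module" where
  "fun_module Z = \<lparr>carrier = Z, mult = undefined, one = undefined, zero = 0, add = (+),
     smult = (\<lambda>r z a. r * z a)\<rparr>"

text \<open>The quotient \<open>Z / B\<close>, whose elements are the cosets of \<open>B\<close>; adding \<open>B\<close> in the scalar
  multiplication matters only for non-invertible scalars.\<close>

definition quot_module ::
    "('c \<Rightarrow> 'f::comm_ring_1) set \<Rightarrow> ('c \<Rightarrow> 'f) set \<Rightarrow> ('f, ('c \<Rightarrow> 'f) set) module" where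
  "quot_module Z B = \<lparr>carrier = (\<lambda>z. z +o B) ` Z, mult = undefined, one = undefined,
     zero = B, add = (+), smult = (\<lambda>r S. (\<lambda>z a. r * z a) ` S + B)\<rparr>"

definition homology ::
    "('a, 'c) cw_complex \<Rightarrow> 'c set \<Rightarrow> int \<Rightarrow> ('f::comm_ring_1, ('c \<Rightarrow> 'f) set) module" where
  "homology X A k = quot_module (cycles X A k) (boundaries X A k)"

definition rel_homology ::
    "('a, 'c) cw_complex \<Rightarrow> 'c set \<Rightarrow> int \<Rightarrow> ('f::comm_ring_1, ('c \<Rightarrow> 'f) set) module" where
  "rel_homology X A k = quot_module (rel_cycles X A k) (rel_boundaries X A k)"

definition betti :: "('a, 'c) cw_complex \<Rightarrow> 'c set \<Rightarrow> int \<Rightarrow> nat" where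
  "betti X A k =
     vectorspace.dim (class_ring :: rat ring) (homology X A k :: (rat, ('c \<Rightarrow> rat) set) module)"

definition incl_induced ::
    "('a, 'c) cw_complex \<Rightarrow> int \<Rightarrow> ('c \<Rightarrow> 'f::comm_ring_1) set \<Rightarrow> ('c \<Rightarrow> 'f) set" where
  "incl_induced X k S = S + boundaries X (cw_cells X) k"

section \<open>Spanning co-trees\<close>

text \<open>Degrees are integers so that \<open>d = 1\<close> gives the empty \<open>(-1)\<close>-skeleton and \<open>H\<^sub>-\<^sub>1 = 0\<close>.\<close>

definition spanning_cotree :: "('a, 'c) cw_complex \<Rightarrow> nat \<Rightarrow> 'c set \<Rightarrow> bool" where
  "spanning_cotree X d L \<longleftrightarrow>
     cw_subcomplex X L \<and>
     (let H\<^sub>L = homology X L (int d - 1) :: (rat, ('c \<Rightarrow> rat) set) module;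
          H\<^sub>X = homology X (cw_cells X) (int d - 1) :: (rat, ('c \<Rightarrow> rat) set) module
      in mod_hom class_ring H\<^sub>L H\<^sub>X (incl_induced X (int d - 1)) \<and>
         bij_betw (incl_induced X (int d - 1)) (carrier H\<^sub>L) (carrier H\<^sub>X)) \<and>
     betti X L (int d - 2) = betti X (cw_cells X) (int d - 2) \<and>
     cw_skel X (int d - 2) \<subseteq> L \<and> L \<subseteq> cw_skel X (int d - 1)"

text \<open>\<open>phi\<close> is \<open>\<phi>\<^sub>L\<close> with coefficients in \<open>'f\<close>, as a map on \<open>cycles X L (int d - 1)\<close>; it sends a
  cycle of \<open>L\<close> to its class in \<open>X\<close>. In particular its rational instance is \<open>\<phi>\<^sub>L \<otimes> \<rat>\<close>.\<close>

definition phi ::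
    "('a, 'c) cw_complex \<Rightarrow> nat \<Rightarrow> ('c \<Rightarrow> 'f::comm_ring_1) \<Rightarrow> ('c \<Rightarrow> 'f) set" where
  "phi X d z = z +o boundaries X (cw_cells X) (int d - 1)"

definition psi_rat ::
    "('a, 'c) cw_complex \<Rightarrow> nat \<Rightarrow> 'c set \<Rightarrow> ('c \<Rightarrow> rat) set \<Rightarrow> 'c \<Rightarrow> rat" where
  "psi_rat X d L = the_inv_into (cycles X L (int d - 1)) (phi X d)"

definition real_chain :: "('c \<Rightarrow> rat) \<Rightarrow> 'c \<Rightarrow> real" where
  "real_chain z = (\<lambda>c. of_rat (z c))"

definition real_class ::
    "('a, 'c) cw_complex \<Rightarrow> int \<Rightarrow> ('c \<Rightarrow> rat) set \<Rightarrow> ('c \<Rightarrow> real) set" where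
  "real_class X k S = real_chain ` S + boundaries X (cw_cells X) k"

text \<open>The extension of \<open>psi_rat\<close> to real coefficients: the \<open>\<real>\<close>-linear map agreeing with it on
  rational classes.\<close>

definition psi ::
    "('a, 'c) cw_complex \<Rightarrow> nat \<Rightarrow> 'c set \<Rightarrow> ('c \<Rightarrow> real) set \<Rightarrow> 'c \<Rightarrow> real" where
  "psi X d L =
     (let H = homology X (cw_cells X) (int d - 1) :: (real, ('c \<Rightarrow> real) set) module
      in THE g. g \<in> extensional (carrier H) \<and>
           mod_hom class_ring H (fun_module (cycles X (cw_cells X) (int d - 1))) g \<and>
           (\<forall>x \<in> carrier (homology X (cw_cells X) (int d - 1) :: (rat, ('c \<Rightarrow> rat) set) module).
              g (real_class X (int d - 1) x) = real_chain (psi_rat X d L x)))"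

definition cotree_index :: "('a, 'c) cw_complex \<Rightarrow> nat \<Rightarrow> 'c set \<Rightarrow> nat" where
  "cotree_index X d L = Coset.order (rel_homology X L (int d - 1) :: (int, ('c \<Rightarrow> int) set) module)"

definition tau ::
    "('a, 'c) cw_complex \<Rightarrow> nat \<Rightarrow> ('c \<Rightarrow> real) \<Rightarrow> real \<Rightarrow> 'c set \<Rightarrow> real" where
  "tau X d E \<beta> L =
     (real (cotree_index X d L))\<^sup>2 * (\<Prod>b \<in> L \<inter> cw_kcells X (int d - 1). exp (- \<beta> * E b))"

definition nabla :: "('a, 'c) cw_complex \<Rightarrow> nat \<Rightarrow> ('c \<Rightarrow> real) \<Rightarrow> real \<Rightarrow> real" where
  "nabla X d E \<beta> = (\<Sum>L | spanning_cotree X d L. tau X d E \<beta> L)"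

definition Psi ::
    "('a, 'c) cw_complex \<Rightarrow> nat \<Rightarrow> ('c \<Rightarrow> real) \<Rightarrow> real \<Rightarrow> ('c \<Rightarrow> real) set \<Rightarrow> 'c \<Rightarrow> real" where
  "Psi X d E \<beta> x = (\<lambda>b. 1 / nabla X d E \<beta> *
     (\<Sum>L | spanning_cotree X d L. tau X d E \<beta> L * psi X d L x b))"

section \<open>The adjoint boundary operator\<close>

definition chain_inner ::
    "('a, 'c) cw_complex \<Rightarrow> int \<Rightarrow> ('c \<Rightarrow> real) \<Rightarrow> ('c \<Rightarrow> real) \<Rightarrow> real" where
  "chain_inner X k y z = (\<Sum>b \<in> cw_kcells X k. y b * z b)"

definition chain_inner_E ::
    "('a, 'c) cw_complex \<Rightarrow> nat \<Rightarrow> ('c \<Rightarrow> real) \<Rightarrow> real \<Rightarrow> ('c \<Rightarrow> real) \<Rightarrow> ('c \<Rightarrow> real) \<Rightarrow> real" where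
  "chain_inner_E X d E \<beta> y z =
     (\<Sum>b \<in> cw_kcells X (int d - 1). exp (\<beta> * E b) * (y b * z b))"

definition bd_adjoint_E ::
    "('a, 'c) cw_complex \<Rightarrow> nat \<Rightarrow> ('c \<Rightarrow> real) \<Rightarrow> real \<Rightarrow> ('c \<Rightarrow> real) \<Rightarrow> 'c \<Rightarrow> real" where
  "bd_adjoint_E X d E \<beta> z =
     (THE w. w \<in> cell_chains X (cw_cells X) (int d) \<and>
        (\<forall>y \<in> cell_chains X (cw_cells X) (int d).
           chain_inner X (int d) y w = chain_inner_E X d E \<beta> (bd X (int d) y) z))"

end

theory Submission
  imports Defs
begin

text \<open>Write \<open>C\<close> for the chains of degree \<open>d - 1\<close>, \<open>B\<close> for the boundaries in it, and
\<open>\<langle>v, w\<rangle>\<^sub>E\<close> for the inner product weighted by \<open>e\<^sup>\<beta>\<^sup>E\<close>. A chain is killed by the adjoint boundary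
operator exactly if it is \<open>\<langle>-,-\<rangle>\<^sub>E\<close>-orthogonal to \<open>B\<close>. As the form is positive definite, two
representatives of \<open>x\<close> that are orthogonal to \<open>B\<close> coincide, their difference being in \<open>B\<close> and
orthogonal to it. It remains to see that \<open>\<Psi>(x)\<close> is a representative orthogonal to \<open>B\<close>.

Over the integers \<open>B\<close> is the row space of the matrix of incidence numbers, and the \<open>(d-1)\<close>-cells of
spanning co-trees are exactly the sets \<open>L\<close> for which the chains on \<open>L\<close> are a linear complement of \<open>B\<close>
in \<open>C\<close> (\<open>spanning_cotree_iff\<close>). In these terms \<open>\<psi>\<^sub>L\<close> is induced by the projection \<open>p\<^sub>L\<close> of \<open>C\<close> along
\<open>B\<close> onto the chains on \<open>L\<close> (\<open>psi_eq\<close>), and \<open>a\<^sub>L\<close> is the index of \<open>B + \<int>\<^sup>L\<close> in the lattice of integral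
chains (\<open>cotree_index_eq\<close>). Every \<open>p\<^sub>L z\<close> differs from \<open>z\<close> by a boundary, hence so does their weighted
mean; and the sum of the weights is positive, because a complement of \<open>B\<close> exists and has finite
index.

The heart is the orthogonality \<open>\<Sum>\<^sub>L \<tau>\<^sub>L \<langle>v, p\<^sub>L z\<rangle>\<^sub>E = 0\<close> for \<open>v \<in> B\<close>. It needs no determinants. Since
\<open>p\<^sub>L z\<close> lives on \<open>L\<close>, the left side is a sum over pairs of a co-tree \<open>L\<close> and a cell \<open>f \<in> L\<close>; the
factor \<open>e\<^sup>\<beta>\<^sup>E\<close> at \<open>f\<close> cancels the factor of \<open>f\<close> in \<open>\<tau>\<^sub>L\<close>. Collect the pairs by \<open>R = L - {f}\<close>, so that
only \<open>\<Sum>\<^sub>f a\<^sub>L\<^sup>2 (p\<^sub>L z)\<^sub>f v\<^sub>f\<close> with \<open>L = R \<union> {f}\<close> and fixed \<open>R\<close> matters. If some \<open>R \<union> {f}\<close> is a co-tree, the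
chains on \<open>R\<close> and \<open>B\<close> together span a hyperplane, the kernel of an integral functional \<open>\<lambda>\<close>; the
set \<open>R \<union> {f}\<close> is a co-tree if and only if \<open>\<lambda>\<^sub>f \<noteq> 0\<close> (\<open>circuit_functional\<close>), and then \<open>\<lambda>\<^sub>f (p\<^sub>L z)\<^sub>f = \<lambda>(p\<^sub>L z) = \<lambda>(z)\<close> and
\<open>a\<^sub>L = \<kappa> \<bar>\<lambda>\<^sub>f\<bar>\<close> with \<open>\<kappa>\<close> independent of \<open>f\<close> (\<open>lattice_index_circuit\<close>). So the inner sum is
\<open>\<kappa>\<^sup>2 \<lambda>(z) \<Sum>\<^sub>f \<lambda>\<^sub>f v\<^sub>f = \<kappa>\<^sup>2 \<lambda>(z) \<lambda>(v) = 0\<close>.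

All of this is linear algebra of the incidence matrices, once these are known to be well defined and
to satisfy \<open>\<partial>\<partial> = 0\<close>. The incidence numbers are defined through the singular homology of pairs of
skeleta, so both facts rest on \<open>H\<^sub>k(X\<^sup>(\<^sup>k\<^sup>), X\<^sup>(\<^sup>k\<^sup>-\<^sup>1\<^sup>))\<close> being free abelian on the \<open>k\<close>-cells
(\<open>cellular_group_basis\<close>). That is proved with one cell at a time, from the fact that the
characteristic map of an attached cell induces an isomorphism from the homology of the disc modulo
its sphere (\<open>characteristic_map_iso\<close>).\<close>

section \<open>Discs\<close>

definition rad :: "nat \<Rightarrow> (nat \<Rightarrow> real) \<Rightarrow> real" where
  "rad n u = sqrt (\<Sum>i<n. (u i)\<^sup>2)"

lemma rad_nonneg: "rad n u \<ge> 0"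
  by (simp add: rad_def sum_nonneg)

lemma rad_scale: "rad n (\<lambda>i. c * u i) = \<bar>c\<bar> * rad n u"
  by (simp add: rad_def power_mult_distrib real_sqrt_mult flip: sum_distrib_left)

lemma topspace_disc: "topspace (disc n) = {u. (\<forall>i\<ge>n. u i = 0) \<and> rad n u \<le> 1}"
  by (auto simp: disc_def rad_def topspace_Euclidean_space)

lemma disc_sphere_rad: "disc_sphere n = {u \<in> topspace (disc n). rad n u = 1}"
  by (auto simp: disc_sphere_def rad_def)

lemma open_disc_rad: "open_disc n = {u \<in> topspace (disc n). rad n u < 1}"
  by (auto simp: open_disc_def rad_def)

lemma topspace_disc_split: "topspace (disc n) = open_disc n \<union> disc_sphere n"
  by (auto simp: open_disc_rad disc_sphere_rad topspace_disc)

lemma open_disc_eq: "open_disc n = topspace (disc n) - disc_sphere n"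
  by (auto simp: disc_sphere_rad open_disc_rad topspace_disc)

lemma disc_eq_top_of_set: "disc n = top_of_set (topspace (disc n))"
  by (simp add: disc_def Euclidean_space_def subtopology_subtopology euclidean_product_topology)

lemma continuous_on_component: "continuous_on S (\<lambda>u::nat \<Rightarrow> real. u i)"
  by (rule continuous_on_subset[OF continuous_on_product_coordinates]) simp

lemma continuous_on_rad: "continuous_on S (rad n)"
  unfolding rad_def by (intro continuous_intros continuous_on_component)

lemma compact_space_disc: "compact_space (disc n)"
proof -
  let ?D = "{u::nat \<Rightarrow> real. (\<forall>i\<ge>n. u i = 0) \<and> rad n u \<le> 1}"
  have "compact (PiE UNIV (\<lambda>i::nat. {-1..1::real}))"
    using compactin_PiE[of "\<lambda>i::nat. euclideanreal" UNIV "\<lambda>i. {-1..1}"]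
    by (simp add: euclidean_product_topology)
  moreover have "closed ?D"
  proof -
    have "?D = (\<Inter>i\<in>{n..}. {u. u i = 0}) \<inter> {u. rad n u \<le> 1}"
      by auto
    moreover have "closed (\<Inter>i\<in>{n..}. {u::nat \<Rightarrow> real. u i = 0})"
      by (intro closed_INT ballI closed_Collect_eq[OF continuous_on_component continuous_on_const])
    moreover have "closed {u::nat \<Rightarrow> real. rad n u \<le> 1}"
      by (rule closed_Collect_le[OF continuous_on_rad continuous_on_const])
    ultimately show ?thesis
      by (simp only: closed_Int)
  qed
  ultimately have "compact (PiE UNIV (\<lambda>i::nat. {-1..1::real}) \<inter> ?D)"
    by (rule compact_Int_closed)
  moreover have "?D \<subseteq> PiE UNIV (\<lambda>i::nat. {-1..1::real})"
  proof (intro subsetI PiE_I)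
    fix u i assume "u \<in> ?D"
    then have u: "\<forall>i\<ge>n. u i = 0" "rad n u \<le> 1" by auto
    have "\<bar>u i\<bar> \<le> 1"
    proof (cases "i < n")
      case True
      then have "(u i)\<^sup>2 \<le> (\<Sum>i<n. (u i)\<^sup>2)"
        by (intro member_le_sum) auto
      also have "\<dots> \<le> 1"
        using u(2) by (simp add: rad_def)
      finally show ?thesis
        by (simp add: abs_square_le_1)
    qed (use u in auto)
    then show "u i \<in> {-1..1}" by auto
  qed auto
  ultimately have "compact ?D"
    by (simp only: inf_absorb2)
  then have "compact_space (top_of_set ?D)"
    by (intro compact_space_subtopology) simp
  then show ?thesis
    by (subst disc_eq_top_of_set) (simp only: topspace_disc)
qed

lemma Hausdorff_disc: "Hausdorff_space (disc n)"
  unfolding disc_def by (intro Hausdorff_space_subtopology Hausdorff_Euclidean_space)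

text \<open>The homotopy that will retract a neighbourhood of the sphere onto the sphere: vectors are stretched by
\<open>1 + t\<close>, but not beyond the sphere. Dividing by the maximum with \<open>1\<close> keeps the formula continuous at
the origin. At time \<open>1\<close> every vector of radius at least \<open>1/2\<close> has reached the sphere.\<close>

definition disc_expand :: "nat \<Rightarrow> real \<Rightarrow> (nat \<Rightarrow> real) \<Rightarrow> nat \<Rightarrow> real" where
  "disc_expand n t u = (\<lambda>i. (1 + t) / max 1 ((1 + t) * rad n u) * u i)"

lemma rad_disc_expand:
  assumes "t \<ge> 0"
  shows "rad n (disc_expand n t u) = min 1 ((1 + t) * rad n u)"
proof -
  have "rad n (disc_expand n t u) = (1 + t) / max 1 ((1 + t) * rad n u) * rad n u"
    using assms unfolding disc_expand_def by (subst rad_scale) simp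
  then show ?thesis
    using assms rad_nonneg[of n u] by (auto simp: max_def min_def)
qed

lemma disc_expand_in_disc:
  "t \<ge> 0 \<Longrightarrow> u \<in> topspace (disc n) \<Longrightarrow> disc_expand n t u \<in> topspace (disc n)"
  by (auto simp: topspace_disc rad_disc_expand) (simp add: disc_expand_def)

lemma disc_expand_0: "u \<in> topspace (disc n) \<Longrightarrow> disc_expand n 0 u = u"
  by (auto simp: topspace_disc disc_expand_def)

lemma disc_expand_sphere: "t \<ge> 0 \<Longrightarrow> u \<in> disc_sphere n \<Longrightarrow> disc_expand n t u = u"
  by (auto simp: disc_sphere_rad disc_expand_def)

lemma continuous_map_into_disc:
  assumes "continuous_on ({0..1} \<times> topspace (disc n)) f"
    and "f \<in> {0..1} \<times> topspace (disc n) \<rightarrow> topspace (disc n)"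
  shows "continuous_map (prod_topology (top_of_set {0..1}) (disc n)) (disc n) f"
proof -
  define D where "D = topspace (disc n)"
  have D: "disc n = top_of_set D"
    unfolding D_def by (rule disc_eq_top_of_set)
  show ?thesis
    using assms unfolding D by (simp add: continuous_map_in_subtopology)
qed

lemma continuous_map_disc_expand:
  "continuous_map (prod_topology (top_of_set {0..1}) (disc n)) (disc n)
     (\<lambda>p. disc_expand n (fst p) (snd p))"
proof -
  have "continuous_on ({0..1} \<times> topspace (disc n)) (\<lambda>p. disc_expand n (fst p) (snd p))"
  proof (rule continuous_on_coordinatewise_then_product)
    fix i
    have 1: "continuous_on ({0..1} \<times> topspace (disc n)) (\<lambda>p. rad n (snd p))"
      by (rule continuous_on_compose2[OF continuous_on_rad[of UNIV] continuous_on_snd[OF continuous_on_id]]) simp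
    have 2: "continuous_on ({0..1} \<times> topspace (disc n)) (\<lambda>p. snd p i)"
      by (rule continuous_on_compose2[OF continuous_on_component[of UNIV] continuous_on_snd[OF continuous_on_id]]) simp
    show "continuous_on ({0..1} \<times> topspace (disc n)) (\<lambda>p. disc_expand n (fst p) (snd p) i)"
      unfolding disc_expand_def by (intro continuous_intros 1 2) auto
  qed
  moreover have "(\<lambda>p. disc_expand n (fst p) (snd p)) \<in> {0..1} \<times> topspace (disc n) \<rightarrow> topspace (disc n)"
    by (auto intro: disc_expand_in_disc)
  ultimately show ?thesis
    by (rule continuous_map_into_disc)
qed

lemma continuous_map_rad: "continuous_map (disc n) euclideanreal (rad n)"
proof -
  obtain D where D: "disc n = top_of_set D"
    using disc_eq_top_of_set by blast
  show ?thesis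
    unfolding D continuous_map_iff_continuous by (rule continuous_on_rad)
qed

lemma closedin_disc_rad:
  assumes "closed S"
  shows "closedin (disc n) {u \<in> topspace (disc n). rad n u \<in> S}"
  by (rule closedin_continuous_map_preimage[OF continuous_map_rad assms[unfolded closed_closedin]])

lemma closedin_disc_sphere: "closedin (disc n) (disc_sphere n)"
  using closedin_disc_rad[OF closed_singleton, of n 1] by (simp only: disc_sphere_rad singleton_iff)

section \<open>Attaching one cell\<close>

text \<open>The space \<open>Y\<close> arises from its closed subspace \<open>A\<close> by attaching one \<open>n\<close>-cell. Compactness
of the disc and the Hausdorff property make \<open>\<Phi>\<close> a closed map, and this determines the topology of
\<open>Y\<close> by those of \<open>A\<close> and the disc.\<close>

locale cell_attachment =
  fixes Y :: "'a topology" and A :: "'a set" and n :: nat and \<Phi> :: "(nat \<Rightarrow> real) \<Rightarrow> 'a"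
  assumes Hausdorff: "Hausdorff_space Y"
    and closed_A: "closedin Y A"
    and continuous: "continuous_map (disc n) Y \<Phi>"
    and sphere: "\<Phi> ` disc_sphere n \<subseteq> A"
    and inj: "inj_on \<Phi> (open_disc n)"
    and disjoint: "\<Phi> ` open_disc n \<inter> A = {}"
    and cover: "topspace Y = A \<union> \<Phi> ` open_disc n"
begin

text \<open>The expansion of the disc carried over to \<open>Y\<close>. It deforms the collar, which is an open neighbourhood
of \<open>A\<close>, into \<open>A\<close>. So \<open>Y\<close> has the same homology modulo \<open>A\<close> as modulo the collar, and from the latter
pair \<open>A\<close> can be excised.\<close>

definition push :: "real \<Rightarrow> 'a \<Rightarrow> 'a" where
  "push t y = (if y \<in> A then y else \<Phi> (disc_expand n t (inv_into (open_disc n) \<Phi> y)))"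

definition collar :: "'a set" where
  "collar = topspace Y - \<Phi> ` {u \<in> topspace (disc n). rad n u \<le> 1/2}"

lemma push_Phi:
  assumes "t \<ge> 0" "u \<in> topspace (disc n)"
  shows "push t (\<Phi> u) = \<Phi> (disc_expand n t u)"
proof (cases "u \<in> open_disc n")
  case True
  then have "\<Phi> u \<notin> A" using disjoint by auto
  then show ?thesis using True by (simp add: push_def inj inv_into_f_f)
next
  case False
  then have "u \<in> disc_sphere n" using assms by (auto simp: topspace_disc_split)
  moreover from this have "\<Phi> u \<in> A" using sphere by auto
  ultimately show ?thesis using assms by (simp add: push_def disc_expand_sphere)
qed

lemma closed_map_Phi: "closed_map (disc n) Y \<Phi>"
  using T1_Spaces.continuous_imp_closed_map[OF continuous compact_space_disc Hausdorff] .

text \<open>On \<open>A\<close> the homotopy is constant. On the closed cell it is continuous after composition with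
\<open>id \<times> \<Phi>\<close>, a closed and hence a quotient map onto the product of the interval with the closed cell.
The two closed pieces are pasted.\<close>

lemma continuous_map_push:
  "continuous_map (prod_topology (top_of_set {0..1}) Y) Y (\<lambda>p. push (fst p) (snd p))"
proof -
  let ?I = "top_of_set {0..1::real}"
  let ?D = "\<Phi> ` topspace (disc n)"
  have cD: "closedin Y ?D"
    using closed_map_Phi unfolding closed_map_def by blast
  have sub: "A \<subseteq> topspace Y" "?D \<subseteq> topspace Y"
    using closed_A cD closedin_subset by blast+
  show ?thesis
  proof (rule pasting_lemma_closed[where I = "{True,False}" and
        T = "\<lambda>b. {0..1} \<times> (if b then A else ?D)" and f = "\<lambda>b p. push (fst p) (snd p)"])
    fix b :: bool
    show "closedin (prod_topology ?I Y) ({0..1} \<times> (if b then A else ?D))"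
      using cD closed_A by (auto simp: closedin_prod_Times_iff)
    show "continuous_map (subtopology (prod_topology ?I Y) ({0..1} \<times> (if b then A else ?D))) Y
            (\<lambda>p. push (fst p) (snd p))"
    proof (cases b)
      case True
      have "continuous_map (subtopology (prod_topology ?I Y) ({0..1} \<times> A)) Y snd"
        by (intro continuous_map_from_subtopology continuous_map_snd)
      then show ?thesis
        using True by (auto intro: continuous_map_eq simp: push_def)
    next
      case False
      let ?P = "\<lambda>(t, u). (t::real, \<Phi> u)"
      have c: "continuous_map (prod_topology ?I (disc n)) (prod_topology ?I Y) ?P"
        using continuous by (simp add: continuous_map_prod_top)
      have "closed_map (prod_topology ?I (disc n)) (prod_topology ?I Y) ?P"
        by (rule T1_Spaces.continuous_imp_closed_map[OF c])
          (auto simp: compact_space_prod_topology compact_space_disc Hausdorff_space_prod_topology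
             Hausdorff compact_space_subtopology Hausdorff_space_subtopology)
      moreover have im: "?P ` topspace (prod_topology ?I (disc n)) = {0..1} \<times> ?D"
        by auto
      ultimately have "quotient_map (prod_topology ?I (disc n))
          (subtopology (prod_topology ?I Y) ({0..1} \<times> ?D)) ?P"
      proof (intro continuous_closed_imp_quotient_map closed_map_into_subtopology)
        show "?P \<in> topspace (prod_topology ?I (disc n)) \<rightarrow> {0..1} \<times> ?D"
          using im by blast
        then show "continuous_map (prod_topology ?I (disc n))
            (subtopology (prod_topology ?I Y) ({0..1} \<times> ?D)) ?P"
          using c by (simp only: continuous_map_in_subtopology)
        have "topspace (subtopology (prod_topology ?I Y) ({0..1} \<times> ?D)) = {0..1} \<times> ?D"
          using sub by auto
        then show "?P ` topspace (prod_topology ?I (disc n)) =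
            topspace (subtopology (prod_topology ?I Y) ({0..1} \<times> ?D))"
          using im by simp
      qed
      moreover have "continuous_map (prod_topology ?I (disc n)) Y ((\<lambda>p. push (fst p) (snd p)) \<circ> ?P)"
      proof (rule continuous_map_eq)
        show "continuous_map (prod_topology ?I (disc n)) Y (\<Phi> \<circ> (\<lambda>p. disc_expand n (fst p) (snd p)))"
          by (rule continuous_map_compose[OF continuous_map_disc_expand continuous])
      qed (auto simp: push_Phi)
      ultimately have "continuous_map (subtopology (prod_topology ?I Y) ({0..1} \<times> ?D)) Y
          (\<lambda>p. push (fst p) (snd p))"
        by (rule continuous_compose_quotient_map)
      then show ?thesis
        using False by (simp only: if_False)
    qed
  next
    fix p assume "p \<in> topspace (prod_topology ?I Y)"
    then have "snd p \<in> A \<union> ?D" "fst p \<in> {0..1}"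
      using cover by (auto simp: topspace_disc_split)
    then show "\<exists>b. b \<in> {True, False} \<and> p \<in> {0..1} \<times> (if b then A else ?D) \<and>
        push (fst p) (snd p) = push (fst p) (snd p)"
      by (cases p) auto
  qed auto
qed

lemma push_A: "y \<in> A \<Longrightarrow> push t y = y"
  by (simp add: push_def)

lemma push_0:
  assumes "y \<in> topspace Y"
  shows "push 0 y = y"
proof (cases "y \<in> A")
  case False
  then obtain u where "u \<in> open_disc n" "y = \<Phi> u"
    using assms cover by blast
  moreover from this have "u \<in> topspace (disc n)"
    by (simp add: topspace_disc_split)
  ultimately show ?thesis
    by (simp add: push_Phi disc_expand_0)
qed (simp add: push_A)

lemma collar_cases:
  assumes "y \<in> collar"
  obtains "y \<in> A" | u where "u \<in> open_disc n" "rad n u > 1/2" "y = \<Phi> u"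
proof (cases "y \<in> A")
  case False
  then obtain u where u: "u \<in> open_disc n" "y = \<Phi> u"
    using assms cover unfolding collar_def by blast
  then have "rad n u > 1/2"
    using assms unfolding collar_def open_disc_rad by fastforce
  with u that(2) show ?thesis by blast
qed (rule that(1))

lemma Phi_collar_iff:
  assumes "u \<in> topspace (disc n)"
  shows "\<Phi> u \<in> collar \<longleftrightarrow> rad n u > 1/2"
proof
  assume "\<Phi> u \<in> collar"
  then show "rad n u > 1/2" using assms by (force simp: collar_def)
next
  assume r: "rad n u > 1/2"
  have "\<Phi> u \<notin> \<Phi> ` {u \<in> topspace (disc n). rad n u \<le> 1/2}"
  proof
    assume "\<Phi> u \<in> \<Phi> ` {u \<in> topspace (disc n). rad n u \<le> 1/2}"
    then obtain v where v: "v \<in> topspace (disc n)" "rad n v \<le> 1/2" "\<Phi> u = \<Phi> v" by auto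
    then have "v \<in> open_disc n" by (auto simp: open_disc_rad)
    show False
    proof (cases "u \<in> open_disc n")
      case True
      then show False using v \<open>v \<in> open_disc n\<close> r inj by (metis inj_onD not_less)
    next
      case False
      then have "\<Phi> u \<in> A" using assms sphere by (auto simp: topspace_disc_split)
      then show False using v \<open>v \<in> open_disc n\<close> disjoint by auto
    qed
  qed
  then show "\<Phi> u \<in> collar"
    using assms continuous by (auto simp: collar_def continuous_map_def)
qed

lemma A_subset_collar: "A \<subseteq> collar"
proof
  fix y assume y: "y \<in> A"
  have "{u \<in> topspace (disc n). rad n u \<le> 1/2} \<subseteq> open_disc n" by (auto simp: open_disc_rad)
  then show "y \<in> collar" using y disjoint cover by (auto simp: collar_def)
qed

lemma openin_collar: "openin Y collar"
proof -
  have "closedin (disc n) {u \<in> topspace (disc n). rad n u \<le> 1/2}"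
    using closedin_disc_rad[OF closed_atMost, of n "1/2"] by (simp only: atMost_iff)
  then show ?thesis
    unfolding collar_def using closed_map_Phi by (intro openin_diff) (auto simp: closed_map_def)
qed

lemma push_collar:
  assumes "y \<in> collar" "t \<ge> 0"
  shows "push t y \<in> collar"
  using assms(1)
proof (cases rule: collar_cases)
  case (2 u)
  then have "u \<in> topspace (disc n)" by (auto simp: open_disc_rad)
  moreover have "1/2 < (1 + t) * rad n u"
  proof -
    have "rad n u \<le> (1 + t) * rad n u"
      using assms(2) rad_nonneg[of n u] by (simp add: distrib_right)
    then show ?thesis using 2(2) by linarith
  qed
  ultimately have "\<Phi> (disc_expand n t u) \<in> collar"
    using assms(2) by (subst Phi_collar_iff) (auto simp: disc_expand_in_disc rad_disc_expand)
  then show ?thesis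
    using 2(3) push_Phi[OF assms(2) \<open>u \<in> topspace (disc n)\<close>] by simp
qed (use assms push_A in auto)

lemma push_1_collar:
  assumes "y \<in> collar"
  shows "push 1 y \<in> A"
  using assms
proof (cases rule: collar_cases)
  case (2 u)
  then have u: "u \<in> topspace (disc n)" by (auto simp: open_disc_rad)
  then have "disc_expand n 1 u \<in> disc_sphere n"
    using 2 by (simp add: disc_sphere_rad disc_expand_in_disc rad_disc_expand)
  then show ?thesis using u 2 sphere by (auto simp: push_Phi)
qed (use push_A in auto)

text \<open>All stages of the homotopy preserve \<open>A\<close> and the collar, and the last one maps the collar into \<open>A\<close>:
the inclusion of pairs is a homotopy equivalence of pairs.\<close>

lemma iso_collar:
  "hom_induced p Y A Y collar id \<in> iso (relative_homology_group p Y A) (relative_homology_group p Y collar)"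
proof (rule homotopy_equivalence_relative_homology_group_isomorphism[where g = "push 1"])
  have cont: "continuous_map Y Y (push t)" if "t \<in> {0..1}" for t
  proof -
    have "continuous_map Y (prod_topology (top_of_set {0..1}) Y) (\<lambda>y. (t, y))"
      using that by (auto simp: continuous_map_pairwise o_def)
    from continuous_map_compose[OF this continuous_map_push] show ?thesis
      by (simp add: o_def)
  qed
  show "continuous_map Y Y (push 1)" by (rule cont) simp
  have "homotopic_with (\<lambda>h. h \<in> S \<rightarrow> S) Y Y (push 1) id"
    if S: "\<And>t y. y \<in> S \<Longrightarrow> t \<in> {0..1} \<Longrightarrow> push t y \<in> S" "S \<subseteq> topspace Y" for S
  proof -
    have P: "h \<in> S \<rightarrow> S \<longleftrightarrow> k \<in> S \<rightarrow> S" if "\<And>x. x \<in> topspace Y \<Longrightarrow> h x = k x" for h k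
      using that S(2) unfolding Pi_iff by (metis subsetD)
    show ?thesis
      unfolding homotopic_with_sym[of _ Y Y "push 1"]
    proof (rule iffD2[OF homotopic_with], goal_cases)
      case (1 h k)
      then show ?case by (rule P)
    next
      case 2
      show ?case
      proof (intro exI[of _ "\<lambda>p. push (fst p) (snd p)"] conjI ballI)
        show "continuous_map (prod_topology (top_of_set {0..1}) Y) Y (\<lambda>p. push (fst p) (snd p))"
          by (rule continuous_map_push)
      qed (use S in \<open>auto simp: push_0\<close>)
    qed
  qed
  note hom = this
  show "homotopic_with (\<lambda>h. h \<in> A \<rightarrow> A) Y Y (push 1 \<circ> id) id"
    unfolding o_id
    by (rule hom) (auto simp: push_A intro: closedin_subset[OF closed_A, THEN subsetD])
  show "homotopic_with (\<lambda>h. h \<in> collar \<rightarrow> collar) Y Y (id \<circ> push 1) id"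
    unfolding id_o
  proof (rule hom)
    show "push t y \<in> collar" if "y \<in> collar" "t \<in> {0..1}" for t y
      using that by (intro push_collar) auto
  qed (rule openin_subset[OF openin_collar])
qed (use push_1_collar A_subset_collar in auto)

end

section \<open>The homology of an attached cell\<close>

lemma iso_cancel_right:
  assumes "f \<in> iso G H" "h \<in> iso G K" "g \<in> hom H K" "\<And>x. x \<in> carrier G \<Longrightarrow> g (f x) = h x"
  shows "g \<in> iso H K"
proof -
  have "bij_betw (g \<circ> f) (carrier G) (carrier K)"
    using assms by (subst bij_betw_cong[of _ _ h]) (auto simp: iso_def)
  then have "bij_betw g (carrier H) (carrier K)"
    using assms by (subst bij_betw_comp_iff[where f = f and A = "carrier G"]) (auto simp: iso_def)
  then show ?thesis using assms by (simp add: iso_def)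
qed

lemma iso_cancel_left:
  assumes "g \<in> iso H K" "h \<in> iso G K" "f \<in> hom G H" "\<And>x. x \<in> carrier G \<Longrightarrow> g (f x) = h x"
  shows "f \<in> iso G H"
proof -
  have "bij_betw (g \<circ> f) (carrier G) (carrier K)"
    using assms by (subst bij_betw_cong[of _ _ h]) (auto simp: iso_def)
  then have "bij_betw f (carrier G) (carrier H)"
    using assms by (subst bij_betw_comp_iff2[where f' = g and A' = "carrier H" and A'' = "carrier K"])
      (auto simp: iso_def hom_def)
  then show ?thesis using assms by (simp add: iso_def)
qed

text \<open>The disc itself arises from its sphere by attaching a cell, so the comparison of \<open>A\<close> with the collar
and the excision below also apply to it.\<close>

lemma cell_attachment_disc: "cell_attachment (disc n) (disc_sphere n) n id"
  by unfold_locales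
    (use closedin_subset[OF closedin_disc_sphere] in
      \<open>auto simp: Hausdorff_disc closedin_disc_sphere open_disc_eq\<close>)

context cell_attachment
begin

lemma iso_excision:
  "hom_induced p (subtopology Y (topspace Y - A)) (collar - A) Y collar id
     \<in> iso (relative_homology_group p (subtopology Y (topspace Y - A)) (collar - A))
         (relative_homology_group p Y collar)"
  using homology_excision_axiom[of Y A collar "topspace Y" p] A_subset_collar openin_collar
    closed_A openin_subset[OF openin_collar]
  by (simp add: closure_of_closedin interior_of_openin)

lemma homeomorphic_open_cell:
  "homeomorphic_map (subtopology (disc n) (topspace (disc n) - disc_sphere n))
     (subtopology Y (topspace Y - A)) \<Phi>"
proof (rule bijective_closed_imp_homeomorphic_map)
  have o: "topspace (disc n) - disc_sphere n = open_disc n"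
    by (rule open_disc_eq[symmetric])
  have pre: "{u \<in> topspace (disc n). \<Phi> u \<in> topspace Y - A} = topspace (disc n) - disc_sphere n"
    using sphere disjoint continuous by (auto simp: topspace_disc_split continuous_map_def)
  show "closed_map (subtopology (disc n) (topspace (disc n) - disc_sphere n))
     (subtopology Y (topspace Y - A)) \<Phi>"
    by (rule closed_map_restriction[OF closed_map_Phi pre])
  show "continuous_map (subtopology (disc n) (topspace (disc n) - disc_sphere n))
     (subtopology Y (topspace Y - A)) \<Phi>"
    using continuous pre by (auto simp: continuous_map_in_subtopology continuous_map_from_subtopology)
  show "\<Phi> ` topspace (subtopology (disc n) (topspace (disc n) - disc_sphere n)) =
      topspace (subtopology Y (topspace Y - A))"
    using cover disjoint by (auto simp: o open_disc_rad)
  show "inj_on \<Phi> (topspace (subtopology (disc n) (topspace (disc n) - disc_sphere n)))"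
    using inj by (auto simp: o inj_on_def)
qed

text \<open>The pairs of the disc and its sphere and of \<open>Y\<close> and \<open>A\<close> are both compared with the pairs of the open
cells and the collars inside them: sphere and \<open>A\<close> are first enlarged to the collars, then excised.
The remaining open cells are homeomorphic under the characteristic map, and the claim travels back
through the two naturality squares.\<close>

theorem characteristic_map_iso:
  "hom_induced p (disc n) (disc_sphere n) Y A \<Phi>
     \<in> iso (relative_homology_group p (disc n) (disc_sphere n)) (relative_homology_group p Y A)"
proof -
  interpret D: cell_attachment "disc n" "disc_sphere n" n id
    by (rule cell_attachment_disc)
  let ?DS = "subtopology (disc n) (topspace (disc n) - disc_sphere n)"
  let ?YA = "subtopology Y (topspace Y - A)"
  have \<Phi>_collar: "\<Phi> u \<in> collar \<longleftrightarrow> u \<in> D.collar" if "u \<in> topspace (disc n)" for u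
    using D.Phi_collar_iff[OF that] Phi_collar_iff[OF that] by simp
  have D_sub: "D.collar \<subseteq> topspace (disc n)"
    by (simp add: D.collar_def)
  have \<Phi>_A: "\<Phi> u \<in> A \<longleftrightarrow> u \<in> disc_sphere n" if "u \<in> topspace (disc n)" for u
    using that sphere disjoint unfolding topspace_disc_split by blast
  have maps: "\<Phi> \<in> D.collar \<rightarrow> collar" "\<Phi> \<in> disc_sphere n \<rightarrow> A"
    using D_sub \<Phi>_collar sphere by auto
  have collar_eq: "\<Phi> ` (D.collar - disc_sphere n) = collar - A"
  proof
    show "\<Phi> ` (D.collar - disc_sphere n) \<subseteq> collar - A"
      using \<Phi>_collar \<Phi>_A D_sub by blast
    show "collar - A \<subseteq> \<Phi> ` (D.collar - disc_sphere n)"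
    proof
      fix y assume y: "y \<in> collar - A"
      then have "y \<in> topspace Y" by (simp add: collar_def)
      then obtain u where u: "u \<in> open_disc n" "y = \<Phi> u"
        using y cover by auto
      then have "u \<in> topspace (disc n)" by (simp add: open_disc_rad)
      then have "u \<in> D.collar - disc_sphere n"
        using u(2) y \<Phi>_collar \<Phi>_A by simp
      then show "y \<in> \<Phi> ` (D.collar - disc_sphere n)" using u(2) by simp
    qed
  qed
  have maps': "\<Phi> \<in> D.collar - disc_sphere n \<rightarrow> collar - A"
    using collar_eq by blast
  have f: "hom_induced p ?DS (D.collar - disc_sphere n) ?YA (collar - A) \<Phi>
      \<in> iso (relative_homology_group p ?DS (D.collar - disc_sphere n))
          (relative_homology_group p ?YA (collar - A))"
    using collar_eq by (intro homeomorphic_map_relative_homology_iso homeomorphic_open_cell)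
      (auto simp: D.collar_def collar_def)
  have contDS: "continuous_map ?DS ?YA \<Phi>"
    using homeomorphic_open_cell homeomorphic_imp_continuous_map by blast
  have coll: "hom_induced p (disc n) D.collar Y collar \<Phi>
      \<in> iso (relative_homology_group p (disc n) D.collar) (relative_homology_group p Y collar)"
  proof (rule iso_cancel_right[OF D.iso_excision[of p] iso_set_trans[OF f iso_excision]])
    fix x
    show "hom_induced p (disc n) D.collar Y collar \<Phi>
            (hom_induced p ?DS (D.collar - disc_sphere n) (disc n) D.collar id x) =
          (hom_induced p ?YA (collar - A) Y collar id \<circ>
            hom_induced p ?DS (D.collar - disc_sphere n) ?YA (collar - A) \<Phi>) x"
      using maps maps' continuous contDS
      by (simp add: hom_induced_compose' continuous_map_from_subtopology)
  qed (simp add: hom_induced_hom)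
  show ?thesis
  proof (rule iso_cancel_left[OF iso_collar iso_set_trans[OF D.iso_collar coll]])
    fix x
    show "hom_induced p Y A Y collar id (hom_induced p (disc n) (disc_sphere n) Y A \<Phi> x) =
        (hom_induced p (disc n) D.collar Y collar \<Phi> \<circ>
          hom_induced p (disc n) (disc_sphere n) (disc n) D.collar id) x"
      using maps continuous A_subset_collar D.A_subset_collar
      by (simp add: hom_induced_compose' subset_eq Pi_iff)
  qed (simp add: hom_induced_hom)
qed

end

section \<open>Homology of the disc modulo its boundary sphere\<close>

lemma contractible_space_disc: "contractible_space (disc n)"
proof -
  have cont: "continuous_map (prod_topology (top_of_set {0..1}) (disc n)) (disc n)
     (\<lambda>p. (\<lambda>i. (1 - fst p) * snd p i))"
  proof (rule continuous_map_into_disc)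
    show "continuous_on ({0..1} \<times> topspace (disc n)) (\<lambda>p. (\<lambda>i. (1 - fst p) * snd p i))"
    proof (rule continuous_on_coordinatewise_then_product)
      fix i
      have 2: "continuous_on ({0..1} \<times> topspace (disc n)) (\<lambda>p. snd p i)"
        by (rule continuous_on_compose2[OF continuous_on_component[of UNIV] continuous_on_snd[OF continuous_on_id]]) simp
      show "continuous_on ({0..1} \<times> topspace (disc n)) (\<lambda>p. (1 - fst p) * snd p i)"
        by (intro continuous_intros 2)
    qed
    show "(\<lambda>p. (\<lambda>i. (1 - fst p) * snd p i)) \<in> {0..1} \<times> topspace (disc n) \<rightarrow> topspace (disc n)"
    proof
      fix p :: "real \<times> (nat \<Rightarrow> real)" assume p: "p \<in> {0..1} \<times> topspace (disc n)"
      then have "rad n (\<lambda>i. (1 - fst p) * snd p i) \<le> 1"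
        unfolding rad_scale by (intro mult_le_one) (auto simp: topspace_disc rad_nonneg)
      then show "(\<lambda>i. (1 - fst p) * snd p i) \<in> topspace (disc n)"
        using p by (auto simp: topspace_disc)
    qed
  qed
  have "homotopic_with (\<lambda>h. True) (disc n) (disc n) id (\<lambda>_. \<lambda>_. 0)"
    unfolding homotopic_with_def
    by (rule exI[of _ "\<lambda>p. (\<lambda>i. (1 - fst p) * snd p i)"], intro conjI cont) simp_all
  then show ?thesis
    unfolding contractible_space_def by (rule exI[where x = "\<lambda>_. 0"])
qed

lemma disc_boundary_sphere:
  "subtopology (disc (Suc n)) (disc_sphere (Suc n)) = nsphere n"
proof -
  let ?E = "Euclidean_space (Suc n)"
  have eq: "topspace ?E \<inter> ({u. (\<Sum>i<Suc n. (u i)\<^sup>2) \<le> 1} \<inter> disc_sphere (Suc n)) =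
      topspace ?E \<inter> {x. (\<Sum>i\<le>n. (x i)\<^sup>2) = 1}"
    by (auto simp: disc_sphere_def disc_def simp del: sum.lessThan_Suc simp flip: lessThan_Suc_atMost)
  show ?thesis
    unfolding disc_def[of "Suc n"] nsphere_def subtopology_subtopology
    by (metis eq subtopology_restrict)
qed

lemma disc_0: "topspace (disc 0) = {\<lambda>_. 0}" "disc_sphere 0 = {}"
  by (auto simp: disc_sphere_rad topspace_disc rad_def)

text \<open>The disc being contractible, the connecting homomorphism of the pair is an isomorphism.\<close>

lemma disc_Suc_homology:
  "relative_homology_group p (disc (Suc n)) (disc_sphere (Suc n)) \<cong> reduced_homology_group (p - 1) (nsphere n)"
proof -
  have "(\<Sum>i<Suc n. (if i = 0 then 1 else 0 :: real)\<^sup>2) = 1"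
    by (simp only: sum.lessThan_Suc_shift) simp
  then have "(\<lambda>i. if i = 0 then 1 else 0) \<in> disc_sphere (Suc n)"
    by (simp add: disc_sphere_rad topspace_disc rad_def del: sum.lessThan_Suc)
  then have "topspace (disc (Suc n)) \<inter> disc_sphere (Suc n) \<noteq> {}"
    by (auto simp: disc_sphere_def)
  from isomorphic_group_relative_homology_of_contractible[OF contractible_space_disc this]
  show ?thesis by (simp add: disc_boundary_sphere)
qed

text \<open>The zero-dimensional disc is a point with empty sphere and needs its own argument, here and in the
next lemma.\<close>

lemma disc_homology_integers:
  "relative_homology_group (int n) (disc n) (disc_sphere n) \<cong> integer_group"
proof (cases n)
  case 0
  have "path_connected_space (disc 0)"
    using contractible_space_disc contractible_imp_path_connected_space by blast
  then show ?thesis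
    using 0 isomorphic_integer_zeroth_homology_group[of "disc 0"] by (auto simp: disc_0)
next
  case (Suc m)
  then show ?thesis
    using iso_trans[OF disc_Suc_homology[of "int (Suc m)" m]] reduced_homology_group_nsphere(1)[of m] by simp
qed

lemma disc_homology_trivial:
  assumes "p \<noteq> int n"
  shows "trivial_group (relative_homology_group p (disc n) (disc_sphere n))"
proof (cases n)
  case 0
  then show ?thesis
    using homology_dimension_axiom[of "disc 0"] assms by (auto simp: disc_0)
next
  case (Suc m)
  then have "trivial_group (reduced_homology_group (p - 1) (nsphere m))"
    using assms by (intro reduced_homology_group_nsphere(2)) auto
  then show ?thesis
    using iffD2[OF isomorphic_group_triviality[OF disc_Suc_homology[of p m]]] Suc by simp
qed

section \<open>Free abelian groups\<close>

text \<open>The homology groups are written multiplicatively, so an integral linear combination is a product of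
powers.\<close>

definition int_comb :: "('g, 'b) monoid_scheme \<Rightarrow> ('i \<Rightarrow> 'g) \<Rightarrow> ('i \<Rightarrow> int) \<Rightarrow> 'i set \<Rightarrow> 'g" where
  "int_comb G e m C = finprod G (\<lambda>c. e c [^]\<^bsub>G\<^esub> m c) C"

definition free_basis :: "('g, 'b) monoid_scheme \<Rightarrow> ('i \<Rightarrow> 'g) \<Rightarrow> 'i set \<Rightarrow> bool" where
  "free_basis G e C \<longleftrightarrow> comm_group G \<and> finite C \<and> e \<in> C \<rightarrow> carrier G \<and>
     (\<forall>x\<in>carrier G. \<exists>m. x = int_comb G e m C) \<and>
     (\<forall>m. int_comb G e m C = \<one>\<^bsub>G\<^esub> \<longrightarrow> (\<forall>c\<in>C. m c = 0))"

context comm_group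
begin

lemma int_comb_closed [simp]: "e \<in> C \<rightarrow> carrier G \<Longrightarrow> int_comb G e m C \<in> carrier G"
  unfolding int_comb_def by (intro finprod_closed) (auto simp: Pi_iff)

lemma int_comb_insert:
  "finite C \<Longrightarrow> c \<notin> C \<Longrightarrow> e \<in> insert c C \<rightarrow> carrier G \<Longrightarrow>
    int_comb G e m (insert c C) = e c [^] m c \<otimes> int_comb G e m C"
  unfolding int_comb_def by (intro finprod_insert) (auto simp: Pi_iff)

lemma int_comb_cong:
  "e' \<in> C \<rightarrow> carrier G \<Longrightarrow> (\<And>c. c \<in> C \<Longrightarrow> e c = e' c) \<Longrightarrow> (\<And>c. c \<in> C \<Longrightarrow> m c = m' c) \<Longrightarrow>
    int_comb G e m C = int_comb G e' m' C"
  unfolding int_comb_def by (intro finprod_cong') (auto simp: Pi_iff)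

lemma int_comb_add:
  assumes "e \<in> C \<rightarrow> carrier G"
  shows "int_comb G e (\<lambda>c. m c + m' c) C = int_comb G e m C \<otimes> int_comb G e m' C"
proof -
  have "int_comb G e (\<lambda>c. m c + m' c) C = finprod G (\<lambda>c. e c [^] m c \<otimes> e c [^] m' c) C"
    unfolding int_comb_def using assms by (intro finprod_cong') (auto simp: Pi_iff int_pow_mult)
  also have "\<dots> = int_comb G e m C \<otimes> int_comb G e m' C"
    unfolding int_comb_def using assms by (intro finprod_multf) (auto simp: Pi_iff)
  finally show ?thesis .
qed

lemma int_comb_zero: "int_comb G e (\<lambda>c. 0) C = \<one>"
  by (simp add: int_comb_def)

lemma int_comb_scale:
  assumes "e \<in> C \<rightarrow> carrier G"
  shows "int_comb G e (\<lambda>c. k * m c) C = int_comb G e m C [^] (k::int)"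
proof -
  have *: "finprod G (\<lambda>c. e c [^] (k * m c)) C = finprod G (\<lambda>c. e c [^] m c) C [^] k"
    using assms
  proof (induction C rule: infinite_finite_induct)
    case (insert c C)
    then show ?case
      by (subst (1 2) finprod_insert) (auto simp: Pi_iff int_pow_distrib int_pow_pow mult.commute)
  qed auto
  then show ?thesis by (simp add: int_comb_def)
qed

lemma int_comb_comb:
  assumes "finite B" "e \<in> C \<rightarrow> carrier G"
  shows "int_comb G (\<lambda>b. int_comb G e (m b) C) k B = int_comb G e (\<lambda>c. \<Sum>b\<in>B. k b * m b c) C"
  using assms(1)
proof induction
  case empty
  then show ?case by (simp add: int_comb_zero) (simp add: int_comb_def)
next
  case (insert b B)
  then show ?case
    using assms(2) by (simp add: int_comb_insert int_comb_add int_comb_scale Pi_iff)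
qed

end

lemma hom_int_comb:
  assumes "comm_group G" "comm_group H" "h \<in> hom G H" "e \<in> C \<rightarrow> carrier G"
  shows "h (int_comb G e m C) = int_comb H (\<lambda>c. h (e c)) m C"
proof -
  interpret G: comm_group G by fact
  interpret H: comm_group H by fact
  interpret group_hom G H h by unfold_locales fact
  show ?thesis
    using assms(4)
  proof (induction C rule: infinite_finite_induct)
    case (insert c C)
    then show ?case
      by (simp add: G.int_comb_insert H.int_comb_insert Pi_iff hom_int_pow)
  qed (auto simp: int_comb_def)
qed

lemma free_basis_ex1:
  fixes G (structure)
  assumes "free_basis G e C" "x \<in> carrier G"
  shows "\<exists>!m. (\<forall>c. c \<notin> C \<longrightarrow> m c = 0) \<and> x = int_comb G e m C"
proof -
  interpret comm_group G using assms by (simp add: free_basis_def)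
  have e: "e \<in> C \<rightarrow> carrier G" using assms by (simp add: free_basis_def)
  obtain m where m: "x = int_comb G e m C" using assms by (auto simp: free_basis_def)
  show ?thesis
  proof (rule ex1I[of _ "\<lambda>c. if c \<in> C then m c else 0"])
    show "(\<forall>c. c \<notin> C \<longrightarrow> (if c \<in> C then m c else 0) = 0) \<and>
        x = int_comb G e (\<lambda>c. if c \<in> C then m c else 0) C"
      using m e by (auto intro: int_comb_cong)
  next
    fix k assume k: "(\<forall>c. c \<notin> C \<longrightarrow> k c = 0) \<and> x = int_comb G e k C"
    have "int_comb G e (\<lambda>c. k c + -1 * m c) C = int_comb G e k C \<otimes> int_comb G e m C [^] (-1::int)"
      using e by (simp only: int_comb_add int_comb_scale)
    also have "\<dots> = \<one>"
      using k m e by (simp add: int_pow_neg)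
    finally have "\<forall>c\<in>C. k c + -1 * m c = 0"
      using assms(1) unfolding free_basis_def by blast
    then show "k = (\<lambda>c. if c \<in> C then m c else 0)" using k by fastforce
  qed
qed

lemma free_basis_cong:
  assumes "free_basis G e C" "\<And>c. c \<in> C \<Longrightarrow> e c = e' c"
  shows "free_basis G e' C"
proof -
  interpret comm_group G using assms(1) by (simp add: free_basis_def)
  have e': "e' \<in> C \<rightarrow> carrier G"
    using assms by (auto simp: free_basis_def Pi_iff)
  have "int_comb G e m C = int_comb G e' m C" for m
    using assms(2) e' by (intro int_comb_cong) auto
  then show ?thesis
    using assms(1) e' by (simp add: free_basis_def)
qed

lemma free_basis_iso:
  assumes "free_basis G e C" "h \<in> iso G H" "group H"
  shows "free_basis H (\<lambda>c. h (e c)) C"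
proof -
  interpret G: comm_group G using assms by (simp add: free_basis_def)
  have hom: "h \<in> hom G H" and bij: "bij_betw h (carrier G) (carrier H)"
    using assms by (auto simp: iso_def)
  have H: "comm_group H"
    using assms by (intro G.iso_imp_comm_group) (auto simp: is_iso_def intro: group.is_monoid)
  have e: "e \<in> C \<rightarrow> carrier G" using assms by (simp add: free_basis_def)
  note hc = hom_int_comb[OF G.comm_group_axioms H hom e]
  interpret group_hom G H h
    using assms(3) hom by (simp add: group_hom_def group_hom_axioms_def)
  show ?thesis
    unfolding free_basis_def
  proof (intro conjI ballI allI impI H)
    fix y assume "y \<in> carrier H"
    then obtain x where "x \<in> carrier G" "y = h x" using bij by (auto simp: bij_betw_def)
    then show "\<exists>m. y = int_comb H (\<lambda>c. h (e c)) m C"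
      using assms(1) hc by (metis free_basis_def)
  next
    fix m c assume "int_comb H (\<lambda>c. h (e c)) m C = \<one>\<^bsub>H\<^esub>" "c \<in> C"
    then have "h (int_comb G e m C) = h \<one>\<^bsub>G\<^esub>" using hc by simp
    then have "int_comb G e m C = \<one>\<^bsub>G\<^esub>"
      using bij e inj_onD[of h "carrier G"] by (simp add: bij_betw_def del: hom_one)
    then show "m c = 0" using assms(1) \<open>c \<in> C\<close> by (auto simp: free_basis_def)
  qed (use assms e hom_closed in \<open>auto simp: free_basis_def Pi_iff\<close>)
qed

text \<open>The exact sequence \<open>0 \<rightarrow> G \<rightarrow> G' \<rightarrow> Q\<close> with \<open>Q\<close> free on the image of one element of \<open>G'\<close>: the map to \<open>Q\<close>
is then onto and split, and a basis of \<open>G\<close> becomes one of \<open>G'\<close> on adding that element.\<close>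

lemma free_basis_extend:
  assumes "free_basis G e C" "comm_group G'" "free_basis Q (\<lambda>_. q (e' c)) {c}"
    and "i \<in> hom G G'" "q \<in> hom G' Q" "inj_on i (carrier G)" "kernel G' Q q = i ` carrier G"
    and "c \<notin> C" "e' c \<in> carrier G'" "\<And>a. a \<in> C \<Longrightarrow> e' a = i (e a)"
  shows "free_basis G' e' (insert c C)"
proof -
  interpret G: comm_group G using assms by (simp add: free_basis_def)
  interpret G': comm_group G' by fact
  interpret Q: comm_group Q using assms by (simp add: free_basis_def)
  interpret i: group_hom G G' i by unfold_locales fact
  interpret q: group_hom G' Q q by unfold_locales fact
  have e: "e \<in> C \<rightarrow> carrier G" and fin: "finite C" using assms by (auto simp: free_basis_def)
  have e': "e' \<in> insert c C \<rightarrow> carrier G'" using assms e by (auto simp: Pi_iff)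
  have comb: "int_comb G' e' m C = i (int_comb G e m C)" for m
    using assms e hom_int_comb[OF G.comm_group_axioms G'.comm_group_axioms assms(4) e, of m]
    by (auto intro!: G'.int_comb_cong simp: Pi_iff)
  have comb_c: "int_comb G' e' m (insert c C) = e' c [^]\<^bsub>G'\<^esub> m c \<otimes>\<^bsub>G'\<^esub> i (int_comb G e m C)" for m
    using fin assms e' by (simp add: G'.int_comb_insert comb)
  have Qc: "int_comb Q (\<lambda>_. q (e' c)) m {c} = q (e' c) [^]\<^bsub>Q\<^esub> m c" for m
    using assms by (subst Q.int_comb_insert) (auto simp: int_comb_def)
  have qi: "q (i x) = \<one>\<^bsub>Q\<^esub>" if "x \<in> carrier G" for x
    using that assms(7) by (auto simp: kernel_def)
  show ?thesis
    unfolding free_basis_def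
  proof (intro conjI ballI allI impI)
    fix x assume x: "x \<in> carrier G'"
    moreover have "\<forall>y\<in>carrier Q. \<exists>m. y = int_comb Q (\<lambda>_. q (e' c)) m {c}"
      using assms(3) unfolding free_basis_def by (elim conjE)
    ultimately obtain m where "q x = int_comb Q (\<lambda>_. q (e' c)) m {c}"
      using q.hom_closed by metis
    then have "q x = q (e' c [^]\<^bsub>G'\<^esub> m c)" using assms by (simp add: Qc q.hom_int_pow)
    \<comment> \<open>Subtracting the right multiple of the new element moves \<open>x\<close> into \<open>G\<close>.\<close>
    then have "inv\<^bsub>G'\<^esub> (e' c [^]\<^bsub>G'\<^esub> m c) \<otimes>\<^bsub>G'\<^esub> x \<in> kernel G' Q q"
      using x assms(9) by (simp add: kernel_def q.hom_closed)
    then obtain z where z: "z \<in> carrier G" "inv\<^bsub>G'\<^esub> (e' c [^]\<^bsub>G'\<^esub> m c) \<otimes>\<^bsub>G'\<^esub> x = i z"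
      using assms(7) by auto
    obtain k where k: "z = int_comb G e k C" using assms(1) z by (auto simp: free_basis_def)
    have "x = e' c [^]\<^bsub>G'\<^esub> m c \<otimes>\<^bsub>G'\<^esub> i z"
      using z x assms(9) by (metis G'.inv_solve_left' G'.int_pow_closed i.hom_closed)
    also have "\<dots> = int_comb G' e' (k(c := m c)) (insert c C)"
      using assms(8) e k by (subst comb_c) (auto intro!: arg_cong[of _ _ i] arg_cong2[of _ _ _ _ "mult G'"] G.int_comb_cong)
    finally show "\<exists>m. x = int_comb G' e' m (insert c C)" by blast
  next
    fix m a assume m: "int_comb G' e' m (insert c C) = \<one>\<^bsub>G'\<^esub>" and a: "a \<in> insert c C"
    have "q (e' c [^]\<^bsub>G'\<^esub> m c) = \<one>\<^bsub>Q\<^esub>"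
      using arg_cong[OF m, of q] assms e by (simp add: comb_c qi)
    then have "int_comb Q (\<lambda>_. q (e' c)) m {c} = \<one>\<^bsub>Q\<^esub>"
      using assms by (simp add: Qc q.hom_int_pow)
    then have mc: "m c = 0" using assms(3) by (auto simp: free_basis_def)
    then have "i (int_comb G e m C) = i \<one>\<^bsub>G\<^esub>" using m e by (simp add: comb_c)
    then have "int_comb G e m C = \<one>\<^bsub>G\<^esub>"
      using inj_onD[OF assms(6)] e by (simp del: i.hom_one)
    then have "\<forall>a\<in>C. m a = 0" using assms(1) by (auto simp: free_basis_def)
    then show "m a = 0" using a mc by auto
  qed (use assms e' fin in auto)
qed

text \<open>An infinite cyclic group is free on each of its generators: a relation \<open>g\<^sup>k = 1\<close> with \<open>k \<noteq> 0\<close> would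
leave only \<open>\<bar>k\<bar>\<close> elements.\<close>

lemma free_basis_generator:
  fixes G (structure)
  assumes "G \<cong> integer_group" "group G" "g \<in> carrier G" "subgroup_generated G {g} = G"
  shows "free_basis G (\<lambda>_. g) {c}"
proof -
  interpret group G by fact
  obtain h where h: "h \<in> iso integer_group G"
    using assms(1) iso_sym[of integer_group] by (auto simp: is_iso_def)
  have G: "comm_group G"
    using comm_group.iso_imp_comm_group[OF abelian_integer_group] h by (auto simp: is_iso_def is_monoid)
  then interpret comm_group G .
  have comb: "int_comb G (\<lambda>_. g) m {c} = g [^] m c" for m
    using assms by (subst int_comb_insert) (auto simp: int_comb_def)
  have surj: "carrier G = range (\<lambda>n::int. g [^] n)"
    using carrier_subgroup_generated_by_singleton[OF assms(3)] assms(4) by simp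
  have inf: "infinite (carrier G)"
    using h bij_betw_finite[of h UNIV "carrier G"] by (auto simp: iso_def infinite_UNIV_int)
  have "k = 0" if k: "g [^] k = \<one>" for k :: int
  proof (rule ccontr)
    assume "k \<noteq> 0"
    have "g [^] n = g [^] (n mod \<bar>k\<bar>)" for n :: int
    proof -
      have "g [^] \<bar>k\<bar> = \<one>" using k assms(3) by (cases "k \<ge> 0") (auto simp: int_pow_neg)
      then have "g [^] (\<bar>k\<bar> * (n div \<bar>k\<bar>)) = \<one>"
        using int_pow_pow[OF assms(3), of "\<bar>k\<bar>" "n div \<bar>k\<bar>"] by simp
      then have "g [^] (\<bar>k\<bar> * (n div \<bar>k\<bar>) + n mod \<bar>k\<bar>) = g [^] (n mod \<bar>k\<bar>)"
        using assms(3) by (simp only: int_pow_mult) simp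
      then show ?thesis by simp
    qed
    then have "carrier G \<subseteq> (\<lambda>n. g [^] n) ` {0..<\<bar>k\<bar>}"
      using surj \<open>k \<noteq> 0\<close> by (auto intro!: image_eqI[of _ _ "_ mod \<bar>k\<bar>"])
    then show False using inf finite_subset by blast
  qed
  moreover have "\<exists>m. x = g [^] (m c :: int)" if x: "x \<in> carrier G" for x
  proof -
    obtain k :: int where "x = g [^] k" using x surj by auto
    then show ?thesis by (intro exI[of _ "\<lambda>_. k"])
  qed
  ultimately show ?thesis
    using assms G by (simp add: free_basis_def comb)
qed

lemma disc_generator_basis:
  "free_basis (relative_homology_group (int n) (disc n) (disc_sphere n)) (\<lambda>_. disc_generator n) {c}"
proof -
  let ?G = "relative_homology_group (int n) (disc n) (disc_sphere n)"
  have "cyclic_group ?G"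
    using isomorphic_group_cyclicity[OF disc_homology_integers] by simp
  then have "\<exists>g. g \<in> carrier ?G \<and> subgroup_generated ?G {g} = ?G"
    by (auto simp: cyclic_group_def)
  then have "disc_generator n \<in> carrier ?G \<and> subgroup_generated ?G {disc_generator n} = ?G"
    unfolding disc_generator_def Let_def by (rule someI_ex)
  then show ?thesis
    by (intro free_basis_generator disc_homology_integers) auto
qed

section \<open>Cellular chains\<close>

context finite_cw_complex
begin

lemma finite_kcells: "finite (cw_kcells X k)"
  by (rule finite_subset[OF _ finite_cells]) (auto simp: cw_kcells_def)

lemma cw_points_mono: "A \<subseteq> B \<Longrightarrow> cw_points X A \<subseteq> cw_points X B"
  by (auto simp: cw_points_def)

lemma cw_points_Un: "cw_points X (A \<union> B) = cw_points X A \<union> cw_points X B"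
  by (auto simp: cw_points_def)

lemma cw_skel_split: "cw_skel X k = cw_skel X (k - 1) \<union> cw_kcells X k"
  by (auto simp: cw_skel_def cw_kcells_def)

lemma cw_points_subset: "A \<subseteq> cw_cells X \<Longrightarrow> cw_points X A \<subseteq> topspace (cw_top X)"
proof
  fix x assume "A \<subseteq> cw_cells X" "x \<in> cw_points X A"
  then obtain c u where "c \<in> cw_cells X" "u \<in> open_disc (cw_dim X c)" "x = cw_map X c u"
    by (auto simp: cw_points_def)
  then show "x \<in> topspace (cw_top X)"
    using bij_betwE[OF open_cells_partition] by auto
qed

lemma open_cell_disjoint:
  assumes "c \<in> cw_cells X" "A \<subseteq> cw_cells X" "c \<notin> A"
  shows "cw_map X c ` open_disc (cw_dim X c) \<inter> cw_points X A = {}"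
proof (rule ccontr)
  assume "\<not> ?thesis"
  then obtain u a v where uv: "u \<in> open_disc (cw_dim X c)" "a \<in> A" "v \<in> open_disc (cw_dim X a)"
    "cw_map X c u = cw_map X a v"
    unfolding cw_points_def by blast
  then have "(c, u) = (a, v)"
    using assms open_cells_partition
    by (intro inj_onD[of "\<lambda>(c, u). cw_map X c u" "SIGMA c:cw_cells X. open_disc (cw_dim X c)"])
      (auto simp: bij_betw_def)
  then show False using uv assms by simp
qed

lemma inj_on_open_cell: "c \<in> cw_cells X \<Longrightarrow> inj_on (cw_map X c) (open_disc (cw_dim X c))"
  using open_cells_partition by (fastforce simp: bij_betw_def inj_on_def)

lemma closed_cell_subset:
  assumes "c \<in> cw_cells X"
  shows "cw_map X c ` topspace (disc (cw_dim X c))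
    \<subseteq> cw_points X (insert c (cw_skel X (int (cw_dim X c) - 1)))"
proof -
  have "cw_map X c ` open_disc (cw_dim X c) \<subseteq> cw_points X {c}"
    by (auto simp: cw_points_def)
  then show ?thesis
    unfolding topspace_disc_split image_Un
    by (subst insert_is_Un) (simp only: cw_points_Un Un_mono attaching[OF assms])
qed

lemma cw_subcomplex_between_skeleta:
  assumes "cw_skel X (k - 1) \<subseteq> A" "A \<subseteq> cw_skel X k"
  shows "cw_subcomplex X A"
  unfolding cw_subcomplex_def
proof (intro conjI ballI)
  show "A \<subseteq> cw_cells X" using assms by (auto simp: cw_skel_def)
  fix c assume c: "c \<in> A"
  then have "int (cw_dim X c) \<le> k"
    using assms(2) by (auto simp: cw_skel_def)
  then have "insert c (cw_skel X (int (cw_dim X c) - 1)) \<subseteq> A"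
    using c assms(1) by (auto simp: cw_skel_def)
  moreover have "c \<in> cw_cells X" using c assms by (auto simp: cw_skel_def)
  ultimately show "cw_map X c ` topspace (disc (cw_dim X c)) \<subseteq> cw_points X A"
    using closed_cell_subset cw_points_mono by blast
qed

lemma closedin_subcomplex:
  assumes "cw_subcomplex X A"
  shows "closedin (cw_top X) (cw_points X A)"
proof -
  have A: "A \<subseteq> cw_cells X" using assms by (simp add: cw_subcomplex_def)
  have "cw_points X A = (\<Union>c\<in>A. cw_map X c ` topspace (disc (cw_dim X c)))"
  proof
    have "open_disc n \<subseteq> topspace (disc n)" for n
      by (simp add: topspace_disc_split)
    then show "cw_points X A \<subseteq> (\<Union>c\<in>A. cw_map X c ` topspace (disc (cw_dim X c)))"
      unfolding cw_points_def by blast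
    show "(\<Union>c\<in>A. cw_map X c ` topspace (disc (cw_dim X c))) \<subseteq> cw_points X A"
      using assms by (auto simp: cw_subcomplex_def)
  qed
  moreover have "closedin (cw_top X) (cw_map X c ` topspace (disc (cw_dim X c)))" if "c \<in> A" for c
    using that A compact_space_disc continuous_cw_map hausdorff
    by (intro compactin_imp_closedin image_compactin[of "disc (cw_dim X c)"])
      (auto simp: compact_space_def)
  moreover have "finite A" using A finite_cells finite_subset by blast
  ultimately show ?thesis by (auto intro!: closedin_Union)
qed

text \<open>Intermediate stages between two consecutive skeleta, through which the \<open>n\<close>-cells are attached one
at a time.\<close>

definition skel_with :: "nat \<Rightarrow> 'c set \<Rightarrow> 'a topology" where
  "skel_with n C = subtopology (cw_top X) (cw_points X (cw_skel X (int n - 1) \<union> C))"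

definition skel_pts :: "int \<Rightarrow> 'a set" where
  "skel_pts k = cw_points X (cw_skel X k)"

lemma topspace_skel_with:
  assumes "C \<subseteq> cw_kcells X (int n)"
  shows "topspace (skel_with n C) = skel_pts (int n - 1) \<union> cw_points X C"
proof -
  have "cw_skel X (int n - 1) \<union> C \<subseteq> cw_cells X"
    using assms by (auto simp: cw_skel_def cw_kcells_def)
  then show ?thesis
    using cw_points_subset unfolding skel_with_def skel_pts_def cw_points_Un by auto
qed

lemma continuous_map_skel_with:
  assumes "c \<in> C" "C \<subseteq> cw_kcells X (int n)"
  shows "continuous_map (disc n) (skel_with n C) (cw_map X c)"
proof -
  have c: "c \<in> cw_cells X" "cw_dim X c = n" using assms by (auto simp: cw_kcells_def)
  have "cw_map X c ` topspace (disc n) \<subseteq> cw_points X (cw_skel X (int n - 1) \<union> C)"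
    using closed_cell_subset[OF c(1)] c assms(1)
      cw_points_mono[of "insert c (cw_skel X (int n - 1))" "cw_skel X (int n - 1) \<union> C"] by auto
  then show ?thesis
    using continuous_cw_map[OF c(1)] c
    by (auto simp: skel_with_def continuous_map_in_subtopology)
qed

text \<open>Adding an \<open>n\<close>-cell to a stage is an attachment in the above sense. The smaller stage is closed since
it is a finite union of closed cells, each of them compact.\<close>

lemma cell_attachment_skel_with:
  assumes "insert c C \<subseteq> cw_kcells X (int n)" "c \<notin> C"
  shows "cell_attachment (skel_with n (insert c C)) (topspace (skel_with n C)) n (cw_map X c)"
proof
  have c: "c \<in> cw_cells X" "cw_dim X c = n" using assms by (auto simp: cw_kcells_def)
  have C: "C \<subseteq> cw_kcells X (int n)" using assms by simp
  have sub: "cw_skel X (int n - 1) \<union> C \<subseteq> cw_cells X"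
    using assms by (auto simp: cw_skel_def cw_kcells_def)
  have pts: "topspace (skel_with n C) = cw_points X (cw_skel X (int n - 1) \<union> C)"
    using topspace_skel_with[OF C] by (simp add: skel_pts_def cw_points_Un)
  have pts': "topspace (skel_with n (insert c C)) = topspace (skel_with n C) \<union> cw_map X c ` open_disc n"
    using topspace_skel_with[OF C] topspace_skel_with[OF assms(1)] c by (auto simp: cw_points_def)
  show "Hausdorff_space (skel_with n (insert c C))"
    unfolding skel_with_def by (rule Hausdorff_space_subtopology[OF hausdorff])
  have "cw_subcomplex X (cw_skel X (int n - 1) \<union> C)"
    by (rule cw_subcomplex_between_skeleta[of "int n"]) (use C in \<open>auto simp: cw_skel_def cw_kcells_def\<close>)
  then show "closedin (skel_with n (insert c C)) (topspace (skel_with n C))"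
    unfolding pts unfolding skel_with_def
    by (intro closedin_subset_topspace closedin_subcomplex cw_points_mono) auto
  show "continuous_map (disc n) (skel_with n (insert c C)) (cw_map X c)"
    using assms by (intro continuous_map_skel_with) auto
  show "cw_map X c ` disc_sphere n \<subseteq> topspace (skel_with n C)"
    using attaching[OF c(1)] c topspace_skel_with[OF C] by (auto simp: skel_pts_def)
  show "inj_on (cw_map X c) (open_disc n)"
    using inj_on_open_cell[OF c(1)] c by simp
  have "c \<notin> cw_skel X (int n - 1) \<union> C" using c assms by (auto simp: cw_skel_def)
  then show "cw_map X c ` open_disc n \<inter> topspace (skel_with n C) = {}"
    using open_cell_disjoint[OF c(1) sub] c by (simp add: pts)
  show "topspace (skel_with n (insert c C)) = topspace (skel_with n C) \<union> cw_map X c ` open_disc n"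
    by (rule pts')
qed

definition cell_class_in :: "nat \<Rightarrow> 'c set \<Rightarrow> 'c \<Rightarrow> 'a chain set" where
  "cell_class_in n C c = hom_induced (int n) (disc n) (disc_sphere n) (skel_with n C)
     (skel_pts (int n - 1)) (cw_map X c) (disc_generator n)"

lemma sphere_to_skel_pts:
  "c \<in> cw_kcells X (int n) \<Longrightarrow> cw_map X c \<in> disc_sphere n \<rightarrow> skel_pts (int n - 1)"
  using attaching[of c] by (auto simp: cw_kcells_def skel_pts_def)

text \<open>Induction over the cells. For the new stage, the old one and the lower skeleton, consider the exact
sequence of the triple. Its third group \<open>H\<^sub>n\<close> of the new stage modulo the old one is free on the class
of the new cell, because the characteristic map identifies it with that of the disc modulo its
sphere. The preceding group \<open>H\<^sub>n\<^sub>+\<^sub>1\<close> of this pair vanishes for the same reason, so the first map is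
injective, and the basis of the old stage extends.\<close>

lemma skel_with_basis:
  assumes "finite C" "C \<subseteq> cw_kcells X (int n)"
  shows "free_basis (relative_homology_group (int n) (skel_with n C) (skel_pts (int n - 1)))
    (cell_class_in n C) C"
  using assms
proof (induction C)
  case empty
  have "topspace (skel_with n {}) = skel_pts (int n - 1)"
    using topspace_skel_with[of "{}" n] by (simp add: cw_points_def)
  then have "trivial_group (relative_homology_group (int n) (skel_with n {}) (skel_pts (int n - 1)))"
    using trivial_relative_homology_group_topspace[of "int n" "skel_with n {}"] by simp
  then show ?case
    by (auto simp: free_basis_def int_comb_def trivial_group_def comm_group.axioms comm_monoid.finprod_empty)
next
  case (insert c C)
  let ?Y = "skel_with n (insert c C)" and ?S = "topspace (skel_with n C)" and ?T = "skel_pts (int n - 1)"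
  have c: "c \<in> cw_kcells X (int n)" and C: "C \<subseteq> cw_kcells X (int n)" using insert by auto
  interpret cell_attachment ?Y ?S n "cw_map X c"
    using insert by (intro cell_attachment_skel_with) auto
  have TS: "?T \<subseteq> ?S" using topspace_skel_with[OF C] by simp
  have sub: "subtopology ?Y ?S = skel_with n C"
  proof -
    have "cw_points X (cw_skel X (int n - 1) \<union> C) \<subseteq> cw_points X (cw_skel X (int n - 1) \<union> insert c C)"
      by (intro cw_points_mono) auto
    moreover have "?S = cw_points X (cw_skel X (int n - 1) \<union> C)"
      using topspace_skel_with[OF C] by (simp add: skel_pts_def cw_points_Un)
    ultimately show ?thesis
      by (simp add: skel_with_def subtopology_subtopology inf_absorb2)
  qed
  let ?G = "relative_homology_group (int n) (skel_with n C) ?T"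
  let ?G' = "relative_homology_group (int n) ?Y ?T"
  let ?Q = "relative_homology_group (int n) ?Y ?S"
  let ?i = "hom_induced (int n) (skel_with n C) ?T ?Y ?T id"
  let ?q = "hom_induced (int n) ?Y ?T ?Y ?S id"
  have "trivial_group (relative_homology_group (int n + 1) ?Y ?S)"
  proof -
    have "relative_homology_group (int n + 1) (disc n) (disc_sphere n) \<cong> relative_homology_group (int n + 1) ?Y ?S"
      using characteristic_map_iso is_isoI by blast
    then show ?thesis
      using iffD1[OF isomorphic_group_triviality] disc_homology_trivial[of "int n + 1" n]
        group_relative_homology_group by (metis add_cancel_right_right one_neq_zero)
  qed
  moreover have "exact_seq ([?G', ?G, relative_homology_group (int n + 1) ?Y ?S],
      [?i, hom_relboundary (int n + 1) ?Y ?S ?T])"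
    using homology_exactness_triple_2[OF TS, of "int n + 1" ?Y] by (simp add: sub)
  ultimately have ker_i: "kernel ?G ?G' ?i = {hom_relboundary (int n + 1) ?Y ?S ?T \<one>\<^bsub>relative_homology_group (int n + 1) ?Y ?S\<^esub>}"
    by (simp add: trivial_group_def)
  have hom_i: "group_hom ?G ?G' ?i"
    by (simp add: group_hom_def group_hom_axioms_def hom_induced_hom)
  have "hom_relboundary (int n + 1) ?Y ?S ?T \<in> hom (relative_homology_group (int n + 1) ?Y ?S) ?G"
    using group_homomorphism_hom_relboundary[of "int n + 1" ?Y ?S ?T] by (simp add: sub)
  from hom_one[OF this] have "kernel ?G ?G' ?i = {\<one>\<^bsub>?G\<^esub>}"
    unfolding ker_i by simp
  then have inj: "inj_on ?i (carrier ?G)"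
    using group_hom.inj_iff_trivial_ker[OF hom_i] by simp
  have ker: "kernel ?G' ?Q ?q = ?i ` carrier ?G"
    using homology_exactness_triple_3[OF TS, of "int n" ?Y] by (simp add: sub)
  have cY: "continuous_map (disc n) ?Y (cw_map X a)" if "a \<in> insert c C" for a
    using continuous_map_skel_with[OF that] insert by simp
  have q: "?q (cell_class_in n (insert c C) c) =
      hom_induced (int n) (disc n) (disc_sphere n) ?Y ?S (cw_map X c) (disc_generator n)"
    unfolding cell_class_in_def using cY sphere_to_skel_pts[OF c] TS
    by (subst hom_induced_compose') auto
  show ?case
  proof (rule free_basis_extend[OF _ _ _ _ _ inj ker])
    show "free_basis ?G (cell_class_in n C) C" using insert by simp
    show "comm_group ?G'" by simp
    show "free_basis ?Q (\<lambda>_. ?q (cell_class_in n (insert c C) c)) {c}"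
      unfolding q by (rule free_basis_iso[OF disc_generator_basis characteristic_map_iso]) simp
    show "?i \<in> hom ?G ?G'" "?q \<in> hom ?G' ?Q" by (simp_all add: hom_induced_hom)
    show "c \<notin> C" by fact
    show "cell_class_in n (insert c C) c \<in> carrier ?G'"
      by (simp add: cell_class_in_def hom_induced_carrier)
    fix a assume a: "a \<in> C"
    have "continuous_map (subtopology ?Y ?S) ?Y id"
      by (rule continuous_map_id_subt)
    then have "continuous_map (skel_with n C) ?Y id"
      by (simp only: sub)
    then show "cell_class_in n (insert c C) a = ?i (cell_class_in n C a)"
      unfolding cell_class_in_def using sphere_to_skel_pts[of a n] a C continuous_map_skel_with[OF a C]
      by (subst hom_induced_compose') auto
  qed
qed

lemma skel_with_kcells: "skel_with n (cw_kcells X (int n)) = subtopology (cw_top X) (cw_points X (cw_skel X (int n)))"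
  using cw_skel_split[of "int n"] by (simp add: skel_with_def)

lemma cellular_group_basis:
  "free_basis (cellular_group X (int n)) (cell_class X) (cw_kcells X (int n))"
proof -
  have "cell_class_in n (cw_kcells X (int n)) c = cell_class X c" if "c \<in> cw_kcells X (int n)" for c
    using that unfolding cell_class_in_def cell_class_def Let_def skel_with_kcells skel_pts_def
    by (auto simp: cw_kcells_def)
  then show ?thesis
    using free_basis_cong[OF skel_with_basis[OF finite_kcells order_refl, of n]]
    unfolding cellular_group_def skel_with_kcells skel_pts_def by simp
qed

text \<open>Freeness gives existence and uniqueness of the coefficients by which the incidence numbers are
defined.\<close>

lemma incidence_property:
  assumes b: "b \<in> cw_kcells X (int (Suc n))"
  shows "cellular_boundary X (int (Suc n)) (cell_class X b) =
    int_comb (cellular_group X (int n)) (cell_class X) (incidence X b) (cw_kcells X (int n))"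
proof -
  let ?k = "int (Suc n)" and ?G = "cellular_group X (int n)"
  have dim: "cw_dim X b = Suc n" using b by (auto simp: cw_kcells_def)
  have "subtopology (subtopology (cw_top X) (cw_points X (cw_skel X ?k))) (cw_points X (cw_skel X (?k - 1)))
      = subtopology (cw_top X) (cw_points X (cw_skel X (?k - 1)))"
  proof -
    have "cw_points X (cw_skel X (?k - 1)) \<subseteq> cw_points X (cw_skel X ?k)"
      by (intro cw_points_mono) (auto simp: cw_skel_def)
    then show ?thesis by (simp add: subtopology_subtopology inf_absorb2)
  qed
  then have "cellular_boundary X ?k (cell_class X b) \<in> carrier ?G"
    using hom_relboundary[of ?k "subtopology (cw_top X) (cw_points X (cw_skel X ?k))"
        "cw_points X (cw_skel X (?k - 1))" "cw_points X (cw_skel X (?k - 2))"]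
    by (simp add: cellular_boundary_def cellular_group_def)
  from free_basis_ex1[OF cellular_group_basis this]
  have "\<exists>!m. (\<forall>a. a \<notin> cw_kcells X (int n) \<longrightarrow> m a = 0) \<and>
      cellular_boundary X ?k (cell_class X b) = int_comb ?G (cell_class X) m (cw_kcells X (int n))" .
  from theI'[OF this] show ?thesis
    unfolding incidence_def int_comb_def Let_def dim by simp
qed

lemma cellular_boundary_hom:
  "cellular_boundary X k \<in> hom (cellular_group X k) (cellular_group X (k - 1))"
proof -
  have "cw_points X (cw_skel X (k - 1)) \<subseteq> cw_points X (cw_skel X k)"
    by (intro cw_points_mono) (auto simp: cw_skel_def)
  then show ?thesis
    using group_homomorphism_hom_relboundary[of k "subtopology (cw_top X) (cw_points X (cw_skel X k))"
        "cw_points X (cw_skel X (k - 1))" "cw_points X (cw_skel X (k - 2))"]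
    by (simp add: cellular_boundary_def cellular_group_def subtopology_subtopology inf_absorb2)
qed

text \<open>The composite contains two consecutive maps of the exact sequence of the pair \<open>(X\<^sup>(\<^sup>k\<^sup>-\<^sup>1\<^sup>), X\<^sup>(\<^sup>k\<^sup>-\<^sup>2\<^sup>))\<close>,
namely the map from absolute to relative homology followed by the boundary map.\<close>

lemma cellular_boundary_boundary:
  assumes "x \<in> carrier (cellular_group X k)"
  shows "cellular_boundary X (k - 1) (cellular_boundary X k x) = \<one>\<^bsub>cellular_group X (k - 2)\<^esub>"
proof -
  let ?P = "\<lambda>k. cw_points X (cw_skel X k)"
  let ?X = "\<lambda>k. subtopology (cw_top X) (?P k)"
  have sub: "subtopology (?X j) (?P (j - 1)) = ?X (j - 1)" for j
  proof -
    have "?P (j - 1) \<subseteq> ?P j" by (intro cw_points_mono) (auto simp: cw_skel_def)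
    then show ?thesis by (simp add: subtopology_subtopology inf_absorb2)
  qed
  define y where "y = hom_boundary k (?X k) (?P (k - 1)) x"
  have y: "y \<in> carrier (homology_group (k - 1) (?X (k - 1)))"
    using hom_boundary_carrier[of k "?X k" "?P (k - 1)" x] by (simp add: y_def sub)
  have sub2: "subtopology (?X (k - 1)) (?P (k - 2)) = ?X (k - 2)"
    using sub[of "k - 1"] by simp
  have "hom_boundary (k - 1) (?X (k - 1)) (?P (k - 2))
      (hom_induced (k - 1) (?X (k - 1)) {} (?X (k - 1)) (?P (k - 2)) id y)
      = \<one>\<^bsub>homology_group (k - 2) (?X (k - 2))\<^esub>"
    using homology_exactness_axiom_1[of "k - 1" "?X (k - 1)" "?P (k - 2)"] y
    by (auto simp: sub2 kernel_def image_def set_eq_iff)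
  moreover have "hom_induced (k - 2) (?X (k - 2)) {} (?X (k - 2)) (?P (k - 3)) id
      \<one>\<^bsub>homology_group (k - 2) (?X (k - 2))\<^esub> = \<one>\<^bsub>cellular_group X (k - 2)\<^esub>"
    unfolding cellular_group_def by (simp add: hom_one[OF hom_induced_hom])
  ultimately show ?thesis
    by (simp add: cellular_boundary_def hom_relboundary_def sub sub2 y_def)
qed

text \<open>The two matrices express consecutive cellular boundaries in the bases of cells; the composite is
trivial, and coefficients in a basis are unique.\<close>

theorem incidence_incidence:
  assumes "b \<in> cw_kcells X k" "c \<in> cw_kcells X (k - 2)"
  shows "(\<Sum>a\<in>cw_kcells X (k - 1). incidence X b a * incidence X a c) = 0"
proof -
  define n where "n = cw_dim X c"
  have k: "k = int (Suc (Suc n))" using assms by (auto simp: cw_kcells_def n_def)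
  let ?K0 = "cw_kcells X (int n)" and ?K1 = "cw_kcells X (int (Suc n))"
  let ?G0 = "cellular_group X (int n)" and ?G1 = "cellular_group X (int (Suc n))"
  have comm: "comm_group (cellular_group X j)" for j
    by (simp add: cellular_group_def)
  interpret G0: comm_group ?G0 by (rule comm)
  have e0: "cell_class X \<in> ?K0 \<rightarrow> carrier ?G0" and e1: "cell_class X \<in> ?K1 \<rightarrow> carrier ?G1"
    using cellular_group_basis[of n] cellular_group_basis[of "Suc n"]
    by (simp_all add: free_basis_def del: of_nat_Suc)
  have e2: "cell_class X b \<in> carrier (cellular_group X k)"
    using cellular_group_basis[of "Suc (Suc n)"] assms(1) by (auto simp: free_basis_def k Pi_iff)
  let ?d1 = "cellular_boundary X (int (Suc n))"
  have h1: "?d1 \<in> hom ?G1 ?G0"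
    using cellular_boundary_hom[of "int (Suc n)"] by simp
  have "\<one>\<^bsub>?G0\<^esub> = ?d1 (cellular_boundary X k (cell_class X b))"
    using cellular_boundary_boundary[OF e2] by (simp add: k)
  also have "cellular_boundary X k (cell_class X b) = int_comb ?G1 (cell_class X) (incidence X b) ?K1"
    using incidence_property[of b "Suc n"] assms(1) by (simp add: k)
  also have "?d1 \<dots> = int_comb ?G0 (\<lambda>a. ?d1 (cell_class X a)) (incidence X b) ?K1"
    by (rule hom_int_comb[OF comm comm h1 e1])
  also have "\<dots> = int_comb ?G0 (\<lambda>a. int_comb ?G0 (cell_class X) (incidence X a) ?K0) (incidence X b) ?K1"
    using e0 by (intro G0.int_comb_cong) (auto simp: incidence_property simp del: of_nat_Suc)
  also have "\<dots> = int_comb ?G0 (cell_class X) (\<lambda>c. \<Sum>a\<in>?K1. incidence X b a * incidence X a c) ?K0"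
    using finite_kcells e0 by (rule G0.int_comb_comb)
  finally have eq: "int_comb ?G0 (cell_class X)
      (\<lambda>c. \<Sum>a\<in>?K1. incidence X b a * incidence X a c) ?K0 = \<one>\<^bsub>?G0\<^esub>" ..
  have "\<forall>m. int_comb ?G0 (cell_class X) m ?K0 = \<one>\<^bsub>?G0\<^esub> \<longrightarrow> (\<forall>c\<in>?K0. m c = 0)"
    using cellular_group_basis[of n] unfolding free_basis_def by (elim conjE)
  from this[rule_format, OF eq] show ?thesis using assms(2) by (simp add: k)
qed

end

section \<open>Complements of the row space of an integer matrix\<close>

definition supported_on :: "'c set \<Rightarrow> ('c \<Rightarrow> 'f::zero) set" where
  "supported_on A = {z. \<forall>c. c \<notin> A \<longrightarrow> z c = 0}"

text \<open>The coefficients are taken in an arbitrary ring: over the integers this is the lattice of integral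
boundaries, over the rationals and reals it is the space of boundaries.\<close>

definition row_span :: "'b set \<Rightarrow> ('b \<Rightarrow> 'c \<Rightarrow> int) \<Rightarrow> ('c \<Rightarrow> 'f::comm_ring_1) set" where
  "row_span M D = range (\<lambda>y a. \<Sum>b\<in>M. of_int (D b a) * y b)"

lemma supported_onD: "z \<in> supported_on A \<Longrightarrow> c \<notin> A \<Longrightarrow> z c = 0"
  by (simp add: supported_on_def)

lemma row_span_zero: "(\<lambda>_. 0) \<in> row_span M D"
  unfolding row_span_def by (rule range_eqI[of _ _ "\<lambda>_. 0"]) simp

lemma row_span_lincomb:
  assumes "finite I" "\<And>i. i \<in> I \<Longrightarrow> v i \<in> row_span M D"
  shows "(\<lambda>a. \<Sum>i\<in>I. r i * v i a) \<in> row_span M D"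
proof -
  have "\<forall>i\<in>I. \<exists>y. v i = (\<lambda>a. \<Sum>b\<in>M. of_int (D b a) * y b)"
    using assms(2) by (auto simp: row_span_def)
  then obtain y where y: "\<And>i. i \<in> I \<Longrightarrow> v i = (\<lambda>a. \<Sum>b\<in>M. of_int (D b a) * y i b)"
    by metis
  have "(\<Sum>i\<in>I. r i * v i a) = (\<Sum>b\<in>M. of_int (D b a) * (\<Sum>i\<in>I. r i * y i b))" for a
  proof -
    have "(\<Sum>i\<in>I. r i * v i a) = (\<Sum>i\<in>I. \<Sum>b\<in>M. of_int (D b a) * (r i * y i b))"
      by (intro sum.cong refl) (simp add: y sum_distrib_left mult.left_commute)
    also have "\<dots> = (\<Sum>b\<in>M. \<Sum>i\<in>I. of_int (D b a) * (r i * y i b))"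
      by (rule sum.swap)
    finally show ?thesis by (simp add: sum_distrib_left)
  qed
  then show ?thesis unfolding row_span_def by auto
qed

lemma row_span_scale:
  assumes "v \<in> row_span M D"
  shows "(\<lambda>a. r * v a) \<in> row_span M D"
  using row_span_lincomb[of "{()}" "\<lambda>_. v" M D "\<lambda>_. r"] assms by simp

lemma row_span_add:
  assumes "v \<in> row_span M D" "w \<in> row_span M D"
  shows "(\<lambda>a. v a + w a) \<in> row_span M D"
  using row_span_lincomb[of "{True, False}" "\<lambda>b. if b then v else w" M D "\<lambda>_. 1"] assms by simp

lemma row_span_diff:
  assumes "v \<in> row_span M D" "w \<in> row_span M D"
  shows "(\<lambda>a. v a - w a) \<in> row_span M D"
  using row_span_add[OF assms(1) row_span_scale[OF assms(2), of "-1"]] by simp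

lemma row_in_row_span:
  assumes "finite M" "b \<in> M"
  shows "(\<lambda>a. of_int (D b a)) \<in> row_span M D"
  unfolding row_span_def
  by (rule range_eqI[of _ _ "\<lambda>b'. if b' = b then 1 else 0"]) (use assms in \<open>simp add: if_distrib[of "(*) _"] cong: if_cong\<close>)

lemma of_rat_row_span:
  assumes "v \<in> row_span M D"
  shows "(\<lambda>a. of_rat (v a) :: 'f::field_char_0) \<in> row_span M D"
proof -
  obtain y where "v = (\<lambda>a. \<Sum>b\<in>M. of_int (D b a) * y b)"
    using assms by (auto simp: row_span_def)
  then have "(\<lambda>a. of_rat (v a) :: 'f) = (\<lambda>a. \<Sum>b\<in>M. of_int (D b a) * of_rat (y b))"
    by (simp add: of_rat_sum of_rat_mult)
  then show ?thesis unfolding row_span_def by auto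
qed

lemma functional_vanishes_on_row_span:
  assumes "\<And>b. b \<in> M \<Longrightarrow> (\<Sum>u\<in>U. l u * D b u) = 0" "v \<in> row_span M D"
  shows "(\<Sum>u\<in>U. of_int (l u) * v u) = 0"
proof -
  obtain y where y: "v = (\<lambda>a. \<Sum>b\<in>M. of_int (D b a) * y b)"
    using assms(2) by (auto simp: row_span_def)
  have "(\<Sum>u\<in>U. of_int (l u) * v u) = (\<Sum>u\<in>U. \<Sum>b\<in>M. of_int (l u * D b u) * y b)"
    by (simp add: y sum_distrib_left mult.assoc)
  also have "\<dots> = (\<Sum>b\<in>M. of_int (\<Sum>u\<in>U. l u * D b u) * y b)"
    by (subst sum.swap) (simp add: sum_distrib_right)
  also have "\<dots> = 0" using assms(1) by simp
  finally show ?thesis .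
qed

lemma common_denominator:
  fixes q :: "'i \<Rightarrow> rat"
  assumes "finite I"
  obtains K :: int where "K > 0" "\<And>i. i \<in> I \<Longrightarrow> of_int K * q i \<in> \<int>"
proof -
  have "\<exists>K::int. K > 0 \<and> (\<forall>i\<in>I. of_int K * q i \<in> \<int>)"
    using assms
  proof induction
    case empty
    show ?case by (intro exI[of _ 1]) simp
  next
    case (insert i I)
    then obtain K :: int where K: "K > 0" "\<forall>i\<in>I. of_int K * q i \<in> \<int>" by auto
    obtain a b where ab: "quotient_of (q i) = (a, b)" by fastforce
    then have b: "b > 0" "q i = of_int a / of_int b"
      using quotient_of_denom_pos quotient_of_div by auto
    have "of_int (K * b) * q j \<in> \<int>" if "j \<in> insert i I" for j
    proof (cases "j = i")
      case True
      then have "of_int (K * b) * q j = of_int (K * a)" using b by simp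
      then show ?thesis by (metis Ints_of_int)
    next
      case False
      then have "of_int K * q j \<in> \<int>" using that K(2) by blast
      then have "of_int b * (of_int K * q j) \<in> \<int>" by (rule Ints_mult[OF Ints_of_int])
      moreover have "of_int (K * b) * q j = of_int b * (of_int K * q j)" by simp
      ultimately show ?thesis by (simp only:)
    qed
    then show ?case using K b by (intro exI[of _ "K * b"]) simp
  qed
  then show ?thesis using that by blast
qed

locale int_matrix =
  fixes M :: "'b set" and N :: "'c set" and D :: "'b \<Rightarrow> 'c \<Rightarrow> int"
  assumes finite_rows: "finite M" and finite_cols: "finite N"
    and D_outside: "a \<notin> N \<Longrightarrow> D b a = 0"
begin

lemma row_span_supported: "v \<in> row_span M D \<Longrightarrow> v \<in> supported_on N"
  by (auto simp: row_span_def supported_on_def D_outside)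

text \<open>The vectors supported on \<open>L\<close> form a linear complement of the rational row space. The first condition
says that the two spaces meet trivially. The second says that they span everything, in the form that
provides the basis of the row space dual to the coordinates outside \<open>L\<close>.\<close>

definition cotree_set :: "'c set \<Rightarrow> bool" where
  "cotree_set L \<longleftrightarrow> L \<subseteq> N \<and>
     (\<forall>v \<in> row_span M D :: ('c \<Rightarrow> rat) set. v \<in> supported_on L \<longrightarrow> v = (\<lambda>_. 0)) \<and>
     (\<forall>f\<in>N - L. \<exists>u \<in> row_span M D :: ('c \<Rightarrow> rat) set. \<forall>g\<in>N - L. u g = (if g = f then 1 else 0))"

definition dual :: "'c set \<Rightarrow> 'c \<Rightarrow> 'c \<Rightarrow> rat" where
  "dual L = (SOME u. \<forall>f\<in>N - L. u f \<in> row_span M D \<and> (\<forall>g\<in>N - L. u f g = (if g = f then 1 else 0)))"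

text \<open>The projection along the row space onto the vectors supported on \<open>L\<close>: combinations of the dual
vectors remove the coordinates outside \<open>L\<close>. The dual vectors being rational, the formula makes sense
over every field of characteristic \<open>0\<close>.\<close>

definition proj :: "'c set \<Rightarrow> ('c \<Rightarrow> 'f::field_char_0) \<Rightarrow> 'c \<Rightarrow> 'f" where
  "proj L z = (\<lambda>c. z c - (\<Sum>f\<in>N - L. z f * of_rat (dual L f c)))"

lemma finite_cotree_sets: "finite {L. cotree_set L}"
  by (rule finite_subset[of _ "Pow N"]) (auto simp: cotree_set_def finite_cols)

lemma dual:
  assumes "cotree_set L" "f \<in> N - L"
  shows dual_row_span: "dual L f \<in> row_span M D"
    and dual_unit: "g \<in> N - L \<Longrightarrow> dual L f g = (if g = f then 1 else 0)"
proof -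
  have "\<exists>u. \<forall>f\<in>N - L. u f \<in> (row_span M D :: ('c \<Rightarrow> rat) set) \<and> (\<forall>g\<in>N - L. u f g = (if g = f then 1 else 0))"
    using assms(1) unfolding cotree_set_def by (intro bchoice) blast
  from someI_ex[OF this, folded dual_def] assms(2)
  show "dual L f \<in> row_span M D" "g \<in> N - L \<Longrightarrow> dual L f g = (if g = f then 1 else 0)"
    by auto
qed

lemma proj_lincomb:
  "finite I \<Longrightarrow> proj L (\<lambda>a. \<Sum>i\<in>I. r i * v i a) = (\<lambda>c. \<Sum>i\<in>I. r i * proj L (v i) c)"
  unfolding proj_def
  by (rule ext) (simp add: right_diff_distrib sum_subtractf sum_distrib_left sum_distrib_right mult.assoc,
      rule sum.swap)

lemma proj_add: "proj L (\<lambda>a. v a + w a) = (\<lambda>c. proj L v c + proj L w c)"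
  unfolding proj_def by (rule ext) (simp add: distrib_right sum.distrib)

lemma proj_diff: "proj L (\<lambda>a. v a - w a) = (\<lambda>c. proj L v c - proj L w c)"
  unfolding proj_def by (rule ext) (simp add: left_diff_distrib sum_subtractf)

lemma proj_scale: "proj L (\<lambda>a. r * v a) = (\<lambda>c. r * proj L v c)"
  unfolding proj_def by (simp add: right_diff_distrib sum_distrib_left mult.assoc)

lemma proj_of_rat: "proj L (\<lambda>c. of_rat (q c)) = (\<lambda>c. of_rat (proj L q c))"
  unfolding proj_def by (simp add: of_rat_diff of_rat_sum of_rat_mult)

lemma proj_supported:
  assumes "cotree_set L" "z \<in> supported_on N"
  shows "proj L z \<in> supported_on L"
  unfolding supported_on_def
proof (intro CollectI allI impI)
  fix c assume "c \<notin> L"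
  show "proj L z c = 0"
  proof (cases "c \<in> N")
    case True
    then have "dual L f c = (if c = f then 1 else 0)" if "f \<in> N - L" for f
      using dual_unit[OF assms(1) that, of c] \<open>c \<notin> L\<close> by simp
    then have "(\<Sum>f\<in>N - L. z f * of_rat (dual L f c)) = (\<Sum>f\<in>N - L. if f = c then z c else 0)"
      by (intro sum.cong refl) simp
    also have "\<dots> = z c"
      using True \<open>c \<notin> L\<close> finite_cols by simp
    finally show ?thesis by (simp add: proj_def)
  next
    case False
    have "dual L f c = 0" if "f \<in> N - L" for f
      using row_span_supported[OF dual_row_span[OF assms(1) that]] False by (rule supported_onD)
    then show ?thesis
      using supported_onD[OF assms(2) False] by (simp add: proj_def)
  qed
qed

lemma diff_proj_row_span:
  assumes "cotree_set L"
  shows "(\<lambda>c. z c - proj L z c) \<in> row_span M D"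
proof -
  have "(\<lambda>c. \<Sum>f\<in>N - L. z f * of_rat (dual L f c)) \<in> row_span M D"
  proof (rule row_span_lincomb)
    show "(\<lambda>c. of_rat (dual L f c)) \<in> row_span M D" if "f \<in> N - L" for f
      by (rule of_rat_row_span[OF dual_row_span[OF assms that]])
  qed (simp add: finite_cols)
  then show ?thesis by (simp add: proj_def)
qed

lemma proj_id: "z \<in> supported_on L \<Longrightarrow> proj L z = z"
  unfolding proj_def supported_on_def by simp

lemma proj_row_span_rat:
  fixes v :: "'c \<Rightarrow> rat"
  assumes "cotree_set L" "v \<in> row_span M D"
  shows "proj L v = (\<lambda>_. 0)"
proof -
  have "(\<lambda>c. v c - (v c - proj L v c)) \<in> row_span M D"
    by (intro row_span_diff assms diff_proj_row_span)
  then have "proj L v \<in> row_span M D" by simp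
  moreover have "proj L v \<in> supported_on L"
    using assms by (intro proj_supported row_span_supported)
  ultimately show ?thesis using assms(1) by (auto simp: cotree_set_def)
qed

text \<open>The two spaces are complementary over the rationals by definition. Over the larger field this is
inherited since the rows, which are rational, span the row space there as well.\<close>

lemma proj_row_span:
  assumes "cotree_set L" "v \<in> row_span M D"
  shows "proj L v = (\<lambda>_. 0 :: 'f::field_char_0)"
proof -
  obtain y where y: "v = (\<lambda>a. \<Sum>b\<in>M. y b * of_int (D b a))"
    using assms(2) by (auto simp: row_span_def mult.commute)
  have "proj L (\<lambda>a. of_int (D b a) :: 'f) = (\<lambda>_. 0)" if "b \<in> M" for b
  proof -
    have "proj L (\<lambda>a. of_rat (of_int (D b a)) :: 'f) = (\<lambda>_. 0)"
      unfolding proj_of_rat proj_row_span_rat[OF assms(1) row_in_row_span[OF finite_rows that]] by simp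
    then show ?thesis by simp
  qed
  then show ?thesis
    unfolding y proj_lincomb[OF finite_rows] by simp
qed

lemma proj_unique:
  assumes "cotree_set L" "w \<in> supported_on L" "(\<lambda>c. z c - w c) \<in> row_span M D"
  shows "proj L z = w"
proof -
  have "(\<lambda>c. proj L z c - proj L w c) = (\<lambda>_. 0)"
    using proj_row_span[OF assms(1,3)] unfolding proj_diff .
  from fun_cong[OF this] show ?thesis
    unfolding proj_id[OF assms(2)] by (auto simp: fun_eq_iff)
qed

text \<open>A maximal \<open>L\<close> whose vectors meet the row space trivially also has the second property: enlarging it by
\<open>f\<close> produces a vector of the row space supported on \<open>L \<union> {f}\<close> and not vanishing at \<open>f\<close>.\<close>

lemma cotree_set_exists: "\<exists>L. cotree_set L"
proof -
  let ?good = "\<lambda>L. L \<subseteq> N \<and> (\<forall>v \<in> row_span M D :: ('c \<Rightarrow> rat) set. v \<in> supported_on L \<longrightarrow> v = (\<lambda>_. 0))"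
  have "?good {}" by (auto simp: supported_on_def)
  then have ne: "{L. ?good L} \<noteq> {}" by blast
  have fin: "finite {L. ?good L}"
    by (rule finite_subset[of _ "Pow N"]) (auto simp: finite_cols)
  from finite_has_maximal[OF fin ne] obtain L where L: "?good L"
    and max: "\<forall>L'\<in>{L. ?good L}. L \<subseteq> L' \<longrightarrow> L = L'"
    by (elim bexE) (simp only: mem_Collect_eq)
  have "\<exists>u \<in> row_span M D :: ('c \<Rightarrow> rat) set. \<forall>g\<in>N - L. u g = (if g = f then 1 else 0)" if f: "f \<in> N - L" for f
  proof -
    have "\<not> ?good (insert f L)" using max[rule_format, of "insert f L"] f by blast
    then obtain v :: "'c \<Rightarrow> rat" where v: "v \<in> row_span M D" "v \<in> supported_on (insert f L)" "v \<noteq> (\<lambda>_. 0)"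
      using L f by blast
    have "v f \<noteq> 0"
    proof
      assume "v f = 0"
      then have "v \<in> supported_on L" using v(2) by (auto simp: supported_on_def)
      then show False using L v by auto
    qed
    then show ?thesis
      using row_span_scale[OF v(1), of "1 / v f"] v(2)
      by (intro bexI[of _ "\<lambda>a. 1 / v f * v a"]) (auto simp: supported_on_def)
  qed
  then show ?thesis
    using L unfolding cotree_set_def by blast
qed

text \<open>If \<open>R \<union> {f0}\<close> is a complement of the row space, the row space and the vectors on \<open>R\<close> together span a
hyperplane; \<open>l\<close> is an integral equation of it. Adding the coordinate \<open>f\<close> to \<open>R\<close> yields a complement
precisely if the unit vector at \<open>f\<close> lies outside of the hyperplane.\<close>

lemma circuit_functional:
  assumes "R \<subseteq> N" "f0 \<in> N - R" "cotree_set (insert f0 R)"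
  obtains l :: "'c \<Rightarrow> int"
  where "\<And>b. b \<in> M \<Longrightarrow> (\<Sum>u\<in>N - R. l u * D b u) = 0"
    and "\<And>f. f \<in> N - R \<Longrightarrow> cotree_set (insert f R) \<longleftrightarrow> l f \<noteq> 0"
proof -
  let ?L = "insert f0 R" and ?U = "N - R"
  let ?S = "N - insert f0 R"
  have U: "?U = insert f0 ?S" "f0 \<notin> ?S" using assms by auto
  \<comment> \<open>The functional takes the \<open>f0\<close>-coordinate of the projection for \<open>R \<union> {f0}\<close>.\<close>
  define \<mu> :: "'c \<Rightarrow> rat" where "\<mu> u = (if u = f0 then 1 else - dual ?L u f0)" for u
  have \<mu>: "(\<Sum>u\<in>?U. \<mu> u * v u) = 0" if v: "v \<in> row_span M D" for v
  proof -
    have "(\<Sum>u\<in>?U. \<mu> u * v u) = v f0 + (\<Sum>u\<in>?S. \<mu> u * v u)"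
      by (subst U(1), subst sum.insert) (use U(2) finite_cols in \<open>simp_all add: \<mu>_def\<close>)
    also have "(\<Sum>u\<in>?S. \<mu> u * v u) = (\<Sum>u\<in>?S. - (v u * dual ?L u f0))"
      by (intro sum.cong refl) (auto simp: \<mu>_def)
    also have "v f0 + \<dots> = proj ?L v f0"
      by (simp add: proj_def sum_negf)
    also have "\<dots> = 0"
      using proj_row_span[OF assms(3) v] by simp
    finally show ?thesis .
  qed
  have cotree_iff: "cotree_set (insert f R) \<longleftrightarrow> \<mu> f \<noteq> 0" if f: "f \<in> ?U" for f
  proof
    assume cf: "cotree_set (insert f R)"
    show "\<mu> f \<noteq> 0"
    proof
      assume 0: "\<mu> f = 0"
      then have "f \<noteq> f0" by (auto simp: \<mu>_def)
      then have f0: "f0 \<in> N - insert f R" using assms f by auto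
      have "(\<Sum>u\<in>?U. \<mu> u * dual (insert f R) f0 u) = (\<Sum>u\<in>?U. if u = f0 then \<mu> f0 else 0)"
      proof (intro sum.cong refl)
        fix u assume "u \<in> ?U"
        then show "\<mu> u * dual (insert f R) f0 u = (if u = f0 then \<mu> f0 else 0)"
          using dual_unit[OF cf f0, of u] 0 by (cases "u = f") auto
      qed
      also have "\<dots> = 1" using assms finite_cols by (simp add: \<mu>_def)
      finally show False using \<mu>[OF dual_row_span[OF cf f0]] by simp
    qed
  next
    assume nz: "\<mu> f \<noteq> 0"
    show "cotree_set (insert f R)"
    proof (cases "f = f0")
      case False
      then have fS: "f \<in> ?S" using f by auto
      have d0: "dual ?L f f0 \<noteq> 0" using nz False by (simp add: \<mu>_def)
      show ?thesis
        unfolding cotree_set_def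
      proof (intro conjI ballI impI)
        show "insert f R \<subseteq> N" using assms f by auto
      next
        fix v :: "'c \<Rightarrow> rat" assume v: "v \<in> row_span M D" "v \<in> supported_on (insert f R)"
        have "(\<Sum>u\<in>?U. \<mu> u * v u) = (\<Sum>u\<in>?U. if u = f then \<mu> f * v f else 0)"
          using v(2) by (intro sum.cong refl) (auto simp: supported_on_def)
        also have "\<dots> = \<mu> f * v f" using f finite_cols by simp
        finally have "v f = 0" using \<mu>[OF v(1)] nz by simp
        then have "v \<in> supported_on ?L" using v(2) by (auto simp: supported_on_def)
        then show "v = (\<lambda>_. 0)" using assms(3) v(1) unfolding cotree_set_def by blast
      next
        fix g assume g: "g \<in> N - insert f R"
        \<comment> \<open>Exchange step: \<open>u0\<close> is the dual vector of \<open>f0\<close> for \<open>R \<union> {f}\<close>, and the other dual vectors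
          are corrected by multiples of it.\<close>
        define u0 where "u0 = (\<lambda>a. 1 / dual ?L f f0 * dual ?L f a)"
        have u0: "u0 \<in> row_span M D"
          unfolding u0_def by (rule row_span_scale[OF dual_row_span[OF assms(3) fS]])
        have u0_val: "u0 h = (if h = f0 then 1 else 0)" if "h \<in> N - insert f R" for h
          using that d0 dual_unit[OF assms(3) fS, of h] by (cases "h = f0") (auto simp: u0_def)
        show "\<exists>u\<in>row_span M D. \<forall>h\<in>N - insert f R. u h = (if h = g then 1 else (0::rat))"
        proof (cases "g = f0")
          case True
          then show ?thesis using u0 u0_val by blast
        next
          case False
          then have gS: "g \<in> ?S" using g by auto
          let ?u = "\<lambda>a. dual ?L g a - dual ?L g f0 * u0 a"
          have "?u \<in> row_span M D"
            by (intro row_span_diff dual_row_span[OF assms(3) gS] row_span_scale u0)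
          moreover have "?u h = (if h = g then 1 else 0)" if h: "h \<in> N - insert f R" for h
          proof (cases "h = f0")
            case True
            then show ?thesis using u0_val[OF h] False by simp
          next
            case neq: False
            then have "h \<in> ?S" using h by blast
            from dual_unit[OF assms(3) gS this] show ?thesis
              using u0_val[OF h] neq by simp
          qed
          ultimately show ?thesis
            by (intro bexI[of _ ?u] ballI)
        qed
      qed
    qed (use assms in simp)
  qed
  \<comment> \<open>Clearing denominators makes the functional integral.\<close>
  obtain K :: int where K: "K > 0" "\<And>u. u \<in> N \<Longrightarrow> of_int K * \<mu> u \<in> \<int>"
    by (fact common_denominator[OF finite_cols, of \<mu>])
  have "\<forall>u\<in>N. \<exists>i. of_int i = of_int K * \<mu> u"
  proof
    fix u assume "u \<in> N"
    from K(2)[OF this] show "\<exists>i. of_int i = of_int K * \<mu> u"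
      by (rule Ints_cases) (metis)
  qed
  from bchoice[OF this] obtain l :: "'c \<Rightarrow> int" where l: "\<And>u. u \<in> N \<Longrightarrow> of_int (l u) = of_int K * \<mu> u"
    by blast
  show ?thesis
  proof (rule that[of l])
    fix b assume b: "b \<in> M"
    have "(of_int (\<Sum>u\<in>?U. l u * D b u) :: rat) = (\<Sum>u\<in>?U. of_int (l u) * of_int (D b u))"
      by simp
    also have "\<dots> = (\<Sum>u\<in>?U. of_int K * (\<mu> u * of_int (D b u)))"
      by (intro sum.cong refl) (simp add: l)
    also have "\<dots> = of_int K * (\<Sum>u\<in>?U. \<mu> u * of_int (D b u))"
      by (rule sum_distrib_left[symmetric])
    also have "\<dots> = 0" using \<mu>[OF row_in_row_span[OF finite_rows b]] by simp
    finally show "(\<Sum>u\<in>?U. l u * D b u) = 0" by (simp only: of_int_eq_0_iff)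
  next
    fix f assume f: "f \<in> ?U"
    then have "l f \<noteq> 0 \<longleftrightarrow> \<mu> f \<noteq> 0"
      using l[of f] K(1) by (metis DiffD1 mult_eq_0_iff of_int_0_eq_iff less_irrefl)
    then show "cotree_set (insert f R) \<longleftrightarrow> l f \<noteq> 0" using cotree_iff[OF f] by simp
  qed
qed

end

section \<open>Indices of sublattices\<close>

definition additive_subgroup :: "'a::ab_group_add set \<Rightarrow> bool" where
  "additive_subgroup P \<longleftrightarrow> 0 \<in> P \<and> (\<forall>x\<in>P. \<forall>y\<in>P. x - y \<in> P)"

lemma additive_subgroup_0: "additive_subgroup P \<Longrightarrow> 0 \<in> P"
  and additive_subgroup_diff: "additive_subgroup P \<Longrightarrow> x \<in> P \<Longrightarrow> y \<in> P \<Longrightarrow> x - y \<in> P"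
  by (auto simp: additive_subgroup_def)

lemma additive_subgroup_neg:
  assumes "additive_subgroup P" "x \<in> P"
  shows "- x \<in> P"
  using additive_subgroup_diff[OF assms(1) additive_subgroup_0[OF assms(1)] assms(2)] by simp

lemma additive_subgroup_add:
  assumes "additive_subgroup P" "x \<in> P" "y \<in> P"
  shows "x + y \<in> P"
  using additive_subgroup_diff[OF assms(1,2) additive_subgroup_neg[OF assms(1,3)]] by simp

lemma coset_eq_iff:
  assumes "additive_subgroup P"
  shows "x +o P = y +o P \<longleftrightarrow> x - y \<in> P"
proof
  assume "x +o P = y +o P"
  moreover have "x \<in> x +o P"
    using additive_subgroup_0[OF assms] by (force simp: elt_set_plus_def)
  ultimately obtain p where "p \<in> P" "x = y + p"
    by (auto simp: elt_set_plus_def)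
  then show "x - y \<in> P" by simp
next
  assume xy: "x - y \<in> P"
  have "a +o P \<subseteq> b +o P" if "a - b \<in> P" for a b
  proof
    fix z assume "z \<in> a +o P"
    then obtain p where "p \<in> P" "z = a + p" by (auto simp: elt_set_plus_def)
    then have "z = b + ((a - b) + p)" "(a - b) + p \<in> P"
      using additive_subgroup_add[OF assms that] by auto
    then show "z \<in> b +o P" unfolding elt_set_plus_def by blast
  qed
  from this[OF xy] this[of y x] additive_subgroup_neg[OF assms xy]
  show "x +o P = y +o P" by auto
qed

lemma coset_in_iff:
  assumes "additive_subgroup P"
  shows "w \<in> z +o P \<longleftrightarrow> w - z \<in> P"
proof
  assume "w - z \<in> P"
  moreover have "w = z + (w - z)" by simp
  ultimately show "w \<in> z +o P" unfolding elt_set_plus_def by blast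
qed (auto simp: elt_set_plus_def)

lemma additive_subgroup_plus:
  assumes "additive_subgroup P" "additive_subgroup Q"
  shows "additive_subgroup (P + Q)"
  unfolding additive_subgroup_def
proof (intro conjI ballI)
  show "0 \<in> P + Q"
    using assms[THEN additive_subgroup_0] by (force simp: set_plus_def)
  fix x y assume "x \<in> P + Q" "y \<in> P + Q"
  then obtain p q p' q' where "p \<in> P" "q \<in> Q" "p' \<in> P" "q' \<in> Q" "x = p + q" "y = p' + q'"
    by (auto simp: set_plus_def)
  moreover from this have "x - y = (p - p') + (q - q')" by simp
  ultimately show "x - y \<in> P + Q"
    using assms[THEN additive_subgroup_diff] unfolding set_plus_def by blast
qed

lemma additive_subgroup_row_span: "additive_subgroup (row_span M D :: ('c \<Rightarrow> 'f::comm_ring_1) set)"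
  using row_span_zero[of M D] row_span_diff[of _ M D]
  by (auto simp: additive_subgroup_def zero_fun_def fun_diff_def)

lemma additive_subgroup_supported: "additive_subgroup (supported_on A :: ('c \<Rightarrow> 'f::comm_ring_1) set)"
  by (auto simp: additive_subgroup_def supported_on_def)

lemma int_subgroup_generator:
  fixes H :: "int set"
  assumes "additive_subgroup H" "h \<in> H" "h \<noteq> 0"
  obtains c where "c > 0" "c \<in> H" "\<And>x. x \<in> H \<Longrightarrow> c dvd x"
proof -
  define n where "n = (LEAST n. n > 0 \<and> int n \<in> H)"
  have "\<bar>h\<bar> \<in> H" using assms additive_subgroup_neg[OF assms(1,2)] by (cases "h \<ge> 0") auto
  then have "nat \<bar>h\<bar> > 0 \<and> int (nat \<bar>h\<bar>) \<in> H" using assms(3) by simp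
  then have n: "n > 0" "int n \<in> H"
    unfolding n_def by (metis (mono_tags, lifting) LeastI)+
  have mult: "int k * int n \<in> H" for k
    by (induction k) (auto simp: distrib_right additive_subgroup_0[OF assms(1)] n additive_subgroup_add[OF assms(1)])
  have mult': "k * int n \<in> H" for k
    using mult[of "nat k"] additive_subgroup_neg[OF assms(1) mult[of "nat (- k)"]]
    by (cases "k \<ge> 0") auto
  have "int n dvd x" if "x \<in> H" for x
  proof (rule ccontr)
    assume "\<not> int n dvd x"
    then have "x mod int n \<noteq> 0" by (simp add: mod_eq_0_iff_dvd)
    moreover have "0 \<le> x mod int n" using n(1) by simp
    ultimately have r: "x mod int n > 0" by linarith
    have "x mod int n = x - x div int n * int n" by (simp add: minus_div_mult_eq_mod)
    then have "x mod int n \<in> H" using additive_subgroup_diff[OF assms(1) that mult'] by simp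
    then have "nat (x mod int n) > 0 \<and> int (nat (x mod int n)) \<in> H" using r by simp
    then have "n \<le> nat (x mod int n)" unfolding n_def by (rule Least_le)
    then have "int n \<le> x mod int n" using r by (simp add: le_nat_iff)
    moreover have "x mod int n < int n" using n(1) by simp
    ultimately show False by simp
  qed
  then show ?thesis using that[of "int n"] n by simp
qed

context int_matrix
begin

text \<open>The index of \<open>B + \<int>\<^sup>L\<close> in \<open>\<int>\<^sup>N\<close>, where \<open>B\<close> is the integral row space; it is \<open>0\<close> when the index is
infinite.\<close>

definition lattice_index :: "'c set \<Rightarrow> nat" where
  "lattice_index L = card ((\<lambda>z. z +o (row_span M D + supported_on L)) ` (supported_on N :: ('c \<Rightarrow> int) set))"

abbreviation sublattice :: "'c set \<Rightarrow> ('c \<Rightarrow> int) set" where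
  "sublattice L \<equiv> row_span M D + supported_on L"

lemma additive_subgroup_sublattice: "additive_subgroup (sublattice L)"
  by (intro additive_subgroup_plus additive_subgroup_row_span additive_subgroup_supported)

lemma sublattice_scale:
  assumes "p \<in> sublattice L"
  shows "(\<lambda>a. k * p a) \<in> sublattice L"
proof -
  obtain v w where vw: "v \<in> row_span M D" "w \<in> supported_on L" "p = v + w"
    using assms by (auto simp: set_plus_def)
  have "(\<lambda>a. k * p a) = (\<lambda>a. k * v a) + (\<lambda>a. k * w a)"
    by (auto simp: vw(3) distrib_left)
  moreover have "(\<lambda>a. k * w a) \<in> supported_on L" using vw(2) by (auto simp: supported_on_def)
  ultimately show ?thesis using row_span_scale[OF vw(1)] unfolding set_plus_def by blast
qed

definition unit_vec :: "'c \<Rightarrow> 'c \<Rightarrow> int" where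
  "unit_vec c = (\<lambda>a. if a = c then 1 else 0)"

lemma sublattice_insert_iff:
  "x \<in> sublattice (insert f R) \<longleftrightarrow> (\<exists>q. x - (\<lambda>a. q * unit_vec f a) \<in> sublattice R)"
proof
  assume "x \<in> sublattice (insert f R)"
  then obtain v w where vw: "v \<in> row_span M D" "w \<in> supported_on (insert f R)" "x = v + w"
    by (auto simp: set_plus_def)
  let ?w = "\<lambda>a. if a = f then 0 else w a"
  let ?q = "w f"
  have "x - (\<lambda>a. ?q * unit_vec f a) = v + ?w"
    by (auto simp: vw(3) unit_vec_def)
  moreover have "?w \<in> supported_on R" using vw(2) by (auto simp: supported_on_def)
  ultimately have "x - (\<lambda>a. ?q * unit_vec f a) \<in> sublattice R"
    using set_plus_intro[OF vw(1)] by simp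
  then show "\<exists>q. x - (\<lambda>a. q * unit_vec f a) \<in> sublattice R" ..
next
  assume "\<exists>q. x - (\<lambda>a. q * unit_vec f a) \<in> sublattice R"
  then obtain q v w where vw: "v \<in> row_span M D" "w \<in> supported_on R" "x - (\<lambda>a. q * unit_vec f a) = v + w"
    by (auto simp: set_plus_def)
  have "x = v + (\<lambda>a. w a + q * unit_vec f a)"
    using vw(3) by (auto simp: fun_eq_iff algebra_simps)
  moreover have "(\<lambda>a. w a + q * unit_vec f a) \<in> supported_on (insert f R)"
    using vw(2) by (auto simp: supported_on_def unit_vec_def)
  ultimately show "x \<in> sublattice (insert f R)"
    using set_plus_intro[OF vw(1)] by simp
qed

text \<open>Let \<open>P = B + \<int>\<^sup>R\<close>, and let \<open>\<lambda>\<close> be the functional on \<open>\<int>\<^sup>N\<close> with coefficients \<open>l\<close>, which vanishes on \<open>P\<close>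
and has image \<open>c\<int>\<close>. It maps \<open>\<int>\<^sup>N / (P + \<int>e\<^sub>f)\<close> onto \<open>c\<int> / \<lambda>\<^sub>f\<int>\<close>, with kernel \<open>ker \<lambda> / P\<close> as soon as
\<open>\<lambda>\<^sub>f \<noteq> 0\<close>. Hence the index is \<open>\<bar>ker \<lambda> / P\<bar> \<bar>\<lambda>\<^sub>f\<bar> / c\<close>, and only the factor \<open>\<bar>\<lambda>\<^sub>f\<bar>\<close> depends on \<open>f\<close>.\<close>

lemma lattice_index_circuit:
  assumes R: "R \<subseteq> N" and l: "\<And>b. b \<in> M \<Longrightarrow> (\<Sum>u\<in>N - R. l u * D b u) = 0"
  obtains \<kappa> :: real where "\<And>f. f \<in> N - R \<Longrightarrow> l f \<noteq> 0 \<Longrightarrow> real (lattice_index (insert f R)) = \<kappa> * \<bar>real_of_int (l f)\<bar>"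
proof (cases "\<exists>f\<in>N - R. l f \<noteq> 0")
  case False
  then show ?thesis using that[of 0] by blast
next
  case True
  then obtain f0 where f0: "f0 \<in> N - R" "l f0 \<noteq> 0" by blast
  define lam where "lam z = (\<Sum>u\<in>N - R. l u * z u)" for z :: "'c \<Rightarrow> int"
  let ?C = "supported_on N :: ('c \<Rightarrow> int) set"
  let ?P = "sublattice R"
  have lam_diff: "lam (x - y) = lam x - lam y" for x y
    by (simp add: lam_def right_diff_distrib sum_subtractf)
  have lam_add: "lam (x + y) = lam x + lam y" for x y
    by (simp add: lam_def distrib_left sum.distrib)
  have lam_scale: "lam (\<lambda>a. k * x a) = k * lam x" for k x
    by (simp add: lam_def sum_distrib_left mult.left_commute)
  have lam_unit: "lam (unit_vec f) = l f" if "f \<in> N - R" for f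
    using that finite_cols by (simp add: lam_def unit_vec_def if_distrib[of "(*) _"] cong: if_cong)
  have lam_P: "lam p = 0" if p: "p \<in> ?P" for p
  proof -
    obtain v w where vw: "v \<in> row_span M D" "w \<in> supported_on R" "p = v + w"
      using p by (auto simp: set_plus_def)
    have "lam v = 0"
      using functional_vanishes_on_row_span[OF l vw(1)] by (simp add: lam_def)
    moreover have "lam w = 0" using vw(2) by (auto simp: lam_def supported_on_def intro!: sum.neutral)
    ultimately show ?thesis by (simp add: vw(3) lam_add)
  qed
  have C: "additive_subgroup ?C" by (rule additive_subgroup_supported)
  have unit_C: "unit_vec f \<in> ?C" if "f \<in> N - R" for f
    using that by (auto simp: unit_vec_def supported_on_def)
  have scale_C: "(\<lambda>a. k * x a) \<in> ?C" if "x \<in> ?C" for x k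
    using that by (auto simp: supported_on_def)
  have lam_C: "additive_subgroup (lam ` ?C)"
    unfolding additive_subgroup_def
  proof (intro conjI ballI)
    show "0 \<in> lam ` ?C" using additive_subgroup_0[OF C] by (force simp: lam_def)
    fix x y assume "x \<in> lam ` ?C" "y \<in> lam ` ?C"
    then obtain v w where "v \<in> ?C" "w \<in> ?C" "x = lam v" "y = lam w" by blast
    then show "x - y \<in> lam ` ?C"
      using additive_subgroup_diff[OF C] by (auto intro!: image_eqI[of _ _ "v - w"] simp: lam_diff)
  qed
  have lf0_C: "l f0 \<in> lam ` ?C" using unit_C[OF f0(1)] lam_unit[OF f0(1)] by (metis imageI)
  obtain c where c: "c > 0" "c \<in> lam ` ?C" "\<And>x. x \<in> lam ` ?C \<Longrightarrow> c dvd x"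
    by (fact int_subgroup_generator[OF lam_C lf0_C f0(2)])
  then obtain e where e: "e \<in> ?C" "lam e = c" by blast
  define Ker where "Ker = {z \<in> ?C. lam z = 0}"
  \<comment> \<open>A set \<open>T\<close> of representatives of the kernel modulo \<open>P\<close>. If it is infinite then both the index
    and \<open>card T\<close> are \<open>0\<close>, which agrees with the formula.\<close>
  have "\<exists>T. T \<subseteq> Ker \<and> inj_on (\<lambda>z. z +o ?P) T \<and> (\<lambda>z. z +o ?P) ` Ker = (\<lambda>z. z +o ?P) ` T"
    by (rule iffD1[OF subset_image_inj order_refl])
  then obtain T where T: "T \<subseteq> Ker" "inj_on (\<lambda>z. z +o ?P) T"
    "(\<lambda>z. z +o ?P) ` Ker = (\<lambda>z. z +o ?P) ` T"
    by blast
  have index: "lattice_index (insert f R) = card T * nat \<bar>l f div c\<bar>" if f: "f \<in> N - R" "l f \<noteq> 0" for f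
  proof -
    define m where "m = l f div c"
    have lf: "l f = m * c"
      using c(3)[of "l f"] unit_C[OF f(1)] lam_unit[OF f(1)] by (metis dvd_div_mult_self imageI m_def)
    then have m: "m \<noteq> 0" using f by auto
    let ?Q = "sublattice (insert f R)"
    have Q: "additive_subgroup ?Q" and P: "additive_subgroup ?P"
      by (rule additive_subgroup_sublattice)+
    \<comment> \<open>The elements \<open>t + i e\<close> with \<open>t \<in> T\<close> and \<open>0 \<le> i < \<bar>m\<bar>\<close> represent each coset of \<open>P + \<int>e\<^sub>f\<close> once.\<close>
    define g where "g = (\<lambda>(t::'c \<Rightarrow> int, i::int). t + (\<lambda>a. i * e a))"
    have eq: "g (t, i) +o ?Q = g (t', i') +o ?Q \<Longrightarrow> (t, i) = (t', i')"
      if "t \<in> T" "i \<in> {0..<\<bar>m\<bar>}" "t' \<in> T" "i' \<in> {0..<\<bar>m\<bar>}" for t i t' i'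
    proof -
      assume "g (t, i) +o ?Q = g (t', i') +o ?Q"
      then have "g (t, i) - g (t', i') \<in> ?Q" by (simp add: coset_eq_iff[OF Q])
      then obtain q where q: "g (t, i) - g (t', i') - (\<lambda>a. q * unit_vec f a) \<in> ?P"
        unfolding sublattice_insert_iff by blast
      have "lam t = 0" "lam t' = 0" using that T(1) by (auto simp: Ker_def)
      then have "i * c - i' * c - q * l f = 0"
        using lam_P[OF q] by (simp add: lam_diff lam_add lam_scale lam_unit[OF f(1)] e(2) g_def)
      then have "(i - i' - q * m) * c = 0" by (simp add: lf algebra_simps)
      then have iq: "i - i' = q * m" using c(1) by simp
      have "\<bar>i - i'\<bar> < \<bar>m\<bar>" using that by auto
      then have "\<bar>q\<bar> * \<bar>m\<bar> < 1 * \<bar>m\<bar>" using iq by (simp add: abs_mult)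
      then have "\<bar>q\<bar> < 1" using mult_less_cancel_right_pos[of "\<bar>m\<bar>" "\<bar>q\<bar>" 1] m by simp
      then have "q = 0" by simp
      then have ii: "i = i'" using iq by simp
      have "t - t' \<in> ?P" using q \<open>q = 0\<close> ii by (simp add: g_def flip: zero_fun_def)
      then have "t = t'" using inj_onD[OF T(2)] that coset_eq_iff[OF P] by blast
      then show ?thesis using ii by simp
    qed
    have inj: "inj_on (\<lambda>p. g p +o ?Q) (T \<times> {0..<\<bar>m\<bar>})"
      by (rule inj_onI) (use eq in auto)
    have "(\<lambda>z. z +o ?Q) ` ?C = (\<lambda>p. g p +o ?Q) ` (T \<times> {0..<\<bar>m\<bar>})"
    proof
      show "(\<lambda>p. g p +o ?Q) ` (T \<times> {0..<\<bar>m\<bar>}) \<subseteq> (\<lambda>z. z +o ?Q) ` ?C"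
      proof clarify
        fix t i assume "t \<in> T"
        then have "t \<in> ?C" using T(1) by (auto simp: Ker_def)
        then have "g (t, i) \<in> ?C" unfolding g_def using additive_subgroup_add[OF C _ scale_C[OF e(1)]] by simp
        then show "g (t, i) +o ?Q \<in> (\<lambda>z. z +o ?Q) ` ?C" by blast
      qed
      show "(\<lambda>z. z +o ?Q) ` ?C \<subseteq> (\<lambda>p. g p +o ?Q) ` (T \<times> {0..<\<bar>m\<bar>})"
      proof clarify
        fix z assume z: "z \<in> ?C"
        then have "c dvd lam z" using c(3) by blast
        then obtain n where n: "lam z = n * c" by (metis dvd_def mult.commute)
        define i where "i = n mod \<bar>m\<bar>"
        define q where "q = (n div \<bar>m\<bar>) * sgn m"
        have "q * m = n div \<bar>m\<bar> * (m * sgn m)"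
          by (simp add: q_def)
        then have ni: "n = q * m + i"
          by (simp add: i_def flip: abs_sgn)
        have i: "i \<in> {0..<\<bar>m\<bar>}" using m by (simp add: i_def)
        define y where "y = z - (\<lambda>a. q * unit_vec f a) - (\<lambda>a. i * e a)"
        have "y \<in> ?C"
          unfolding y_def by (intro additive_subgroup_diff[OF C] z scale_C unit_C f e)
        moreover have "lam y = n * c - q * l f - i * c"
          by (simp only: y_def lam_diff lam_scale lam_unit[OF f(1)] e(2) n)
        then have "lam y = 0"
          by (simp add: lf ni algebra_simps)
        ultimately have "y +o ?P \<in> (\<lambda>z. z +o ?P) ` T" using T(3) by (auto simp: Ker_def)
        then obtain t where t: "t \<in> T" "y - t \<in> ?P" using coset_eq_iff[OF P] by auto
        have "z - g (t, i) - (\<lambda>a. q * unit_vec f a) = y - t"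
          by (simp add: y_def g_def algebra_simps)
        then have "z - g (t, i) \<in> ?Q" unfolding sublattice_insert_iff using t(2) by metis
        then have "z +o ?Q = g (t, i) +o ?Q" by (simp add: coset_eq_iff[OF Q])
        then show "z +o ?Q \<in> (\<lambda>p. g p +o ?Q) ` (T \<times> {0..<\<bar>m\<bar>})" using t(1) i by blast
      qed
    qed
    then have "lattice_index (insert f R) = card (T \<times> {0..<\<bar>m\<bar>})"
      unfolding lattice_index_def using card_image[OF inj] by simp
    then show ?thesis by (simp add: card_cartesian_product m_def)
  qed
  show ?thesis
  proof (rule that[of "real (card T) / real_of_int c"])
    fix f assume f: "f \<in> N - R" "l f \<noteq> 0"
    have "c dvd l f" using c(3)[of "l f"] unit_C[OF f(1)] lam_unit[OF f(1)] by (metis imageI)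
    then have "real_of_int (l f) = real_of_int (l f div c) * real_of_int c"
      by (metis dvd_div_mult_self of_int_mult)
    then show "real (lattice_index (insert f R)) = real (card T) / real_of_int c * \<bar>real_of_int (l f)\<bar>"
      using c(1) by (simp add: index[OF f] abs_mult)
  qed
qed

text \<open>A common denominator \<open>K\<close> of the coefficients that express the dual vectors by the rows puts \<open>K\<close> times
each unit vector into \<open>B + \<int>\<^sup>L\<close>. So every coset contains a vector with entries in \<open>{0..<K}\<close>.\<close>

lemma lattice_index_pos:
  assumes L: "cotree_set L"
  shows "lattice_index L > 0"
proof -
  have "\<forall>f\<in>N - L. \<exists>y. dual L f = (\<lambda>a. \<Sum>b\<in>M. of_int (D b a) * y b)"
    using dual_row_span[OF L] by (auto simp: row_span_def)
  from bchoice[OF this] obtain y where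
    y: "\<And>f. f \<in> N - L \<Longrightarrow> dual L f = (\<lambda>a. \<Sum>b\<in>M. of_int (D b a) * y f b)" by blast
  have fin: "finite ((N - L) \<times> M)" using finite_cols finite_rows by simp
  obtain K :: int where K: "K > 0" "\<And>p. p \<in> (N - L) \<times> M \<Longrightarrow> of_int K * y (fst p) (snd p) \<in> \<int>"
    by (fact common_denominator[OF fin, of "\<lambda>p. y (fst p) (snd p)"])
  let ?P = "sublattice L"
  have P: "additive_subgroup ?P" by (rule additive_subgroup_sublattice)
  have unit: "(\<lambda>a. K * unit_vec f a) \<in> ?P" if f: "f \<in> N" for f
  proof (cases "f \<in> L")
    case True
    then have "(\<lambda>a. K * unit_vec f a) \<in> supported_on L"
      by (auto simp: supported_on_def unit_vec_def)
    then have "(\<lambda>_. 0) + (\<lambda>a. K * unit_vec f a) \<in> ?P"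
      by (intro set_plus_intro row_span_zero)
    then show ?thesis by (simp add: plus_fun_def)
  next
    case False
    then have fS: "f \<in> N - L" using f by simp
    have "\<forall>b\<in>M. \<exists>i. of_int i = of_int K * y f b"
    proof
      fix b assume "b \<in> M"
      then have "of_int K * y f b \<in> \<int>" using K(2)[of "(f, b)"] fS by simp
      then show "\<exists>i. of_int i = of_int K * y f b" by (rule Ints_cases) metis
    qed
    from bchoice[OF this] obtain i where i: "\<And>b. b \<in> M \<Longrightarrow> of_int (i b) = of_int K * y f b" by blast
    \<comment> \<open>\<open>v\<close> is \<open>K\<close> times the dual vector of \<open>f\<close>, hence equals \<open>K\<close> times the unit vector outside \<open>L\<close>.\<close>
    define v where "v = (\<lambda>a. \<Sum>b\<in>M. D b a * i b)"
    have v: "v \<in> row_span M D" unfolding row_span_def v_def by (rule range_eqI[of _ _ i]) simp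
    have v_eq: "of_int (v a) = of_int K * dual L f a" for a
    proof -
      have "(of_int (v a) :: rat) = (\<Sum>b\<in>M. of_int (D b a) * of_int (i b))" by (simp add: v_def)
      also have "\<dots> = (\<Sum>b\<in>M. of_int K * (of_int (D b a) * y f b))"
        by (intro sum.cong refl) (simp add: i)
      finally show ?thesis by (simp add: y[OF fS] sum_distrib_left)
    qed
    have "(\<lambda>a. K * unit_vec f a - v a) \<in> supported_on L"
      unfolding supported_on_def
    proof (intro CollectI allI impI)
      fix a assume a: "a \<notin> L"
      show "K * unit_vec f a - v a = 0"
      proof (cases "a \<in> N")
        case True
        then have "(of_int (v a) :: rat) = of_int (K * unit_vec f a)"
          using v_eq[of a] dual_unit[OF L fS, of a] a by (simp add: unit_vec_def)
        then have "v a = K * unit_vec f a" by (simp only: of_int_eq_iff)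
        then show ?thesis by simp
      next
        case False
        then show ?thesis
          using supported_onD[OF row_span_supported[OF v] False] f by (auto simp: unit_vec_def)
      qed
    qed
    then have "v + (\<lambda>a. K * unit_vec f a - v a) \<in> ?P"
      by (intro set_plus_intro v)
    moreover have "v + (\<lambda>a. K * unit_vec f a - v a) = (\<lambda>a. K * unit_vec f a)" by auto
    ultimately show ?thesis by simp
  qed
  have multiples: "(\<lambda>a. K * z a) \<in> ?P" if z: "z \<in> supported_on N" for z
  proof -
    have "(\<lambda>a. \<Sum>f\<in>F. K * z f * unit_vec f a) \<in> ?P" if "finite F" "F \<subseteq> N" for F
      using that
    proof induction
      case empty
      show ?case using additive_subgroup_0[OF P] by (simp add: zero_fun_def)
    next
      case (insert f F)
      have "(\<lambda>a. z f * (K * unit_vec f a)) \<in> ?P"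
        using insert.prems by (intro sublattice_scale unit) auto
      moreover have "(\<lambda>a. \<Sum>f\<in>F. K * z f * unit_vec f a) \<in> ?P" using insert by simp
      ultimately have "(\<lambda>a. z f * (K * unit_vec f a)) + (\<lambda>a. \<Sum>f\<in>F. K * z f * unit_vec f a) \<in> ?P"
        by (rule additive_subgroup_add[OF P])
      moreover have "(\<lambda>a. z f * (K * unit_vec f a)) + (\<lambda>a. \<Sum>f\<in>F. K * z f * unit_vec f a) =
          (\<lambda>a. \<Sum>f\<in>insert f F. K * z f * unit_vec f a)"
        using insert.hyps by (simp add: fun_eq_iff)
      ultimately show ?case by (simp only:)
    qed
    from this[OF finite_cols order_refl]
    have "(\<lambda>a. \<Sum>f\<in>N. K * z f * unit_vec f a) \<in> ?P" .
    moreover have "(\<Sum>f\<in>N. K * z f * unit_vec f a) = K * z a" for a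
    proof -
      have "(\<Sum>f\<in>N. K * z f * unit_vec f a) = (\<Sum>f\<in>N. if f = a then K * z a else 0)"
        by (intro sum.cong refl) (auto simp: unit_vec_def)
      also have "\<dots> = K * z a"
        using z finite_cols by (auto simp: supported_on_def)
      finally show ?thesis .
    qed
    ultimately show ?thesis by simp
  qed
  let ?box = "{z. \<forall>a. (a \<in> N \<longrightarrow> z a \<in> {0..<K}) \<and> (a \<notin> N \<longrightarrow> z a = 0)} :: ('c \<Rightarrow> int) set"
  have "(\<lambda>z. z +o ?P) ` supported_on N \<subseteq> (\<lambda>z. z +o ?P) ` ?box"
  proof clarify
    fix z :: "'c \<Rightarrow> int" assume z: "z \<in> supported_on N"
    have "z - (\<lambda>a. z a mod K) = (\<lambda>a. K * (z a div K))"
      by (auto simp: fun_eq_iff minus_mod_eq_mult_div)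
    moreover have "(\<lambda>a. z a div K) \<in> supported_on N" using z by (auto simp: supported_on_def)
    ultimately have "z - (\<lambda>a. z a mod K) \<in> ?P" using multiples by simp
    then have "z +o ?P = (\<lambda>a. z a mod K) +o ?P" by (simp add: coset_eq_iff[OF P])
    moreover have "(\<lambda>a. z a mod K) \<in> ?box" using z K(1) by (auto simp: supported_on_def)
    ultimately show "z +o ?P \<in> (\<lambda>z. z +o ?P) ` ?box" by blast
  qed
  moreover have "finite ?box"
    using finite_set_of_finite_funs[OF finite_cols, of "{0..<K}" 0] by simp
  ultimately have "finite ((\<lambda>z. z +o ?P) ` supported_on N)"
    by (rule finite_subset[OF _ finite_imageI])
  moreover have "(\<lambda>_. 0) \<in> (supported_on N :: ('c \<Rightarrow> int) set)" by (simp add: supported_on_def)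
  ultimately show ?thesis unfolding lattice_index_def by (metis card_gt_0_iff empty_iff image_is_empty)
qed

end

section \<open>Quotients of function modules\<close>

definition submod :: "('c \<Rightarrow> 'f::comm_ring_1) set \<Rightarrow> bool" where
  "submod P \<longleftrightarrow> 0 \<in> P \<and> (\<forall>x\<in>P. \<forall>y\<in>P. x + y \<in> P) \<and> (\<forall>r. \<forall>x\<in>P. (\<lambda>a. r * x a) \<in> P)"

lemma submod_0: "submod P \<Longrightarrow> 0 \<in> P"
  and submod_add: "submod P \<Longrightarrow> x \<in> P \<Longrightarrow> y \<in> P \<Longrightarrow> x + y \<in> P"
  and submod_scale: "submod P \<Longrightarrow> x \<in> P \<Longrightarrow> (\<lambda>a. r * x a) \<in> P"
  by (simp_all add: submod_def)

lemma submod_additive_subgroup: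
  assumes "submod P"
  shows "additive_subgroup P"
  unfolding additive_subgroup_def
proof (intro conjI ballI)
  fix x y assume "x \<in> P" "y \<in> P"
  moreover have "x - y = x + (\<lambda>a. -1 * y a)" by (simp add: fun_eq_iff)
  ultimately show "x - y \<in> P" using submod_add submod_scale assms by metis
qed (rule submod_0[OF assms])

lemma submod_row_span: "submod (row_span M D)"
  using row_span_zero[of M D] unfolding submod_def zero_fun_def plus_fun_def
  by (intro conjI ballI allI row_span_add row_span_scale)

lemma submod_supported: "submod (supported_on A)"
  by (simp add: submod_def supported_on_def)

lemma coset_add:
  assumes "submod B"
  shows "(x +o B) + (y +o B) = (x + y) +o B"
proof
  show "(x +o B) + (y +o B) \<subseteq> (x + y) +o B"
  proof
    fix z assume "z \<in> (x +o B) + (y +o B)"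
    then obtain b c where "b \<in> B" "c \<in> B" "z = (x + b) + (y + c)"
      unfolding set_plus_def elt_set_plus_def by blast
    then have "z = (x + y) + (b + c)" "b + c \<in> B" using submod_add[OF assms] by (auto simp: ac_simps)
    then show "z \<in> (x + y) +o B" unfolding elt_set_plus_def by blast
  qed
  show "(x + y) +o B \<subseteq> (x +o B) + (y +o B)"
  proof
    fix z assume "z \<in> (x + y) +o B"
    then obtain b where "b \<in> B" "z = (x + b) + (y + 0)"
      unfolding elt_set_plus_def by (auto simp: ac_simps)
    then show "z \<in> (x +o B) + (y +o B)"
      using submod_0[OF assms] unfolding set_plus_def elt_set_plus_def by blast
  qed
qed

lemma coset_scale:
  assumes "submod B"
  shows "(\<lambda>z a. r * z a) ` (x +o B) + B = (\<lambda>a. r * x a) +o B"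
proof
  show "(\<lambda>z a. r * z a) ` (x +o B) + B \<subseteq> (\<lambda>a. r * x a) +o B"
  proof
    fix z assume "z \<in> (\<lambda>z a. r * z a) ` (x +o B) + B"
    then obtain b c where bc: "b \<in> B" "c \<in> B" "z = (\<lambda>a. r * (x + b) a) + c"
      unfolding set_plus_def elt_set_plus_def by blast
    then have "z = (\<lambda>a. r * x a) + ((\<lambda>a. r * b a) + c)" by (simp add: fun_eq_iff distrib_left)
    moreover have "(\<lambda>a. r * b a) + c \<in> B" using bc submod_add[OF assms] submod_scale[OF assms] by blast
    ultimately show "z \<in> (\<lambda>a. r * x a) +o B" unfolding elt_set_plus_def by blast
  qed
  show "(\<lambda>a. r * x a) +o B \<subseteq> (\<lambda>z a. r * z a) ` (x +o B) + B"
  proof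
    fix z assume "z \<in> (\<lambda>a. r * x a) +o B"
    then obtain b where b: "b \<in> B" "z = (\<lambda>a. r * x a) + b"
      unfolding elt_set_plus_def by blast
    have "x \<in> x +o B" using submod_0[OF assms] by (force simp: elt_set_plus_def)
    then have "(\<lambda>a. r * x a) \<in> (\<lambda>z a. r * z a) ` (x +o B)" by (rule imageI)
    then show "z \<in> (\<lambda>z a. r * z a) ` (x +o B) + B" unfolding b(2) using b(1) by (rule set_plus_intro)
  qed
qed

lemma carrier_quot_module: "carrier (quot_module Z B) = (\<lambda>z. z +o B) ` Z"
  by (simp add: quot_module_def)

lemma add_quot_module: "submod B \<Longrightarrow> (x +o B) \<oplus>\<^bsub>quot_module Z B\<^esub> (y +o B) = (x + y) +o B"
  by (simp add: quot_module_def coset_add)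

lemma smult_quot_module: "submod B \<Longrightarrow> r \<odot>\<^bsub>quot_module Z B\<^esub> (x +o B) = (\<lambda>a. r * x a) +o B"
  by (simp add: quot_module_def coset_scale)

lemma zero_quot_module: "\<zero>\<^bsub>quot_module Z B\<^esub> = 0 +o B"
  by (simp add: quot_module_def)

lemma module_quot_module:
  fixes Z B :: "('c \<Rightarrow> 'f::comm_ring_1) set"
  assumes Z: "submod Z" and B: "submod B"
  shows "module (class_ring :: 'f ring) (quot_module Z B)"
proof -
  let ?Q = "quot_module Z B"
  note quot = carrier_quot_module add_quot_module[OF B] smult_quot_module[OF B] zero_quot_module
  have in_carrier: "z +o B \<in> carrier ?Q" if "z \<in> Z" for z
    using that by (simp add: quot)
  have cases: thesis if "x \<in> carrier ?Q" "\<And>z. z \<in> Z \<Longrightarrow> x = z +o B \<Longrightarrow> thesis" for x thesis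
    using that by (auto simp: quot)
  have "abelian_group ?Q"
  proof (rule abelian_groupI)
    show "\<zero>\<^bsub>?Q\<^esub> \<in> carrier ?Q"
      unfolding zero_quot_module by (rule in_carrier[OF submod_0[OF Z]])
    fix x assume x: "x \<in> carrier ?Q"
    then obtain z where z: "z \<in> Z" "x = z +o B" by (rule cases)
    show "\<zero>\<^bsub>?Q\<^esub> \<oplus>\<^bsub>?Q\<^esub> x = x" by (simp only: quot z add_0)
    have "(\<lambda>a. -1 * z a) +o B \<in> carrier ?Q" by (rule in_carrier[OF submod_scale[OF Z z(1)]])
    moreover have "((\<lambda>a. -1 * z a) +o B) \<oplus>\<^bsub>?Q\<^esub> x = \<zero>\<^bsub>?Q\<^esub>"
    proof -
      have "(\<lambda>a. -1 * z a) + z = 0" by (simp add: fun_eq_iff)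
      then show ?thesis by (simp only: quot z)
    qed
    ultimately show "\<exists>y\<in>carrier ?Q. y \<oplus>\<^bsub>?Q\<^esub> x = \<zero>\<^bsub>?Q\<^esub>" by blast
    fix y assume "y \<in> carrier ?Q"
    then obtain w where w: "w \<in> Z" "y = w +o B" by (rule cases)
    show "x \<oplus>\<^bsub>?Q\<^esub> y \<in> carrier ?Q"
      unfolding z w add_quot_module[OF B] by (rule in_carrier[OF submod_add[OF Z z(1) w(1)]])
    show "x \<oplus>\<^bsub>?Q\<^esub> y = y \<oplus>\<^bsub>?Q\<^esub> x" by (simp only: quot z w add.commute)
    fix u assume "u \<in> carrier ?Q"
    then obtain t where t: "t \<in> Z" "u = t +o B" by (rule cases)
    show "x \<oplus>\<^bsub>?Q\<^esub> y \<oplus>\<^bsub>?Q\<^esub> u = x \<oplus>\<^bsub>?Q\<^esub> (y \<oplus>\<^bsub>?Q\<^esub> u)" by (simp only: quot z w t add.assoc)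
  qed
  then show ?thesis
  proof (rule moduleI[OF class_cring.cring_axioms[where 'a = 'f]])
    fix r x assume "x \<in> carrier ?Q"
    then obtain z where z: "z \<in> Z" "x = z +o B" by (rule cases)
    show "r \<odot>\<^bsub>?Q\<^esub> x \<in> carrier ?Q"
      unfolding z smult_quot_module[OF B] by (rule in_carrier[OF submod_scale[OF Z z(1)]])
    show "\<one>\<^bsub>class_ring\<^esub> \<odot>\<^bsub>?Q\<^esub> x = x" by (simp only: quot z) simp
    fix s
    have "(\<lambda>a. (r + s) * z a) = (\<lambda>a. r * z a) + (\<lambda>a. s * z a)" by (simp add: fun_eq_iff distrib_right)
    then show "(r \<oplus>\<^bsub>class_ring\<^esub> s) \<odot>\<^bsub>?Q\<^esub> x = r \<odot>\<^bsub>?Q\<^esub> x \<oplus>\<^bsub>?Q\<^esub> s \<odot>\<^bsub>?Q\<^esub> x" by (simp add: quot z)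
    show "(r \<otimes>\<^bsub>class_ring\<^esub> s) \<odot>\<^bsub>?Q\<^esub> x = r \<odot>\<^bsub>?Q\<^esub> (s \<odot>\<^bsub>?Q\<^esub> x)" by (simp add: quot z mult.assoc)
    fix y assume "y \<in> carrier ?Q"
    then obtain w where w: "w \<in> Z" "y = w +o B" by (rule cases)
    have "(\<lambda>a. r * (z + w) a) = (\<lambda>a. r * z a) + (\<lambda>a. r * w a)" by (simp add: fun_eq_iff distrib_left)
    then show "r \<odot>\<^bsub>?Q\<^esub> (x \<oplus>\<^bsub>?Q\<^esub> y) = r \<odot>\<^bsub>?Q\<^esub> x \<oplus>\<^bsub>?Q\<^esub> r \<odot>\<^bsub>?Q\<^esub> y" by (simp only: quot z w)
  qed
qed

lemma module_fun_module:
  fixes Z :: "('c \<Rightarrow> 'f::comm_ring_1) set"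
  assumes Z: "submod Z"
  shows "module (class_ring :: 'f ring) (fun_module Z)"
proof -
  have "abelian_group (fun_module Z)"
  proof (rule abelian_groupI)
    fix x assume x: "x \<in> carrier (fun_module Z)"
    have "(\<lambda>a. -1 * x a) \<in> Z" by (rule submod_scale[OF Z]) (use x in \<open>simp add: fun_module_def\<close>)
    moreover have "(\<lambda>a. -1 * x a) + x = 0" by (simp add: fun_eq_iff)
    ultimately show "\<exists>y\<in>carrier (fun_module Z). y \<oplus>\<^bsub>fun_module Z\<^esub> x = \<zero>\<^bsub>fun_module Z\<^esub>"
      by (auto simp: fun_module_def)
  qed (use submod_0[OF Z] submod_add[OF Z] in \<open>simp_all add: fun_module_def ac_simps\<close>)
  then show ?thesis
    by (rule moduleI[OF class_cring.cring_axioms[where 'a = 'f]])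
      (use submod_scale[OF Z] in \<open>simp_all add: fun_module_def fun_eq_iff algebra_simps\<close>)
qed

text \<open>How module homomorphisms on homology are obtained: \<open>h\<close> is a linear map on chains, and \<open>g\<close> the map it
induces on classes.\<close>

lemma mod_hom_quot_fun:
  fixes Z B Z' :: "('c \<Rightarrow> 'f::comm_ring_1) set"
  assumes "submod Z" "submod B" "submod Z'"
    and g: "\<And>z. z \<in> Z \<Longrightarrow> g (z +o B) = h z" "\<And>z. z \<in> Z \<Longrightarrow> h z \<in> Z'"
    and h: "\<And>x y. h (x + y) = h x + h y" "\<And>r x. h (\<lambda>a. r * x a) = (\<lambda>a. r * h x a)"
  shows "mod_hom (class_ring :: 'f ring) (quot_module Z B) (fun_module Z') g"
proof -
  have "g \<in> module_hom (class_ring :: 'f ring) (quot_module Z B) (fun_module Z')"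
    unfolding module_hom_def
  proof (intro CollectI conjI allI impI)
    show "g \<in> carrier (quot_module Z B) \<rightarrow> carrier (fun_module Z')"
      using g by (auto simp: carrier_quot_module fun_module_def)
    fix x y assume "x \<in> carrier (quot_module Z B) \<and> y \<in> carrier (quot_module Z B)"
    then obtain z w where zw: "z \<in> Z" "w \<in> Z" "x = z +o B" "y = w +o B"
      by (auto simp: carrier_quot_module)
    show "g (x \<oplus>\<^bsub>quot_module Z B\<^esub> y) = g x \<oplus>\<^bsub>fun_module Z'\<^esub> g y"
      using g(1)[OF zw(1)] g(1)[OF zw(2)] g(1)[OF submod_add[OF assms(1) zw(1,2)]]
      by (simp add: zw(3,4) add_quot_module[OF assms(2)] fun_module_def h)
  next
    fix r x assume "r \<in> carrier (class_ring :: 'f ring) \<and> x \<in> carrier (quot_module Z B)"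
    then obtain z where z: "z \<in> Z" "x = z +o B" by (auto simp: carrier_quot_module)
    show "g (r \<odot>\<^bsub>quot_module Z B\<^esub> x) = r \<odot>\<^bsub>fun_module Z'\<^esub> g x"
      using g(1)[OF z(1)] g(1)[OF submod_scale[OF assms(1) z(1)]]
      by (simp add: z(2) smult_quot_module[OF assms(2)] fun_module_def h)
  qed
  then show ?thesis
    using module_quot_module[OF assms(1,2)] module_fun_module[OF assms(3)]
    by (simp add: mod_hom_def mod_hom_axioms_def)
qed

lemma mod_hom_quot_quot:
  fixes Z Z' B B' :: "('c \<Rightarrow> 'f::comm_ring_1) set"
  assumes "submod Z" "submod Z'" "submod B" "submod B'" "Z \<subseteq> Z'" "B \<subseteq> B'"
  shows "mod_hom (class_ring :: 'f ring) (quot_module Z B) (quot_module Z' B') (\<lambda>S. S + B')"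
    and "\<And>z. (z +o B) + B' = z +o B'"
proof -
  show eq: "(z +o B) + B' = z +o B'" for z
  proof
    show "(z +o B) + B' \<subseteq> z +o B'"
    proof
      fix x assume "x \<in> (z +o B) + B'"
      then obtain b b' where "b \<in> B" "b' \<in> B'" "x = z + b + b'"
        unfolding set_plus_def elt_set_plus_def by blast
      then have "x = z + (b + b')" "b + b' \<in> B'"
        using assms(6) submod_add[OF assms(4)] by (auto simp: add.assoc)
      then show "x \<in> z +o B'" unfolding elt_set_plus_def by blast
    qed
    show "z +o B' \<subseteq> (z +o B) + B'"
    proof
      fix x assume "x \<in> z +o B'"
      then obtain b where b: "b \<in> B'" "x = z + b" unfolding elt_set_plus_def by blast
      have "z \<in> z +o B" using submod_0[OF assms(3)] by (force simp: elt_set_plus_def)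
      then show "x \<in> (z +o B) + B'" unfolding b(2) using b(1) by (rule set_plus_intro)
    qed
  qed
  have "(\<lambda>S. S + B') \<in> module_hom (class_ring :: 'f ring) (quot_module Z B) (quot_module Z' B')"
    unfolding module_hom_def
  proof (intro CollectI conjI allI impI)
    show "(\<lambda>S. S + B') \<in> carrier (quot_module Z B) \<rightarrow> carrier (quot_module Z' B')"
      using assms(5) by (auto simp: carrier_quot_module eq)
    fix x y assume "x \<in> carrier (quot_module Z B) \<and> y \<in> carrier (quot_module Z B)"
    then obtain z w where zw: "x = z +o B" "y = w +o B" by (auto simp: carrier_quot_module)
    show "(x \<oplus>\<^bsub>quot_module Z B\<^esub> y) + B' = (x + B') \<oplus>\<^bsub>quot_module Z' B'\<^esub> (y + B')"
      by (simp only: zw add_quot_module[OF assms(3)] add_quot_module[OF assms(4)] eq)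
  next
    fix r x assume "r \<in> carrier (class_ring :: 'f ring) \<and> x \<in> carrier (quot_module Z B)"
    then obtain z where z: "x = z +o B" by (auto simp: carrier_quot_module)
    show "(r \<odot>\<^bsub>quot_module Z B\<^esub> x) + B' = r \<odot>\<^bsub>quot_module Z' B'\<^esub> (x + B')"
      by (simp only: z smult_quot_module[OF assms(3)] smult_quot_module[OF assms(4)] eq)
  qed
  then show "mod_hom (class_ring :: 'f ring) (quot_module Z B) (quot_module Z' B') (\<lambda>S. S + B')"
    using module_quot_module[OF assms(1,3)] module_quot_module[OF assms(2,4)]
    by (simp add: mod_hom_def mod_hom_axioms_def)
qed

lemma vectorspace_quot_module:
  fixes Z B :: "('c \<Rightarrow> 'f::field) set"
  assumes "submod Z" "submod B"
  shows "vectorspace (class_ring :: 'f ring) (quot_module Z B)"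
  using module_quot_module[OF assms] class_field by (simp add: vectorspace_def)

lemma sum_fun_apply: "(\<Sum>i\<in>I. f i) x = (\<Sum>i\<in>I. f i x :: 'f::comm_monoid_add)"
  by (induction I rule: infinite_finite_induct) simp_all

lemma fin_dim_quot_module:
  fixes Z B :: "('c \<Rightarrow> 'f::field) set"
  assumes Z: "submod Z" and B: "submod B" and N: "finite N" "Z \<subseteq> supported_on N"
  shows "vectorspace.fin_dim (class_ring :: 'f ring) (quot_module Z B)"
proof -
  interpret F: vector_space "\<lambda>(r::'f) (z::'c \<Rightarrow> 'f) a. r * z a"
    by unfold_locales (simp_all add: fun_eq_iff algebra_simps)
  interpret V: vectorspace "class_ring :: 'f ring" "quot_module Z B"
    by (rule vectorspace_quot_module[OF Z B])
  \<comment> \<open>The cosets of a basis of \<open>Z\<close> generate the quotient, and this basis is finite because \<open>Z\<close> lies in the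
    span of finitely many unit vectors.\<close>
  obtain S where S: "S \<subseteq> Z" "F.independent S" "Z \<subseteq> F.span S"
    by (rule F.maximal_independent_subset)
  let ?e = "\<lambda>c a. if a = c then 1 else (0::'f)"
  have "Z \<subseteq> F.span (?e ` N)"
  proof
    fix z assume "z \<in> Z"
    then have z: "z \<in> supported_on N" using N(2) by blast
    have "z = (\<lambda>a. \<Sum>c\<in>N. z c * ?e c a)"
    proof
      fix a show "z a = (\<Sum>c\<in>N. z c * ?e c a)"
        using z N(1) by (simp add: supported_on_def if_distrib[of "(*) _"] cong: if_cong)
    qed
    also have "\<dots> = (\<Sum>c\<in>N. (\<lambda>a. z c * ?e c a))" by (simp add: fun_eq_iff sum_fun_apply)
    also have "\<dots> \<in> F.span (?e ` N)"
      by (intro F.span_sum F.span_scale F.span_base imageI)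
    finally show "z \<in> F.span (?e ` N)" .
  qed
  then have finS: "finite S"
    using F.independent_span_bound[OF finite_imageI[OF N(1)] S(2)] S(1) by blast
  let ?A = "(\<lambda>z. z +o B) ` S"
  have A: "?A \<subseteq> carrier (quot_module Z B)" using S(1) by (auto simp: carrier_quot_module)
  have sub: "submodule class_ring (V.span ?A) (quot_module Z B)"
    by (rule V.span_is_submodule[OF A])
  have comb: "(\<Sum>v\<in>T. (\<lambda>a. u v * v a)) +o B \<in> V.span ?A" if "finite T" "T \<subseteq> S" for T u
    using that
  proof (induction T)
    case empty
    then show ?case using submodule.zero_closed[OF sub] by (simp only: zero_quot_module sum.empty)
  next
    case (insert v T)
    have "v +o B \<in> V.span ?A" using V.in_own_span[OF A] insert.prems by blast
    then have "(\<lambda>a. u v * v a) +o B \<in> V.span ?A"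
      using submodule.smult_closed[OF sub, of "u v" "v +o B"] unfolding smult_quot_module[OF B] by simp
    moreover have "(\<Sum>v\<in>T. (\<lambda>a. u v * v a)) +o B \<in> V.span ?A" using insert by blast
    ultimately have "((\<lambda>a. u v * v a) + (\<Sum>v\<in>T. (\<lambda>a. u v * v a))) +o B \<in> V.span ?A"
      unfolding add_quot_module[OF B, symmetric, of _ _ Z] by (rule submodule.m_closed[OF sub])
    then show ?case by (simp only: sum.insert[OF insert.hyps])
  qed
  have "carrier (quot_module Z B) \<subseteq> V.span ?A"
  proof
    fix x assume "x \<in> carrier (quot_module Z B)"
    then obtain z where z: "z \<in> Z" "x = z +o B" by (auto simp: carrier_quot_module)
    then obtain u where "z = (\<Sum>v\<in>S. (\<lambda>a. u v * v a))"
      using S(3) unfolding F.span_finite[OF finS] by blast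
    then show "x \<in> V.span ?A" using comb[OF finS order_refl] z(2) by simp
  qed
  then have "V.span ?A = carrier (quot_module Z B)"
    using V.span_is_subset2[OF A] by blast
  then show ?thesis
    unfolding V.fin_dim_def using finS A by blast
qed

text \<open>Rank and nullity for the surjection \<open>Z / B \<rightarrow> Z / B'\<close>, whose kernel is \<open>B' / B\<close>.\<close>

lemma quot_dim_eq_imp_eq:
  fixes Z B B' :: "('c \<Rightarrow> 'f::field) set"
  assumes sm: "submod Z" "submod B" "submod B'" and sub: "B \<subseteq> B'" "B' \<subseteq> Z"
    and N: "finite N" "Z \<subseteq> supported_on N"
    and dim: "vectorspace.dim (class_ring :: 'f ring) (quot_module Z B) =
      vectorspace.dim (class_ring :: 'f ring) (quot_module Z B')"
  shows "B = B'"
proof -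
  let ?V = "quot_module Z B" and ?W = "quot_module Z B'" and ?K = "quot_module B' B"
  note hom = mod_hom_quot_quot[OF sm(1,1,2,3) order_refl sub(1)]
  interpret linear_map "class_ring :: 'f ring" ?V ?W "\<lambda>S. S + B'"
    using vectorspace_quot_module[OF sm(1,2)] vectorspace_quot_module[OF sm(1,3)] hom(1)
    by (simp add: linear_map_def)
  have im: "imT = carrier ?W"
    unfolding im_def by (auto simp: carrier_quot_module hom(2) image_image)
  have ker: "kerT = carrier ?K"
  proof -
    have iff: "z +o B' = 0 +o B' \<longleftrightarrow> z \<in> B'" for z
      using coset_eq_iff[OF submod_additive_subgroup[OF sm(3)], of z 0] by simp
    show ?thesis
    proof (rule Set.set_eqI)
      fix x
      have "x \<in> kerT \<longleftrightarrow> (\<exists>z\<in>Z. x = z +o B \<and> z +o B' = 0 +o B')"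
      proof -
        have "x \<in> kerT \<longleftrightarrow> (\<exists>z\<in>Z. x = z +o B \<and> (z +o B) + B' = 0 +o B')"
          unfolding ker_def carrier_quot_module zero_quot_module by blast
        then show ?thesis by (simp only: hom(2))
      qed
      also have "\<dots> \<longleftrightarrow> x \<in> carrier ?K"
        unfolding carrier_quot_module iff using sub(2) by blast
      finally show "x \<in> kerT \<longleftrightarrow> x \<in> carrier ?K" .
    qed
  qed
  have "?W\<lparr>carrier := imT\<rparr> = ?W" unfolding im by (simp add: quot_module_def)
  moreover have "?V\<lparr>carrier := kerT\<rparr> = ?K" unfolding ker by (simp add: quot_module_def)
  ultimately have "vectorspace.dim (class_ring :: 'f ring) ?K = 0"
    using rank_nullity[OF fin_dim_quot_module[OF sm(1,2) N]] dim by simp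
  moreover interpret K: vectorspace "class_ring :: 'f ring" ?K
    by (rule vectorspace_quot_module[OF sm(3,2)])
  have fdK: "K.fin_dim"
    using sub(2) N(2) by (intro fin_dim_quot_module[OF sm(3,2) N(1)]) blast
  obtain \<beta> where \<beta>: "finite \<beta>" "K.basis \<beta>" using K.finite_basis_exists[OF fdK] by blast
  ultimately have "\<beta> = {}" using K.dim_basis[OF \<beta>] by simp
  then have "carrier ?K = {\<zero>\<^bsub>?K\<^esub>}" using \<beta>(2) unfolding K.basis_def by (simp add: K.span_empty)
  have "B' \<subseteq> B"
  proof
    fix b assume "b \<in> B'"
    then have "b +o B \<in> carrier ?K" by (simp add: carrier_quot_module)
    then have "b +o B = 0 +o B" using \<open>carrier ?K = {\<zero>\<^bsub>?K\<^esub>}\<close> by (simp add: zero_quot_module)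
    then show "b \<in> B" using coset_eq_iff[OF submod_additive_subgroup[OF sm(2)], of b 0] by simp
  qed
  then show ?thesis using sub by blast
qed

section \<open>Averaging the projections over all co-trees\<close>

context int_matrix
begin

text \<open>With the functional \<open>\<lambda>\<close> of \<open>R\<close>, only indices with \<open>\<lambda>\<^sub>f \<noteq> 0\<close> contribute. The projection of \<open>z\<close> for
\<open>R \<union> {f}\<close> vanishes on the domain of \<open>\<lambda>\<close> except at \<open>f\<close>, and differs from \<open>z\<close> by an element of the row
space, so its entry at \<open>f\<close> is \<open>\<lambda>(z) / \<lambda>\<^sub>f\<close>. The squared index is \<open>\<kappa>\<^sup>2 \<lambda>\<^sub>f\<^sup>2\<close>. The sum therefore equals
\<open>\<kappa>\<^sup>2 \<lambda>(z) \<lambda>(v)\<close>, and \<open>\<lambda>(v) = 0\<close>.\<close>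

lemma circuit_sum_zero:
  fixes z v :: "'c \<Rightarrow> real"
  assumes "R \<subseteq> N" "z \<in> supported_on N" "v \<in> row_span M D"
  shows "(\<Sum>f\<in>{f\<in>N - R. cotree_set (insert f R)}.
    (real (lattice_index (insert f R)))\<^sup>2 * (proj (insert f R) z f * v f)) = 0"
proof (cases "\<exists>f\<in>N - R. cotree_set (insert f R)")
  case False
  then have "{f\<in>N - R. cotree_set (insert f R)} = {}" by blast
  then show ?thesis by (simp only: sum.empty)
next
  case True
  then obtain f0 where f0: "f0 \<in> N - R" "cotree_set (insert f0 R)" by blast
  obtain l where l: "\<And>b. b \<in> M \<Longrightarrow> (\<Sum>u\<in>N - R. l u * D b u) = 0"
    and cot: "\<And>f. f \<in> N - R \<Longrightarrow> cotree_set (insert f R) \<longleftrightarrow> l f \<noteq> 0"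
    by (fact circuit_functional[OF assms(1) f0])
  obtain \<kappa> :: real where \<kappa>: "\<And>f. f \<in> N - R \<Longrightarrow> l f \<noteq> 0 \<Longrightarrow>
      real (lattice_index (insert f R)) = \<kappa> * \<bar>real_of_int (l f)\<bar>"
    by (rule lattice_index_circuit[OF assms(1), of l]) (rule l, assumption, blast)
  define lam where "lam x = (\<Sum>u\<in>N - R. real_of_int (l u) * x u)" for x :: "'c \<Rightarrow> real"
  have lam_row: "lam x = 0" if "x \<in> row_span M D" for x
    unfolding lam_def by (rule functional_vanishes_on_row_span[OF l that])
  have proj_f: "real_of_int (l f) * proj (insert f R) z f = lam z" if f: "f \<in> N - R" "l f \<noteq> 0" for f
  proof -
    have cf: "cotree_set (insert f R)" using cot f by simp
    have "lam (proj (insert f R) z) = (\<Sum>u\<in>N - R. if u = f then real_of_int (l f) * proj (insert f R) z f else 0)"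
      unfolding lam_def
    proof (intro sum.cong refl)
      fix u assume "u \<in> N - R"
      then show "real_of_int (l u) * proj (insert f R) z u =
          (if u = f then real_of_int (l f) * proj (insert f R) z f else 0)"
        using supported_onD[OF proj_supported[OF cf assms(2)], of u] by auto
    qed
    also have "\<dots> = real_of_int (l f) * proj (insert f R) z f"
      using f finite_cols by simp
    finally have "real_of_int (l f) * proj (insert f R) z f = lam (proj (insert f R) z)" by simp
    also have "\<dots> = lam z"
      using lam_row[OF diff_proj_row_span[OF cf, of z]] by (simp add: lam_def right_diff_distrib sum_subtractf)
    finally show ?thesis .
  qed
  have "(\<Sum>f\<in>{f\<in>N - R. cotree_set (insert f R)}.
      (real (lattice_index (insert f R)))\<^sup>2 * (proj (insert f R) z f * v f)) =
    (\<Sum>f\<in>N - R. \<kappa>\<^sup>2 * lam z * (real_of_int (l f) * v f))"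
  proof (rule sum.mono_neutral_cong_left)
    show "finite (N - R)" using finite_cols by simp
    show "\<forall>f\<in>N - R - {f\<in>N - R. cotree_set (insert f R)}. \<kappa>\<^sup>2 * lam z * (real_of_int (l f) * v f) = 0"
      using cot by auto
    fix f assume "f \<in> {f\<in>N - R. cotree_set (insert f R)}"
    then have f: "f \<in> N - R" "l f \<noteq> 0" using cot by auto
    have "(real (lattice_index (insert f R)))\<^sup>2 = \<kappa>\<^sup>2 * real_of_int (l f) * real_of_int (l f)"
      by (simp add: \<kappa>[OF f] power_mult_distrib power2_eq_square)
    then have "(real (lattice_index (insert f R)))\<^sup>2 * (proj (insert f R) z f * v f) =
        \<kappa>\<^sup>2 * (real_of_int (l f) * proj (insert f R) z f) * (real_of_int (l f) * v f)"
      by simp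
    then show "(real (lattice_index (insert f R)))\<^sup>2 * (proj (insert f R) z f * v f) =
        \<kappa>\<^sup>2 * lam z * (real_of_int (l f) * v f)"
      by (simp only: proj_f[OF f])
  qed auto
  also have "\<dots> = \<kappa>\<^sup>2 * lam z * lam v"
    by (simp add: lam_def sum_distrib_left)
  also have "\<dots> = 0" using lam_row[OF assms(3)] by simp
  finally show ?thesis .
qed

text \<open>The weights \<open>W\<close> of the inner product are inverse to the weights \<open>w\<close> of the co-trees. Hence in the
double sum over co-trees \<open>L\<close> and entries \<open>f \<in> L\<close> the weight that remains is the product over
\<open>R = L - {f}\<close>. Summing over \<open>f\<close> first, with \<open>R\<close> fixed, gives zero.\<close>

theorem cotree_average_orthogonal:
  fixes z v w W :: "'c \<Rightarrow> real"
  assumes "z \<in> supported_on N" "v \<in> row_span M D" "\<And>b. b \<in> N \<Longrightarrow> W b * w b = 1"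
  shows "(\<Sum>f\<in>N. W f * ((\<Sum>L | cotree_set L. (real (lattice_index L))\<^sup>2 * (\<Prod>b\<in>L. w b) * proj L z f) * v f)) = 0"
proof -
  let ?CT = "{L. cotree_set L}"
  have sub: "L \<subseteq> N" if "cotree_set L" for L
    using that by (simp add: cotree_set_def)
  let ?t = "\<lambda>L f. (real (lattice_index L))\<^sup>2 * (proj L z f * v f)"
  have "(\<Sum>f\<in>N. W f * ((\<Sum>L\<in>?CT. (real (lattice_index L))\<^sup>2 * (\<Prod>b\<in>L. w b) * proj L z f) * v f)) =
      (\<Sum>f\<in>N. \<Sum>L\<in>?CT. (W f * (\<Prod>b\<in>L. w b)) * ?t L f)"
    by (simp add: sum_distrib_left sum_distrib_right ac_simps)
  also have "\<dots> = (\<Sum>L\<in>?CT. \<Sum>f\<in>N. (W f * (\<Prod>b\<in>L. w b)) * ?t L f)"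
    by (rule sum.swap)
  also have "\<dots> = (\<Sum>L\<in>?CT. \<Sum>f\<in>L. (\<Prod>b\<in>L - {f}. w b) * ?t L f)"
  proof (rule sum.cong[OF refl])
    fix L assume "L \<in> ?CT"
    then have L: "cotree_set L" "L \<subseteq> N" by (auto simp: cotree_set_def)
    then have "finite L" using finite_cols finite_subset by blast
    show "(\<Sum>f\<in>N. (W f * (\<Prod>b\<in>L. w b)) * ?t L f) = (\<Sum>f\<in>L. (\<Prod>b\<in>L - {f}. w b) * ?t L f)"
    proof (rule sum.mono_neutral_cong_right[OF finite_cols L(2)])
      show "\<forall>f\<in>N - L. (W f * (\<Prod>b\<in>L. w b)) * ?t L f = 0"
        using supported_onD[OF proj_supported[OF L(1) assms(1)]] by simp
      fix f assume f: "f \<in> L"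
      have "(\<Prod>b\<in>L. w b) = w f * (\<Prod>b\<in>L - {f}. w b)"
        by (rule prod.remove[OF \<open>finite L\<close> f])
      then have "W f * (\<Prod>b\<in>L. w b) = (W f * w f) * (\<Prod>b\<in>L - {f}. w b)" by simp
      also have "W f * w f = 1" using assms(3) f L(2) by blast
      finally show "(W f * (\<Prod>b\<in>L. w b)) * ?t L f = (\<Prod>b\<in>L - {f}. w b) * ?t L f" by simp
    qed
  qed
  also have "\<dots> = (\<Sum>(L, f)\<in>Sigma ?CT (\<lambda>L. L). (\<Prod>b\<in>L - {f}. w b) * ?t L f)"
    by (rule sum.Sigma) (simp_all add: finite_cotree_sets sub finite_subset[OF _ finite_cols])
  also have "\<dots> = (\<Sum>(R, f)\<in>Sigma (Pow N) (\<lambda>R. {f\<in>N - R. cotree_set (insert f R)}). (\<Prod>b\<in>R. w b) * ?t (insert f R) f)"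
    by (rule sum.reindex_bij_witness[where i = "\<lambda>(R, f). (insert f R, f)" and j = "\<lambda>(L, f). (L - {f}, f)"])
      (auto simp: insert_absorb dest: sub)
  also have "\<dots> = (\<Sum>R\<in>Pow N. \<Sum>f\<in>{f\<in>N - R. cotree_set (insert f R)}. (\<Prod>b\<in>R. w b) * ?t (insert f R) f)"
    by (rule sum.Sigma[symmetric]) (use finite_cols in auto)
  also have "\<dots> = (\<Sum>R\<in>Pow N. (\<Prod>b\<in>R. w b) * (\<Sum>f\<in>{f\<in>N - R. cotree_set (insert f R)}. ?t (insert f R) f))"
    by (simp only: sum_distrib_left)
  also have "\<dots> = 0"
    by (intro sum.neutral ballI) (simp only: Pow_iff circuit_sum_zero[OF _ assms(1,2)] mult_zero_right)
  finally show ?thesis .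
qed

end

section \<open>Real kernels of integer matrices\<close>

text \<open>Real solutions of a rational linear system are real combinations of rational ones: expand the entries
of \<open>z\<close> in a basis \<open>J\<close> of the rational vector space that they span. An integral relation between the
entries then holds for the coefficients of each basis element separately.\<close>

lemma real_kernel_rational:
  fixes z :: "'c \<Rightarrow> real" and A :: "'c \<Rightarrow> 'b \<Rightarrow> int"
  assumes "finite N" "z \<in> supported_on N" "\<And>a. a \<in> P \<Longrightarrow> (\<Sum>b\<in>N. of_int (A b a) * z b) = 0"
  obtains J :: "real set" and q :: "real \<Rightarrow> 'c \<Rightarrow> rat"
  where "finite J" "\<And>j. j \<in> J \<Longrightarrow> q j \<in> supported_on N"
    "\<And>j a. j \<in> J \<Longrightarrow> a \<in> P \<Longrightarrow> (\<Sum>b\<in>N. of_int (A b a) * q j b) = 0"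
    "z = (\<lambda>b. \<Sum>j\<in>J. j * of_rat (q j b))"
proof -
  interpret R: vector_space "\<lambda>(q::rat) (r::real). of_rat q * r"
    by unfold_locales (auto simp: of_rat_add of_rat_mult algebra_simps)
  obtain J where J: "J \<subseteq> z ` N" "R.independent J" "z ` N \<subseteq> R.span J"
    using R.maximal_independent_subset[of "z ` N"] by metis
  have fin: "finite J" using J(1) assms(1) finite_subset by blast
  have "\<forall>b\<in>N. \<exists>u. z b = (\<Sum>j\<in>J. of_rat (u j) * j)"
  proof
    fix b assume "b \<in> N"
    then have "z b \<in> R.span J" using J(3) by blast
    then show "\<exists>u. z b = (\<Sum>j\<in>J. of_rat (u j) * j)"
      unfolding R.span_finite[OF fin] by blast
  qed
  from bchoice[OF this] obtain u where u: "\<And>b. b \<in> N \<Longrightarrow> z b = (\<Sum>j\<in>J. of_rat (u b j) * j)"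
    by blast
  define q where "q = (\<lambda>j b. if b \<in> N then u b j else 0)"
  show ?thesis
  proof (rule that[OF fin, of q])
    show "q j \<in> supported_on N" for j by (simp add: q_def supported_on_def)
    show "z = (\<lambda>b. \<Sum>j\<in>J. j * of_rat (q j b))"
    proof
      fix b show "z b = (\<Sum>j\<in>J. j * of_rat (q j b))"
      proof (cases "b \<in> N")
        case True
        then show ?thesis by (simp add: q_def u mult.commute)
      next
        case False
        then show ?thesis using supported_onD[OF assms(2) False] by (simp add: q_def)
      qed
    qed
    fix j a assume j: "j \<in> J" and a: "a \<in> P"
    have "(\<Sum>i\<in>J. of_rat (\<Sum>b\<in>N. of_int (A b a) * q i b) * i) =
        (\<Sum>i\<in>J. \<Sum>b\<in>N. of_int (A b a) * (of_rat (u b i) * i))"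
      by (simp add: q_def of_rat_sum of_rat_mult sum_distrib_right mult.assoc)
    also have "\<dots> = (\<Sum>b\<in>N. of_int (A b a) * z b)"
      by (subst sum.swap) (simp add: u sum_distrib_left)
    also have "\<dots> = 0" using assms(3)[OF a] .
    finally show "(\<Sum>b\<in>N. of_int (A b a) * q j b) = 0"
      using R.independentD[OF J(2) fin order_refl _ j, of "\<lambda>i. \<Sum>b\<in>N. of_int (A b a) * q i b"] by simp
  qed
qed

section \<open>The cellular chain complex\<close>

lemma cell_chains_supported: "cell_chains X A j = supported_on (A \<inter> cw_kcells X j)"
  by (simp add: cell_chains_def supported_on_def)

lemma cell_chains_all: "cell_chains X (cw_cells X) j = supported_on (cw_kcells X j)"
proof -
  have "cw_cells X \<inter> cw_kcells X j = cw_kcells X j" by (auto simp: cw_kcells_def)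
  then show ?thesis by (simp only: cell_chains_supported)
qed

lemma bd_add: "bd X j (x + y) = bd X j x + bd X j y"
  by (simp add: bd_def fun_eq_iff distrib_left sum.distrib)

lemma bd_scale: "bd X j (\<lambda>a. r * x a) = (\<lambda>a. r * bd X j x a)"
  by (simp add: bd_def fun_eq_iff sum_distrib_left mult.left_commute)

lemma bd_zero: "bd X j 0 = 0"
  by (simp add: bd_def fun_eq_iff)

lemma bd_supported: "bd X j z \<in> supported_on (cw_kcells X (j - 1))"
  by (simp add: bd_def supported_on_def)

lemma submod_image:
  assumes "submod P" "\<And>x y. h (x + y) = h x + h y" "\<And>r x. h (\<lambda>a. r * x a) = (\<lambda>a. r * h x a)" "h 0 = 0"
  shows "submod (h ` P)"
  unfolding submod_def
proof (intro conjI ballI allI)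
  show "0 \<in> h ` P" using submod_0[OF assms(1)] assms(4) by (metis imageI)
  fix x assume "x \<in> h ` P"
  then obtain p where p: "p \<in> P" "x = h p" by blast
  show "(\<lambda>a. r * x a) \<in> h ` P" for r
    unfolding p(2) assms(3)[symmetric] by (intro imageI submod_scale[OF assms(1) p(1)])
  fix y assume "y \<in> h ` P"
  then obtain q where q: "q \<in> P" "y = h q" by blast
  show "x + y \<in> h ` P"
    unfolding p(2) q(2) assms(2)[symmetric] by (intro imageI submod_add[OF assms(1) p(1) q(1)])
qed

lemma submod_boundaries: "submod (boundaries X A j)"
  unfolding boundaries_def cell_chains_supported
  by (intro submod_image submod_supported bd_add bd_scale bd_zero)

lemma submod_cycles:
  fixes X :: "('a, 'c) cw_complex"
  shows "submod (cycles X A j :: ('c \<Rightarrow> 'f::comm_ring_1) set)"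
  unfolding submod_def
proof (intro conjI ballI allI)
  show "0 \<in> cycles X A j"
    using submod_0[OF submod_supported]
    by (simp only: cycles_def cell_chains_supported mem_Collect_eq bd_zero simp_thms)
  fix x :: "'c \<Rightarrow> 'f" assume x: "x \<in> cycles X A j"
  show "(\<lambda>a. r * x a) \<in> cycles X A j" for r
    using x submod_scale[OF submod_supported, of x "A \<inter> cw_kcells X j" r]
    by (simp add: cycles_def cell_chains_supported bd_scale zero_fun_def)
  fix y :: "'c \<Rightarrow> 'f" assume y: "y \<in> cycles X A j"
  show "x + y \<in> cycles X A j"
    using x y submod_add[OF submod_supported, of x "A \<inter> cw_kcells X j" y]
    by (simp add: cycles_def cell_chains_supported bd_add)
qed

lemma (in finite_cw_complex) bd_bd: "bd X (j - 1) (bd X j z) = 0"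
proof
  fix c show "bd X (j - 1) (bd X j z) c = 0 c"
  proof (cases "c \<in> cw_kcells X (j - 2)")
    case True
    have "bd X (j - 1) (bd X j z) c = (\<Sum>a\<in>cw_kcells X (j - 1). \<Sum>b\<in>cw_kcells X j.
        of_int (incidence X b a * incidence X a c) * z b)"
      using True by (simp add: bd_def sum_distrib_left ac_simps cong: sum.cong)
    also have "\<dots> = (\<Sum>b\<in>cw_kcells X j. of_int (\<Sum>a\<in>cw_kcells X (j - 1). incidence X b a * incidence X a c) * z b)"
      by (subst sum.swap) (simp add: sum_distrib_right)
    also have "\<dots> = 0"
      by (intro sum.neutral ballI) (simp only: incidence_incidence[OF _ True] of_int_0 mult_zero_left)
    finally show ?thesis by simp
  qed (simp add: bd_def)
qed

section \<open>Spanning co-trees\<close>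

text \<open>In a fixed degree, the incidence numbers between \<open>d\<close>-cells and \<open>(d-1)\<close>-cells form an integer matrix
whose row space is the module of boundaries.\<close>

locale cw_degree = finite_cw_complex X for X :: "('a, 'c) cw_complex" +
  fixes d :: nat
  assumes degree: "d \<ge> 1"
begin

abbreviation "low_deg \<equiv> int d - 1"
abbreviation "low_cells \<equiv> cw_kcells X (int d - 1)"
abbreviation "top_cells \<equiv> cw_kcells X (int d)"

definition bd_matrix :: "'c \<Rightarrow> 'c \<Rightarrow> int" where
  "bd_matrix b a = (if a \<in> low_cells then incidence X b a else 0)"

sublocale int_matrix top_cells low_cells bd_matrix
  by unfold_locales (simp_all add: finite_kcells bd_matrix_def)

lemma bd_eq: "bd X (int d) y = (\<lambda>a. \<Sum>b\<in>top_cells. of_int (bd_matrix b a) * y b)"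
  by (simp add: bd_def bd_matrix_def fun_eq_iff)

lemma boundaries_row_span: "boundaries X (cw_cells X) low_deg = row_span top_cells bd_matrix"
proof
  show "boundaries X (cw_cells X) low_deg \<subseteq> row_span top_cells bd_matrix"
    by (auto simp: boundaries_def row_span_def bd_eq)
  show "row_span top_cells bd_matrix \<subseteq> boundaries X (cw_cells X) low_deg"
  proof
    fix v assume "v \<in> row_span top_cells bd_matrix"
    then obtain y where y: "v = (\<lambda>a. \<Sum>b\<in>top_cells. of_int (bd_matrix b a) * y b)"
      by (auto simp: row_span_def)
    let ?y = "\<lambda>b. if b \<in> top_cells then y b else 0"
    have "v = bd X (int d) ?y" unfolding bd_eq y by (intro ext sum.cong refl) simp
    moreover have "?y \<in> supported_on top_cells" by (simp add: supported_on_def)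
    ultimately show "v \<in> boundaries X (cw_cells X) low_deg"
      by (simp add: boundaries_def cell_chains_all)
  qed
qed

lemma row_span_cycles: "row_span top_cells bd_matrix \<subseteq> cycles X (cw_cells X) low_deg"
proof
  fix v assume v: "v \<in> row_span top_cells bd_matrix"
  then obtain y where "v = bd X (int d) y" by (auto simp: row_span_def bd_eq)
  then have "bd X low_deg v = 0" using bd_bd[of "int d" y] by simp
  then show "v \<in> cycles X (cw_cells X) low_deg"
    using row_span_supported[OF v] by (simp add: cycles_def cell_chains_all)
qed

lemma cycles_supported: "z \<in> cycles X (cw_cells X) low_deg \<Longrightarrow> z \<in> supported_on low_cells"
  by (simp add: cycles_def cell_chains_all)

lemma cycles_subset_iff:
  "z \<in> cycles X L low_deg \<longleftrightarrow> z \<in> cycles X (cw_cells X) low_deg \<and> z \<in> supported_on (L \<inter> low_cells)"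
proof -
  have "z \<in> supported_on (L \<inter> low_cells) \<Longrightarrow> z \<in> supported_on low_cells"
    by (auto simp: supported_on_def)
  then show ?thesis
    by (auto simp: cycles_def cell_chains_supported cell_chains_all[unfolded cell_chains_supported])
qed

lemma proj_cycles:
  assumes "cotree_set (L \<inter> low_cells)" "z \<in> cycles X (cw_cells X) low_deg"
  shows "proj (L \<inter> low_cells) z \<in> cycles X L low_deg"
proof -
  have "(\<lambda>c. z c - proj (L \<inter> low_cells) z c) \<in> cycles X (cw_cells X) low_deg"
    using diff_proj_row_span[OF assms(1)] row_span_cycles by blast
  from additive_subgroup_diff[OF submod_additive_subgroup[OF submod_cycles] assms(2) this]
  have "proj (L \<inter> low_cells) z \<in> cycles X (cw_cells X) low_deg"
    by (simp add: fun_diff_def)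
  then show ?thesis
    using proj_supported[OF assms(1) cycles_supported[OF assms(2)]] cycles_subset_iff[of _ L] by blast
qed

lemma coset_eq_proj:
  assumes "cotree_set (L \<inter> low_cells)"
  shows "proj (L \<inter> low_cells) z +o row_span top_cells bd_matrix = z +o row_span top_cells bd_matrix"
proof -
  have "z - proj (L \<inter> low_cells) z \<in> row_span top_cells bd_matrix"
    using diff_proj_row_span[OF assms] by (simp add: fun_diff_def)
  then show ?thesis
    using coset_eq_iff[OF submod_additive_subgroup[OF submod_row_span]] by blast
qed

lemma inj_on_cosets:
  assumes "cotree_set (L \<inter> low_cells)"
  shows "inj_on (\<lambda>z. z +o row_span top_cells bd_matrix) (supported_on (L \<inter> low_cells) :: ('c \<Rightarrow> 'f::field_char_0) set)"
proof (rule inj_onI)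
  fix x y :: "'c \<Rightarrow> 'f"
  assume x: "x \<in> supported_on (L \<inter> low_cells)" and y: "y \<in> supported_on (L \<inter> low_cells)"
    and "x +o row_span top_cells bd_matrix = y +o row_span top_cells bd_matrix"
  then have "(\<lambda>c. x c - y c) \<in> row_span top_cells bd_matrix"
    by (simp add: coset_eq_iff[OF submod_additive_subgroup[OF submod_row_span]] fun_diff_def)
  from proj_unique[OF assms y this] show "x = y" by (simp add: proj_id[OF x])
qed

lemma boundaries_skeleton:
  assumes "L \<subseteq> cw_skel X low_deg"
  shows "boundaries X L low_deg = ({0} :: ('c \<Rightarrow> 'f::comm_ring_1) set)"
proof -
  have "L \<inter> top_cells = {}" using assms by (auto simp: cw_skel_def cw_kcells_def)
  then have "cell_chains X L (int d) = ({0} :: ('c \<Rightarrow> 'f) set)"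
    by (auto simp: cell_chains_supported supported_on_def)
  then show ?thesis by (simp add: boundaries_def bd_zero)
qed

lemma kcells_in_skel: "cw_skel X j \<subseteq> L \<Longrightarrow> L \<inter> cw_kcells X j = cw_kcells X j"
  by (auto simp: cw_skel_def cw_kcells_def)

text \<open>A subcomplex without \<open>d\<close>-cells has no boundaries in degree \<open>d - 1\<close>, so its homology consists of its
cycles.\<close>

lemma homology_incl:
  assumes "L \<subseteq> cw_skel X low_deg"
  shows "homology X L low_deg = quot_module (cycles X L low_deg) {0}"
    and "homology X (cw_cells X) low_deg = quot_module (cycles X (cw_cells X) low_deg) (row_span top_cells bd_matrix)"
    and "incl_induced X low_deg = (\<lambda>S. S + row_span top_cells bd_matrix)"
  by (simp_all add: homology_def boundaries_skeleton[OF assms] boundaries_row_span incl_induced_def fun_eq_iff)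

lemma submod_zero: "submod {0}"
  by (simp add: submod_def zero_fun_def plus_fun_def)

text \<open>The projection changes a cycle by a boundary and so moves it within its class onto \<open>L\<close>; two cycles on
\<open>L\<close> in the same class are equal as \<open>L\<close> carries no nonzero boundary. This is the isomorphism. The projection
also preserves the boundary of every chain, so \<open>L\<close> has all the boundaries of degree \<open>d - 2\<close>, and the
Betti numbers agree.\<close>

lemma cotree_set_imp_spanning_cotree:
  assumes L: "cw_skel X (int d - 2) \<subseteq> L" "L \<subseteq> cw_skel X low_deg" and cot: "cotree_set (L \<inter> low_cells)"
  shows "spanning_cotree X d L"
proof -
  let ?B = "row_span top_cells bd_matrix :: ('c \<Rightarrow> rat) set"
  let ?Z = "cycles X (cw_cells X) low_deg :: ('c \<Rightarrow> rat) set" and ?ZL = "cycles X L low_deg :: ('c \<Rightarrow> rat) set"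
  have ZL: "?ZL \<subseteq> ?Z" "?ZL \<subseteq> supported_on (L \<inter> low_cells)"
    using cycles_subset_iff[of _ L] by blast+
  note hom = mod_hom_quot_quot[OF submod_cycles submod_cycles submod_zero submod_row_span ZL(1)]
  have zero: "{0} \<subseteq> ?B" using submod_0[OF submod_row_span] by blast
  have "mod_hom class_ring (homology X L low_deg :: (rat, ('c \<Rightarrow> rat) set) module) (homology X (cw_cells X) low_deg) (incl_induced X low_deg)"
    unfolding homology_incl[OF L(2)] by (rule hom(1)[OF zero])
  moreover have "bij_betw (incl_induced X low_deg) (carrier (homology X L low_deg :: (rat, ('c \<Rightarrow> rat) set) module))
      (carrier (homology X (cw_cells X) low_deg))"
    unfolding homology_incl[OF L(2)] carrier_quot_module bij_betw_def
  proof
    have "inj_on (\<lambda>z. z +o ?B) ?ZL"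
      by (rule inj_on_subset[OF inj_on_cosets[OF cot] ZL(2)])
    then have "inj_on ((\<lambda>S. S + ?B) \<circ> (\<lambda>z. z +o {0})) ?ZL"
      unfolding comp_def hom(2)[OF zero] .
    then show "inj_on (\<lambda>S. S + ?B) ((\<lambda>z. z +o {0}) ` ?ZL)"
      by (rule inj_on_imageI)
    have "(\<lambda>z. z +o ?B) ` ?ZL = (\<lambda>z. z +o ?B) ` ?Z"
    proof
      show "(\<lambda>z. z +o ?B) ` ?Z \<subseteq> (\<lambda>z. z +o ?B) ` ?ZL"
      proof (rule image_subsetI)
        fix z assume "z \<in> ?Z"
        then have "proj (L \<inter> low_cells) z \<in> ?ZL" by (rule proj_cycles[OF cot])
        then have "proj (L \<inter> low_cells) z +o ?B \<in> (\<lambda>z. z +o ?B) ` ?ZL" by (rule imageI)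
        then show "z +o ?B \<in> (\<lambda>z. z +o ?B) ` ?ZL" by (simp only: coset_eq_proj[OF cot])
      qed
    qed (use ZL(1) in blast)
    then show "(\<lambda>S. S + ?B) ` (\<lambda>z. z +o {0}) ` ?ZL = (\<lambda>z. z +o ?B) ` ?Z"
      by (simp add: image_image hom(2)[OF zero])
  qed
  moreover have "betti X L (int d - 2) = betti X (cw_cells X) (int d - 2)"
  proof -
    have chains: "cell_chains X L (int d - 2) = (cell_chains X (cw_cells X) (int d - 2) :: ('c \<Rightarrow> rat) set)"
      unfolding cell_chains_all cell_chains_supported[of X L] kcells_in_skel[OF L(1)] by (rule refl)
    have "bd X low_deg z \<in> bd X low_deg ` supported_on (L \<inter> low_cells)" if "z \<in> supported_on low_cells" for z :: "'c \<Rightarrow> rat"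
    proof -
      let ?p = "proj (L \<inter> low_cells) z"
      have "bd X low_deg (\<lambda>c. z c - ?p c) = 0"
        using diff_proj_row_span[OF cot, of z] row_span_cycles unfolding cycles_def by blast
      then have "bd X low_deg (?p + (\<lambda>c. z c - ?p c)) = bd X low_deg ?p"
        unfolding bd_add by simp
      moreover have "?p + (\<lambda>c. z c - ?p c) = z" by (simp add: fun_eq_iff)
      ultimately have "bd X low_deg z = bd X low_deg ?p" by simp
      then show ?thesis using proj_supported[OF cot that] by (rule image_eqI)
    qed
    moreover have "supported_on (L \<inter> low_cells) \<subseteq> (supported_on low_cells :: ('c \<Rightarrow> rat) set)"
      by (auto simp: supported_on_def)
    ultimately have "bd X low_deg ` (supported_on (L \<inter> low_cells) :: ('c \<Rightarrow> rat) set) = bd X low_deg ` supported_on low_cells"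
      by blast
    then have "boundaries X L (int d - 2) = (boundaries X (cw_cells X) (int d - 2) :: ('c \<Rightarrow> rat) set)"
      by (simp add: boundaries_def cell_chains_all cell_chains_supported[of X L])
    then show ?thesis by (simp add: betti_def homology_def cycles_def chains)
  qed
  moreover have "cw_subcomplex X L"
    by (rule cw_subcomplex_between_skeleta[of low_deg]) (use L in simp_all)
  ultimately show ?thesis
    using L unfolding spanning_cotree_def Let_def by blast
qed

text \<open>Injectivity of the map on homology says that \<open>L\<close> carries no nonzero boundary. For the dual vector of a cell
\<open>f\<close> outside \<open>L\<close>, use the condition on Betti numbers: \<open>L\<close> and \<open>X\<close> have the same cycles of degree
\<open>d - 2\<close>, so by a dimension count also the same boundaries, and the boundary of \<open>f\<close> is that of a chain
\<open>l\<close> on \<open>L\<close>. By surjectivity the cycle \<open>f - l\<close> is homologous to a cycle \<open>y\<close> on \<open>L\<close>. The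
boundary \<open>f - l - y\<close> has the required entries.\<close>

lemma spanning_cotree_imp_cotree_set:
  assumes sc: "spanning_cotree X d L"
  shows "cotree_set (L \<inter> low_cells)"
proof -
  have L: "cw_skel X (int d - 2) \<subseteq> L" "L \<subseteq> cw_skel X low_deg"
    and bij: "bij_betw (incl_induced X low_deg) (carrier (homology X L low_deg :: (rat, ('c \<Rightarrow> rat) set) module))
      (carrier (homology X (cw_cells X) low_deg))"
    and betti: "betti X L (int d - 2) = betti X (cw_cells X) (int d - 2)"
    using sc unfolding spanning_cotree_def Let_def by blast+
  let ?B = "row_span top_cells bd_matrix :: ('c \<Rightarrow> rat) set"
  let ?Z = "cycles X (cw_cells X) low_deg :: ('c \<Rightarrow> rat) set" and ?ZL = "cycles X L low_deg :: ('c \<Rightarrow> rat) set"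
  have B: "additive_subgroup ?B" by (rule submod_additive_subgroup[OF submod_row_span])
  have ZL: "?ZL \<subseteq> ?Z" using cycles_subset_iff[of _ L] by blast
  have zero: "{0} \<subseteq> ?B" using submod_0[OF submod_row_span] by blast
  note hom = mod_hom_quot_quot[OF submod_cycles submod_cycles submod_zero submod_row_span ZL zero]
  note bij' = bij[unfolded homology_incl[OF L(2)] carrier_quot_module bij_betw_def]
  have inj: "x = y" if "x \<in> ?ZL" "y \<in> ?ZL" "x +o ?B = y +o ?B" for x y
  proof -
    have "x +o {0} = y +o {0}"
    proof (rule inj_onD[OF conjunct1[OF bij']])
      show "(x +o {0}) + ?B = (y +o {0}) + ?B" unfolding hom(2) by (rule that(3))
    qed (use that in blast)+
    then show ?thesis by (auto simp: elt_set_plus_def)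
  qed
  have surj: "\<exists>y\<in>?ZL. z - y \<in> ?B" if z: "z \<in> ?Z" for z
  proof -
    have "z +o ?B \<in> (\<lambda>S. S + ?B) ` (\<lambda>z. z +o {0}) ` ?ZL" using conjunct2[OF bij'] z by blast
    then obtain y where "y \<in> ?ZL" "z +o ?B = y +o ?B" by (auto simp: hom(2))
    then show ?thesis using coset_eq_iff[OF B] by blast
  qed
  have bd_L: "boundaries X L (int d - 2) = (boundaries X (cw_cells X) (int d - 2) :: ('c \<Rightarrow> rat) set)"
  proof (rule quot_dim_eq_imp_eq)
    let ?Z2 = "cycles X (cw_cells X) (int d - 2) :: ('c \<Rightarrow> rat) set"
    have chains: "cell_chains X L (int d - 2) = (cell_chains X (cw_cells X) (int d - 2) :: ('c \<Rightarrow> rat) set)"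
      unfolding cell_chains_all cell_chains_supported[of X L] kcells_in_skel[OF L(1)] by (rule refl)
    have "cell_chains X L low_deg \<subseteq> (cell_chains X (cw_cells X) low_deg :: ('c \<Rightarrow> rat) set)"
      unfolding cell_chains_all cell_chains_supported[of X L] by (auto simp: supported_on_def)
    then show "boundaries X L (int d - 2) \<subseteq> (boundaries X (cw_cells X) (int d - 2) :: ('c \<Rightarrow> rat) set)"
      by (auto simp: boundaries_def)
    show "boundaries X (cw_cells X) (int d - 2) \<subseteq> ?Z2"
      using bd_bd[of low_deg] bd_supported[of X low_deg] by (auto simp: boundaries_def cycles_def cell_chains_all)
    show "submod ?Z2" by (rule submod_cycles)
    show "?Z2 \<subseteq> supported_on (cw_kcells X (int d - 2))" by (auto simp: cycles_def cell_chains_all)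
    show "vectorspace.dim (class_ring :: rat ring) (quot_module ?Z2 (boundaries X L (int d - 2))) =
      vectorspace.dim (class_ring :: rat ring) (quot_module ?Z2 (boundaries X (cw_cells X) (int d - 2)))"
      using betti by (simp add: betti_def homology_def cycles_def chains)
  qed (simp_all add: submod_boundaries finite_kcells)
  show ?thesis
    unfolding cotree_set_def
  proof (intro conjI ballI impI)
    fix v :: "'c \<Rightarrow> rat" assume v: "v \<in> ?B" "v \<in> supported_on (L \<inter> low_cells)"
    then have "v \<in> ?ZL" using row_span_cycles cycles_subset_iff[of v L] by blast
    moreover have "0 \<in> ?ZL" by (rule submod_0[OF submod_cycles])
    moreover have "v +o ?B = 0 +o ?B" using v(1) by (intro iffD2[OF coset_eq_iff[OF B]]) simp
    ultimately have "v = 0" by (rule inj)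
    then show "v = (\<lambda>_. 0)" by (simp add: zero_fun_def)
  next
    fix f assume f: "f \<in> low_cells - L \<inter> low_cells"
    let ?e = "(\<lambda>a. if a = f then 1 else 0) :: 'c \<Rightarrow> rat"
    have e: "?e \<in> supported_on low_cells" using f by (auto simp: supported_on_def)
    then have "bd X low_deg ?e \<in> boundaries X (cw_cells X) (int d - 2)"
      by (simp add: boundaries_def cell_chains_all)
    then obtain l where l: "l \<in> supported_on (L \<inter> low_cells)" "bd X low_deg ?e = bd X low_deg l"
      unfolding bd_L[symmetric] by (auto simp: boundaries_def cell_chains_supported)
    have lc: "l \<in> supported_on low_cells" using l(1) by (auto simp: supported_on_def)
    have eq: "bd X low_deg (?e - l) = 0"
    proof -
      have "bd X low_deg (?e - l) + bd X low_deg l = bd X low_deg ?e"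
        unfolding bd_add[symmetric] by simp
      then show ?thesis using l(2) by simp
    qed
    have "?e - l \<in> supported_on low_cells"
      using e lc additive_subgroup_diff[OF additive_subgroup_supported] by blast
    then have "?e - l \<in> ?Z" using eq by (simp add: cycles_def cell_chains_all)
    from surj[OF this] obtain y where y: "y \<in> ?ZL" "?e - l - y \<in> ?B" by blast
    have "(?e - l - y) g = (if g = f then 1 else 0)" if "g \<in> low_cells - L \<inter> low_cells" for g
    proof -
      have "y \<in> supported_on (L \<inter> low_cells)" using y(1) cycles_subset_iff[of y L] by blast
      then have "y g = 0" "l g = 0"
        using that l(1) by (auto simp: supported_on_def)
      then show ?thesis by simp
    qed
    then show "\<exists>u\<in>?B. \<forall>g\<in>low_cells - L \<inter> low_cells. u g = (if g = f then 1 else 0)"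
      using y(2) by blast
  qed auto
qed

lemma spanning_cotree_iff:
  "spanning_cotree X d L \<longleftrightarrow> cw_skel X (int d - 2) \<subseteq> L \<and> L \<subseteq> cw_skel X low_deg \<and> cotree_set (L \<inter> low_cells)"
  using cotree_set_imp_spanning_cotree spanning_cotree_imp_cotree_set
  by (auto simp: spanning_cotree_def Let_def)

text \<open>A spanning co-tree contains the whole \<open>(d-2)\<close>-skeleton and is determined by its \<open>(d-1)\<close>-cells.\<close>

lemma sum_spanning_cotrees:
  "(\<Sum>L | spanning_cotree X d L. h (L \<inter> low_cells)) = (\<Sum>L | cotree_set L. h L)"
proof (rule sum.reindex_bij_witness[where j = "\<lambda>L. L \<inter> low_cells" and i = "\<lambda>L. cw_skel X (int d - 2) \<union> L"])
  have split: "cw_skel X low_deg = cw_skel X (int d - 2) \<union> low_cells"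
    using cw_skel_split[of low_deg] by simp
  fix L assume "L \<in> {L. spanning_cotree X d L}"
  then show "cw_skel X (int d - 2) \<union> L \<inter> low_cells = L" "L \<inter> low_cells \<in> {L. cotree_set L}"
    using split by (auto simp: spanning_cotree_iff)
next
  have disj: "cw_skel X (int d - 2) \<inter> low_cells = {}" by (auto simp: cw_skel_def cw_kcells_def)
  have split: "cw_skel X low_deg = cw_skel X (int d - 2) \<union> low_cells"
    using cw_skel_split[of low_deg] by simp
  fix L assume "L \<in> {L. cotree_set L}"
  then have L: "cotree_set L" "L \<subseteq> low_cells" by (auto simp: cotree_set_def)
  then show eq: "(cw_skel X (int d - 2) \<union> L) \<inter> low_cells = L" using disj by blast
  show "cw_skel X (int d - 2) \<union> L \<in> {L. spanning_cotree X d L}"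
    using L split by (auto simp: spanning_cotree_iff eq)
qed simp

text \<open>Since \<open>L\<close> contains all cells of dimension \<open>d - 2\<close>, every \<open>(d-1)\<close>-chain is a relative cycle.\<close>

lemma cotree_index_eq:
  assumes "cw_skel X (int d - 2) \<subseteq> L"
  shows "cotree_index X d L = lattice_index (L \<inter> low_cells)"
proof -
  have "rel_cycles X L low_deg = (supported_on low_cells :: ('c \<Rightarrow> int) set)"
    using bd_supported[of X low_deg]
    by (auto simp: rel_cycles_def cell_chains_all cell_chains_supported[of X L] kcells_in_skel[OF assms])
  then show ?thesis
    by (simp add: cotree_index_def Coset.order_def rel_homology_def carrier_quot_module
        lattice_index_def rel_boundaries_def boundaries_row_span cell_chains_supported)
qed

end

section \<open>The maps \<open>\<psi>\<^sub>L\<close> as projections\<close>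

context cw_degree
begin

lemma psi_rat_eq:
  assumes L: "spanning_cotree X d L" and q: "q \<in> cycles X (cw_cells X) low_deg"
  shows "psi_rat X d L (q +o row_span top_cells bd_matrix) = proj (L \<inter> low_cells) q"
proof -
  have cot: "cotree_set (L \<inter> low_cells)" by (rule spanning_cotree_imp_cotree_set[OF L])
  have phi: "phi X d = (\<lambda>z :: 'c \<Rightarrow> rat. z +o row_span top_cells bd_matrix)"
    by (simp add: phi_def boundaries_row_span fun_eq_iff)
  have "cycles X L low_deg \<subseteq> (supported_on (L \<inter> low_cells) :: ('c \<Rightarrow> rat) set)"
    using cycles_subset_iff[of _ L] by blast
  then have inj: "inj_on (phi X d) (cycles X L low_deg :: ('c \<Rightarrow> rat) set)"
    unfolding phi by (rule inj_on_subset[OF inj_on_cosets[OF cot]])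
  show ?thesis
    unfolding psi_rat_def
  proof (rule the_inv_into_f_eq[OF inj])
    show "phi X d (proj (L \<inter> low_cells) q) = q +o row_span top_cells bd_matrix"
      unfolding phi by (rule coset_eq_proj[OF cot])
    show "proj (L \<inter> low_cells) q \<in> cycles X L low_deg" by (rule proj_cycles[OF cot q])
  qed
qed

lemma real_class_eq:
  "real_class X low_deg (q +o row_span top_cells bd_matrix) = real_chain q +o row_span top_cells bd_matrix"
proof -
  let ?BQ = "row_span top_cells bd_matrix :: ('c \<Rightarrow> rat) set"
    and ?BR = "row_span top_cells bd_matrix :: ('c \<Rightarrow> real) set"
  show ?thesis
    unfolding real_class_def boundaries_row_span
  proof
    show "real_chain ` (q +o ?BQ) + ?BR \<subseteq> real_chain q +o ?BR"
    proof
      fix x assume "x \<in> real_chain ` (q +o ?BQ) + ?BR"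
      then obtain b c where bc: "b \<in> ?BQ" "c \<in> ?BR" "x = real_chain (q + b) + c"
        unfolding set_plus_def elt_set_plus_def by blast
      have "x = real_chain q + (real_chain b + c)"
        by (simp add: bc(3) real_chain_def fun_eq_iff of_rat_add)
      moreover have "real_chain b \<in> ?BR"
        unfolding real_chain_def by (rule of_rat_row_span[OF bc(1)])
      then have "real_chain b + c \<in> ?BR" using bc(2) by (rule submod_add[OF submod_row_span])
      ultimately show "x \<in> real_chain q +o ?BR" unfolding elt_set_plus_def by blast
    qed
    show "real_chain q +o ?BR \<subseteq> real_chain ` (q +o ?BQ) + ?BR"
    proof
      fix x assume "x \<in> real_chain q +o ?BR"
      then obtain c where c: "c \<in> ?BR" "x = real_chain q + c" unfolding elt_set_plus_def by blast
      have "q + 0 \<in> q +o ?BQ"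
        unfolding elt_set_plus_def using submod_0[OF submod_row_span] by blast
      then have "real_chain q \<in> real_chain ` (q +o ?BQ)" by simp
      then show "x \<in> real_chain ` (q +o ?BQ) + ?BR" unfolding c(2) using c(1) by (rule set_plus_intro)
    qed
  qed
qed

lemma real_chain_cycles:
  assumes "q \<in> cycles X A j"
  shows "real_chain q \<in> cycles X A j"
proof -
  have "bd X j (real_chain q) = real_chain (bd X j q)"
    by (simp add: bd_def real_chain_def fun_eq_iff of_rat_sum of_rat_mult)
  then show ?thesis
    using assms by (auto simp: cycles_def cell_chains_def real_chain_def fun_eq_iff)
qed

text \<open>A real-linear map on homology is determined by its values on rational classes, which makes the real
extension of \<open>\<psi>\<^sub>L\<close> unique.\<close>

lemma real_cycle_decomposition:
  assumes "z \<in> cycles X (cw_cells X) low_deg"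
  obtains J :: "real set" and q where "finite J" "\<And>j. j \<in> J \<Longrightarrow> q j \<in> cycles X (cw_cells X) low_deg"
    "z = (\<lambda>b. \<Sum>j\<in>J. j * real_chain (q j) b)"
proof -
  have z: "z \<in> supported_on low_cells" "bd X low_deg z = 0"
    using assms by (auto simp: cycles_def cell_chains_all)
  have eq: "(\<Sum>b\<in>low_cells. of_int (incidence X b a) * z b) = 0" if "a \<in> cw_kcells X (low_deg - 1)" for a
    using fun_cong[OF z(2), of a] that by (simp add: bd_def)
  obtain J q where J: "finite J" "\<And>j. j \<in> J \<Longrightarrow> q j \<in> supported_on low_cells"
    "\<And>j a. j \<in> J \<Longrightarrow> a \<in> cw_kcells X (low_deg - 1) \<Longrightarrow> (\<Sum>b\<in>low_cells. of_int (incidence X b a) * q j b) = 0"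
    "z = (\<lambda>b. \<Sum>j\<in>J. j * of_rat (q j b))"
    by (rule real_kernel_rational[OF finite_cols z(1), of "cw_kcells X (low_deg - 1)" "incidence X"])
      (rule eq, assumption, blast)
  show ?thesis
  proof (rule that[OF J(1)])
    show "q j \<in> cycles X (cw_cells X) low_deg" if j: "j \<in> J" for j
    proof -
      have "bd X low_deg (q j) = 0"
        using J(3)[OF j] by (simp add: bd_def fun_eq_iff)
      then show ?thesis using J(2)[OF j] by (simp add: cycles_def cell_chains_all)
    qed
    show "z = (\<lambda>b. \<Sum>j\<in>J. j * real_chain (q j) b)" unfolding real_chain_def by (rule J(4))
  qed
qed

text \<open>The projection is defined over the reals, agrees with the rational \<open>\<psi>\<^sub>L\<close> on rational cycles and is
constant on classes, so it induces a real-linear extension of it. There is no other one since every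
real cycle is a real combination of rational cycles.\<close>

lemma psi_eq:
  assumes L: "spanning_cotree X d L" and z: "z \<in> cycles X (cw_cells X) low_deg"
  shows "psi X d L (z +o row_span top_cells bd_matrix) = proj (L \<inter> low_cells) z"
proof -
  let ?BQ = "row_span top_cells bd_matrix :: ('c \<Rightarrow> rat) set"
    and ?BR = "row_span top_cells bd_matrix :: ('c \<Rightarrow> real) set"
  let ?ZQ = "cycles X (cw_cells X) low_deg :: ('c \<Rightarrow> rat) set"
    and ?ZR = "cycles X (cw_cells X) low_deg :: ('c \<Rightarrow> real) set"
  let ?p = "proj (L \<inter> low_cells) :: ('c \<Rightarrow> real) \<Rightarrow> 'c \<Rightarrow> real"
  have cot: "cotree_set (L \<inter> low_cells)" by (rule spanning_cotree_imp_cotree_set[OF L])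
  have BR: "additive_subgroup ?BR" by (rule submod_additive_subgroup[OF submod_row_span])
  let ?P = "\<lambda>g. g \<in> extensional ((\<lambda>z. z +o ?BR) ` ?ZR) \<and>
      mod_hom class_ring (quot_module ?ZR ?BR) (fun_module ?ZR) g \<and>
      (\<forall>x\<in>(\<lambda>z. z +o ?BQ) ` ?ZQ. g (real_class X low_deg x) = real_chain (psi_rat X d L x))"
  have psi: "psi X d L = The ?P"
    unfolding psi_def Let_def homology_def boundaries_row_span carrier_quot_module by (rule refl)
  have p_coset: "?p x = ?p y" if "x +o ?BR = y +o ?BR" for x y
  proof -
    have "(\<lambda>c. x c - y c) \<in> ?BR"
      using iffD1[OF coset_eq_iff[OF BR] that] by (simp add: fun_diff_def)
    from proj_row_span[OF cot this] have "(\<lambda>c. ?p x c - ?p y c) = (\<lambda>_. 0)"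
      by (simp only: proj_diff)
    then show ?thesis by (simp add: fun_eq_iff)
  qed
  \<comment> \<open>The map induced by the projection, computed on a chosen representative of each class.\<close>
  define g where "g = (\<lambda>S\<in>(\<lambda>z. z +o ?BR) ` ?ZR. ?p (SOME z. z \<in> ?ZR \<and> S = z +o ?BR))"
  have g: "g (w +o ?BR) = ?p w" if w: "w \<in> ?ZR" for w
  proof -
    have "(SOME z. z \<in> ?ZR \<and> w +o ?BR = z +o ?BR) \<in> ?ZR \<and>
        w +o ?BR = (SOME z. z \<in> ?ZR \<and> w +o ?BR = z +o ?BR) +o ?BR"
      by (rule someI[of _ w]) (use w in simp)
    from p_coset[OF conjunct2[OF this, symmetric]]
    have "?p (SOME z. z \<in> ?ZR \<and> w +o ?BR = z +o ?BR) = ?p w" .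
    then show ?thesis using w by (simp add: g_def)
  qed
  have rat: "real_chain (psi_rat X d L (q +o ?BQ)) = ?p (real_chain q)" if "q \<in> ?ZQ" for q
    unfolding psi_rat_eq[OF L that] unfolding real_chain_def by (rule proj_of_rat[symmetric])
  have "?P g"
  proof (intro conjI ballI)
    show "g \<in> extensional ((\<lambda>z. z +o ?BR) ` ?ZR)" by (simp add: g_def)
    show "mod_hom class_ring (quot_module ?ZR ?BR) (fun_module ?ZR) g"
    proof (rule mod_hom_quot_fun[where h = ?p and g = g])
      show "submod ?ZR" "submod ?ZR" "submod ?BR" by (rule submod_cycles submod_row_span)+
      show "g (w +o ?BR) = ?p w" if "w \<in> ?ZR" for w by (rule g[OF that])
      show "?p w \<in> ?ZR" if "w \<in> ?ZR" for w
        using proj_cycles[OF cot that] cycles_subset_iff[of _ L] by blast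
      show "?p (x + y) = ?p x + ?p y" for x y
        by (simp add: plus_fun_def proj_add)
      show "?p (\<lambda>a. r * x a) = (\<lambda>a. r * ?p x a)" for r x by (rule proj_scale)
    qed
    fix x assume "x \<in> (\<lambda>z. z +o ?BQ) ` ?ZQ"
    then obtain q where q: "q \<in> ?ZQ" "x = q +o ?BQ" by blast
    show "g (real_class X low_deg x) = real_chain (psi_rat X d L x)"
      unfolding q(2) real_class_eq rat[OF q(1)] by (rule g[OF real_chain_cycles[OF q(1)]])
  qed
  moreover have "h = g" if h: "?P h" for h
  proof (rule extensionalityI)
    show "h \<in> extensional ((\<lambda>z. z +o ?BR) ` ?ZR)" using h by blast
    show "g \<in> extensional ((\<lambda>z. z +o ?BR) ` ?ZR)" by (simp add: g_def)
    interpret h: mod_hom "class_ring :: real ring" "quot_module ?ZR ?BR" "fun_module ?ZR" h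
      using h by blast
    have rat_h: "h (real_chain q +o ?BR) = ?p (real_chain q)" if "q \<in> ?ZQ" for q
      using h that rat[OF that] real_class_eq[of q] by auto
    have add: "h ((x + y) +o ?BR) = h (x +o ?BR) + h (y +o ?BR)" if "x \<in> ?ZR" "y \<in> ?ZR" for x y
      using h.f_add[of "x +o ?BR" "y +o ?BR"] that
      by (simp add: carrier_quot_module add_quot_module[OF submod_row_span] fun_module_def)
    have scale: "h ((\<lambda>a. r * x a) +o ?BR) = (\<lambda>a. r * h (x +o ?BR) a)" if "x \<in> ?ZR" for r x
      using h.f_smult[of r "x +o ?BR"] that
      by (simp add: carrier_quot_module smult_quot_module[OF submod_row_span] fun_module_def)
    fix S assume "S \<in> (\<lambda>z. z +o ?BR) ` ?ZR"
    then obtain w where w: "w \<in> ?ZR" "S = w +o ?BR" by blast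
    obtain J q where J: "finite J" "\<And>j. j \<in> J \<Longrightarrow> q j \<in> ?ZQ" "w = (\<lambda>b. \<Sum>j\<in>J. j * real_chain (q j) b)"
      by (fact real_cycle_decomposition[OF w(1)])
    have "(\<lambda>b. \<Sum>j\<in>T. j * real_chain (q j) b) \<in> ?ZR \<and>
        h ((\<lambda>b. \<Sum>j\<in>T. j * real_chain (q j) b) +o ?BR) = ?p (\<lambda>b. \<Sum>j\<in>T. j * real_chain (q j) b)"
      if "finite T" "T \<subseteq> J" for T
      using that
    proof (induction T)
      case empty
      have "h (0 +o ?BR) = 0"
        using scale[OF submod_0[OF submod_cycles], of 0] by (simp add: zero_fun_def)
      moreover have "?p (\<lambda>_. 0) = (\<lambda>_. 0)" by (simp add: proj_def)
      ultimately show ?case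
        using submod_0[OF submod_cycles, of X "cw_cells X" low_deg] by (simp add: zero_fun_def)
    next
      case (insert j T)
      let ?a = "\<lambda>b. j * real_chain (q j) b" and ?b = "\<lambda>b. \<Sum>j\<in>T. j * real_chain (q j) b"
      have eq: "(\<lambda>b. \<Sum>j\<in>insert j T. j * real_chain (q j) b) = ?a + ?b"
        using insert.hyps by (simp add: fun_eq_iff)
      have qj: "q j \<in> ?ZQ" using J(2) insert.prems by blast
      then have a: "?a \<in> ?ZR" by (intro submod_scale[OF submod_cycles] real_chain_cycles)
      have b: "?b \<in> ?ZR" "h (?b +o ?BR) = ?p ?b" using insert by auto
      have "h (?a +o ?BR) = ?p ?a"
        unfolding scale[OF real_chain_cycles[OF qj]] rat_h[OF qj] proj_scale by (rule refl)
      then have "h ((?a + ?b) +o ?BR) = ?p (?a + ?b)"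
        using add[OF a b(1)] b(2) proj_add[of "L \<inter> low_cells" ?a ?b] by (simp add: plus_fun_def)
      then show ?case unfolding eq using submod_add[OF submod_cycles a b(1)] by blast
    qed
    from this[OF J(1) order_refl] show "h S = g S"
      unfolding w(2) g[OF w(1)] J(3)[symmetric] by blast
  qed
  ultimately have "The ?P = g" by (rule the_equality)
  then show ?thesis using g[OF z] by (simp only: psi)
qed

section \<open>The adjoint boundary operator\<close>

text \<open>The adjoint exists and is unique since the \<open>d\<close>-cells are orthonormal, which justifies its description
by \<open>THE\<close>; its kernel is the orthogonal complement of the image of the boundary operator.\<close>

lemma bd_adjoint_zero_iff:
  "bd_adjoint_E X d E \<beta> \<rho> = 0 \<longleftrightarrow>
    (\<forall>v\<in>row_span top_cells bd_matrix. chain_inner_E X d E \<beta> v \<rho> = 0)"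
proof -
  let ?C = "supported_on top_cells :: ('c \<Rightarrow> real) set"
  let ?P = "\<lambda>w. w \<in> ?C \<and> (\<forall>y\<in>?C. chain_inner X (int d) y w = chain_inner_E X d E \<beta> (bd X (int d) y) \<rho>)"
  have adj: "bd_adjoint_E X d E \<beta> \<rho> = The ?P"
    by (simp add: bd_adjoint_E_def cell_chains_all)
  have unique: "w = w'" if "?P w" "?P w'" for w w'
  proof
    fix c show "w c = w' c"
    proof (cases "c \<in> top_cells")
      case True
      let ?e = "\<lambda>a. if a = c then 1 else (0::real)"
      have "chain_inner X (int d) ?e u = u c" for u
        using True finite_kcells by (simp add: chain_inner_def if_distrib[of "\<lambda>x. x * _"] cong: if_cong)
      moreover have "?e \<in> ?C" using True by (auto simp: supported_on_def)
      ultimately show ?thesis using that by metis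
    next
      case False
      then show ?thesis using that by (simp add: supported_on_def)
    qed
  qed
  \<comment> \<open>The entry of the adjoint at \<open>c\<close> is the weighted inner product of \<open>\<rho>\<close> with the boundary of \<open>c\<close>.\<close>
  define w0 where "w0 = (\<lambda>c. if c \<in> top_cells then chain_inner_E X d E \<beta> (\<lambda>a. of_int (bd_matrix c a)) \<rho> else 0)"
  have w0: "?P w0"
  proof (intro conjI ballI)
    show "w0 \<in> ?C" by (simp add: w0_def supported_on_def)
    fix y
    have "chain_inner X (int d) y w0 = (\<Sum>c\<in>top_cells. \<Sum>b\<in>low_cells. exp (\<beta> * E b) * (of_int (bd_matrix c b) * y c * \<rho> b))"
      by (simp add: chain_inner_def w0_def chain_inner_E_def sum_distrib_left ac_simps)
    also have "\<dots> = chain_inner_E X d E \<beta> (bd X (int d) y) \<rho>"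
      by (subst sum.swap) (simp add: chain_inner_E_def bd_eq sum_distrib_left sum_distrib_right)
    finally show "chain_inner X (int d) y w0 = chain_inner_E X d E \<beta> (bd X (int d) y) \<rho>" .
  qed
  have "The ?P = w0"
    by (rule the_equality[of ?P, OF w0]) (rule unique[OF _ w0])
  with w0 have P: "?P (The ?P)" by simp
  show ?thesis
  proof
    assume 0: "bd_adjoint_E X d E \<beta> \<rho> = 0"
    show "\<forall>v\<in>row_span top_cells bd_matrix. chain_inner_E X d E \<beta> v \<rho> = 0"
    proof
      fix v :: "'c \<Rightarrow> real" assume "v \<in> row_span top_cells bd_matrix"
      then obtain y where y: "y \<in> ?C" "v = bd X (int d) y"
        unfolding boundaries_row_span[symmetric] by (auto simp: boundaries_def cell_chains_all)
      then have "chain_inner_E X d E \<beta> v \<rho> = chain_inner X (int d) y 0"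
        using P 0 adj by simp
      then show "chain_inner_E X d E \<beta> v \<rho> = 0" by (simp add: chain_inner_def)
    qed
  next
    assume orth: "\<forall>v\<in>row_span top_cells bd_matrix. chain_inner_E X d E \<beta> v \<rho> = 0"
    have "?P 0"
    proof (intro conjI ballI)
      fix y :: "'c \<Rightarrow> real" assume "y \<in> ?C"
      then have "bd X (int d) y \<in> row_span top_cells bd_matrix"
        unfolding boundaries_row_span[symmetric] by (simp add: boundaries_def cell_chains_all)
      then show "chain_inner X (int d) y 0 = chain_inner_E X d E \<beta> (bd X (int d) y) \<rho>"
        using orth by (simp add: chain_inner_def)
    qed (simp add: supported_on_def)
    then show "bd_adjoint_E X d E \<beta> \<rho> = 0" unfolding adj by (rule unique[OF P])
  qed
qed

section \<open>The Hodge representative\<close>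

text \<open>The weights and \<open>\<Psi>\<close> expressed by the incidence matrix alone: the sums run over sets of \<open>(d-1)\<close>-cells,
and \<open>mean_proj\<close> acts on chains instead of classes.\<close>

definition weight :: "('c \<Rightarrow> real) \<Rightarrow> real \<Rightarrow> 'c set \<Rightarrow> real" where
  "weight E \<beta> L = (real (lattice_index L))\<^sup>2 * (\<Prod>b\<in>L. exp (- \<beta> * E b))"

definition mean_proj :: "('c \<Rightarrow> real) \<Rightarrow> real \<Rightarrow> ('c \<Rightarrow> real) \<Rightarrow> 'c \<Rightarrow> real" where
  "mean_proj E \<beta> z = (\<lambda>b. 1 / nabla X d E \<beta> * (\<Sum>L | cotree_set L. weight E \<beta> L * proj L z b))"

lemma tau_weight: "spanning_cotree X d L \<Longrightarrow> tau X d E \<beta> L = weight E \<beta> (L \<inter> low_cells)"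
  by (simp add: tau_def weight_def cotree_index_eq spanning_cotree_iff)

lemma nabla_eq: "nabla X d E \<beta> = (\<Sum>L | cotree_set L. weight E \<beta> L)"
proof -
  have "nabla X d E \<beta> = (\<Sum>L | spanning_cotree X d L. weight E \<beta> (L \<inter> low_cells))"
    unfolding nabla_def by (intro sum.cong refl) (simp add: tau_weight)
  then show ?thesis by (simp only: sum_spanning_cotrees)
qed

lemma nabla_pos: "nabla X d E \<beta> > 0"
proof -
  obtain L where "cotree_set L" using cotree_set_exists by blast
  moreover have "weight E \<beta> L > 0" if "cotree_set L" for L
    unfolding weight_def using lattice_index_pos[OF that] by (intro mult_pos_pos prod_pos) auto
  ultimately show ?thesis
    unfolding nabla_eq using finite_cotree_sets by (intro sum_pos) auto
qed

lemma Psi_eq: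
  assumes "z \<in> cycles X (cw_cells X) low_deg"
  shows "Psi X d E \<beta> (z +o row_span top_cells bd_matrix) = mean_proj E \<beta> z"
proof
  fix b
  have "(\<Sum>L | spanning_cotree X d L. tau X d E \<beta> L * psi X d L (z +o row_span top_cells bd_matrix) b) =
      (\<Sum>L | spanning_cotree X d L. weight E \<beta> (L \<inter> low_cells) * proj (L \<inter> low_cells) z b)"
    by (intro sum.cong refl) (simp add: tau_weight psi_eq[OF _ assms])
  also have "\<dots> = (\<Sum>L | cotree_set L. weight E \<beta> L * proj L z b)"
    by (rule sum_spanning_cotrees)
  finally show "Psi X d E \<beta> (z +o row_span top_cells bd_matrix) b = mean_proj E \<beta> z b"
    by (simp add: Psi_def mean_proj_def)
qed

lemma mean_proj_add: "mean_proj E \<beta> (x + y) = mean_proj E \<beta> x + mean_proj E \<beta> y"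
  unfolding mean_proj_def plus_fun_def proj_add by (simp add: distrib_left sum.distrib add_divide_distrib)

lemma mean_proj_scale: "mean_proj E \<beta> (\<lambda>a. r * x a) = (\<lambda>a. r * mean_proj E \<beta> x a)"
  unfolding mean_proj_def proj_scale by (simp add: sum_distrib_left ac_simps)

text \<open>The weights add up to \<open>\<nabla>\<close>, so this is a combination of the differences \<open>z - p\<^sub>L z\<close>.\<close>

lemma mean_proj_coset: "(\<lambda>b. z b - mean_proj E \<beta> z b) \<in> row_span top_cells bd_matrix"
proof -
  have "z b - mean_proj E \<beta> z b =
      (\<Sum>L | cotree_set L. weight E \<beta> L / nabla X d E \<beta> * (z b - proj L z b))" for b
  proof -
    have "(\<Sum>L | cotree_set L. weight E \<beta> L / nabla X d E \<beta> * (z b - proj L z b)) =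
        (\<Sum>L | cotree_set L. weight E \<beta> L) / nabla X d E \<beta> * z b - mean_proj E \<beta> z b"
      by (simp add: mean_proj_def right_diff_distrib sum_subtractf sum_distrib_right sum_divide_distrib)
    then show ?thesis using nabla_pos[of E \<beta>] by (simp flip: nabla_eq)
  qed
  moreover have "(\<lambda>b. \<Sum>L | cotree_set L. weight E \<beta> L / nabla X d E \<beta> * (z b - proj L z b)) \<in> row_span top_cells bd_matrix"
    by (rule row_span_lincomb[OF finite_cotree_sets]) (simp add: diff_proj_row_span)
  ultimately show ?thesis by simp
qed

lemma mean_proj_cycles:
  assumes "z \<in> cycles X (cw_cells X) low_deg"
  shows "mean_proj E \<beta> z \<in> cycles X (cw_cells X) low_deg"
proof -
  have "(\<lambda>b. z b - mean_proj E \<beta> z b) \<in> cycles X (cw_cells X) low_deg"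
    using mean_proj_coset row_span_cycles by blast
  from additive_subgroup_diff[OF submod_additive_subgroup[OF submod_cycles] assms this]
  show ?thesis by (simp add: fun_diff_def)
qed

lemma mean_proj_orthogonal:
  assumes "z \<in> supported_on low_cells" "v \<in> row_span top_cells bd_matrix"
  shows "chain_inner_E X d E \<beta> v (mean_proj E \<beta> z) = 0"
proof -
  let ?s = "\<lambda>f. \<Sum>L | cotree_set L. weight E \<beta> L * proj L z f"
  have "chain_inner_E X d E \<beta> v (mean_proj E \<beta> z) =
      1 / nabla X d E \<beta> * (\<Sum>f\<in>low_cells. exp (\<beta> * E f) * (?s f * v f))"
    by (simp add: chain_inner_E_def mean_proj_def sum_distrib_left ac_simps)
  also have "(\<Sum>f\<in>low_cells. exp (\<beta> * E f) * (?s f * v f)) = 0"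
    unfolding weight_def
    by (rule cotree_average_orthogonal[OF assms]) (simp flip: exp_add)
  finally show ?thesis by simp
qed

lemma orthogonal_boundary_zero:
  assumes "v \<in> row_span top_cells bd_matrix" "chain_inner_E X d E \<beta> v v = 0"
  shows "v = 0"
proof
  fix f
  show "v f = 0 f"
  proof (cases "f \<in> low_cells")
    case True
    have "\<forall>f\<in>low_cells. exp (\<beta> * E f) * (v f * v f) = 0"
      using assms(2) finite_cols unfolding chain_inner_E_def by (subst (asm) sum_nonneg_eq_0_iff) auto
    then show ?thesis using True by auto
  next
    case False
    then show ?thesis using supported_onD[OF row_span_supported[OF assms(1)] False] by simp
  qed
qed

lemma chain_inner_E_diff:
  "chain_inner_E X d E \<beta> v (x - y) = chain_inner_E X d E \<beta> v x - chain_inner_E X d E \<beta> v y"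
  by (simp add: chain_inner_E_def right_diff_distrib sum_subtractf)

text \<open>The weighted mean of the projections of a cycle represents its class and is orthogonal to the
boundaries. Any other such representative differs from it by a boundary orthogonal to itself, that is, by zero.\<close>

theorem hodge_representative:
  shows "mod_hom (class_ring :: real ring) (homology X (cw_cells X) low_deg)
      (fun_module (cycles X (cw_cells X) low_deg)) (Psi X d E \<beta>)"
    and "x \<in> carrier (homology X (cw_cells X) low_deg :: (real, ('c \<Rightarrow> real) set) module) \<Longrightarrow>
      (\<rho> \<in> cycles X (cw_cells X) low_deg \<and> \<rho> \<in> x \<and> bd_adjoint_E X d E \<beta> \<rho> = 0) \<longleftrightarrow> \<rho> = Psi X d E \<beta> x"
proof -
  let ?B = "row_span top_cells bd_matrix :: ('c \<Rightarrow> real) set"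
  have B: "additive_subgroup ?B" by (rule submod_additive_subgroup[OF submod_row_span])
  show "mod_hom (class_ring :: real ring) (homology X (cw_cells X) low_deg)
      (fun_module (cycles X (cw_cells X) low_deg)) (Psi X d E \<beta>)"
    unfolding homology_def boundaries_row_span
    by (rule mod_hom_quot_fun[where h = "mean_proj E \<beta>"])
      (rule submod_cycles submod_row_span Psi_eq mean_proj_cycles mean_proj_add mean_proj_scale; assumption)+
  assume "x \<in> carrier (homology X (cw_cells X) low_deg :: (real, ('c \<Rightarrow> real) set) module)"
  then obtain z where z: "z \<in> cycles X (cw_cells X) low_deg" "x = z +o ?B"
    unfolding homology_def boundaries_row_span carrier_quot_module by blast
  have Psi: "Psi X d E \<beta> x = mean_proj E \<beta> z" unfolding z(2) by (rule Psi_eq[OF z(1)])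
  have zm: "z - mean_proj E \<beta> z \<in> ?B"
    using mean_proj_coset[of z E \<beta>] by (simp add: fun_diff_def)
  show "(\<rho> \<in> cycles X (cw_cells X) low_deg \<and> \<rho> \<in> x \<and> bd_adjoint_E X d E \<beta> \<rho> = 0) \<longleftrightarrow> \<rho> = Psi X d E \<beta> x"
  proof
    assume \<rho>: "\<rho> \<in> cycles X (cw_cells X) low_deg \<and> \<rho> \<in> x \<and> bd_adjoint_E X d E \<beta> \<rho> = 0"
    then have "\<rho> - z \<in> ?B" using coset_in_iff[OF B] z(2) by blast
    from additive_subgroup_add[OF B this zm]
    have v: "\<rho> - mean_proj E \<beta> z \<in> ?B" by simp
    have "chain_inner_E X d E \<beta> (\<rho> - mean_proj E \<beta> z) (\<rho> - mean_proj E \<beta> z) = 0"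
      unfolding chain_inner_E_diff using \<rho> v mean_proj_orthogonal[OF cycles_supported[OF z(1)] v]
      unfolding bd_adjoint_zero_iff by simp
    from orthogonal_boundary_zero[OF v this] show "\<rho> = Psi X d E \<beta> x" by (simp add: Psi)
  next
    assume "\<rho> = Psi X d E \<beta> x"
    then have \<rho>: "\<rho> = mean_proj E \<beta> z" by (simp only: Psi)
    have "mean_proj E \<beta> z - z \<in> ?B" using additive_subgroup_neg[OF B zm] by simp
    then have "\<rho> \<in> x" unfolding \<rho> z(2) coset_in_iff[OF B] .
    moreover have "bd_adjoint_E X d E \<beta> \<rho> = 0"
      unfolding \<rho> bd_adjoint_zero_iff
      using mean_proj_orthogonal[OF cycles_supported[OF z(1)]] by blast
    ultimately show "\<rho> \<in> cycles X (cw_cells X) low_deg \<and> \<rho> \<in> x \<and> bd_adjoint_E X d E \<beta> \<rho> = 0"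
      using mean_proj_cycles[OF z(1)] unfolding \<rho> by blast
  qed
qed

end

theorem theorem1:
  fixes X :: "('a, 'c) cw_complex" and d :: nat and E :: "'c \<Rightarrow> real" and \<beta> :: real
  assumes "finite_cw_complex X"
    and "connected_space (cw_top X)"
    and "1 \<le> d" and "d \<le> cw_dimension X"
    and "\<beta> > 0"
  shows "nabla X d E \<beta> \<noteq> 0 \<and>
    mod_hom (class_ring :: real ring) (homology X (cw_cells X) (int d - 1))
      (fun_module (cycles X (cw_cells X) (int d - 1))) (Psi X d E \<beta>) \<and>
    (\<forall>x \<in> carrier (homology X (cw_cells X) (int d - 1) :: (real, ('c \<Rightarrow> real) set) module).
       \<forall>\<rho> :: 'c \<Rightarrow> real.
         (\<rho> \<in> cycles X (cw_cells X) (int d - 1) \<and> \<rho> \<in> x \<and> bd_adjoint_E X d E \<beta> \<rho> = 0)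
           \<longleftrightarrow> \<rho> = Psi X d E \<beta> x)"
proof -
  interpret cw_degree X d
    by (rule cw_degree.intro[OF assms(1)]) (unfold_locales, rule assms(3))
  show ?thesis
    using nabla_pos[of E \<beta>] hodge_representative by (intro conjI ballI allI) auto
qed

end
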